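(* Let $n\ge 2$, let $-1+\frac n2<s_1<s_2$, and let $\mathbb A=(a_{kj}^{\alpha\beta})$ be a constant real tensor satisfying the symmetry and relaxed ellipticity conditions stated in the context. (i) If $(\mathbf u,p)\in\dot{\mathbf H}_{\#\sigma}^{s_1}\times\dot H_\#^{s_1-1}$ is a solution of the anisotropic incompressible Navier-Stokes equation $$-\boldsymbol{\mathcal L}(\mathbf u,p)=\mathbf f-(\mathbf u\cdot\nabla)\mathbf u$$ on the torus $\mathbb T$ (in the sense of distributions) with a right-hand side $\mathbf f\in\dot{\mathbf H}_\#^{s_2-2}$, then $(\mathbf u,p)\in\dot{\mathbf H}_{\#\sigma}^{s_2}\times\dot H_\#^{s_2-1}$. (ii) Moreover, if $(\mathbf u,p)\in\dot{\mathbf H}_{\#\sigma}^{s_1}\times\dot H_\#^{s_1-1}$ is a solution of this equation with $\mathbf f\in(\dot{\mathcal C}_\#^\infty)^n$, then $(\mathbf u,p)\in(\dot{\mathcal C}_\#^\infty)^n\times\dot{\mathcal C}_\#^\infty$.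
   Context: Summation over repeated indices from $1$ to $n$ is used. Function spaces. $\mathbb T=[0,1)^n$ is the $n$-dimensional flat torus; functions and distributions on $\mathbb T$ (real- or complex-valued) are identified with $1$-periodic ones on $\mathbb R^n$. $\mathcal C_\#^\infty$ is the space of $1$-periodic $C^\infty$ functions; $\mathcal D'_\#$ is its dual (periodic distributions). Fourier coefficients: $\hat g(\boldsymbol\xi)=\int_{\mathbb T}e^{-2\pi i\mathbf x\cdot\boldsymbol\xi}g(\mathbf x)\,d\mathbf x$, $\boldsymbol\xi\in\mathbb Z^n$, extended to $g\in\mathcal D'_\#$. Let $|\boldsymbol\xi|$ be the Euclidean norm and $\rho(\boldsymbol\xi)=(1+|\boldsymbol\xi|^2)^{1/2}$. For $s\in\mathbb R$, $H_\#^s$ is the space of $g\in\mathcal D'_\#$ with finite norm $\|g\|_{H_\#^s}=\big(\sum_{\boldsymbol\xi\in\mathbb Z^n}\rho(\boldsymbol\xi)^{2s}|\hat g(\boldsymbol\xi)|^2\big)^{1/2}$; $\dot H_\#^s=\{g\in H_\#^s:\langle g,1\rangle_{\mathbb T}=0\}$ and $\dot{\mathcal C}_\#^\infty=\{g\in\mathcal C_\#^\infty:\langle g,1\rangle_{\mathbb T}=0\}$. Bold letters denote spaces of $n$-component vectors: $\mathbf H_\#^s=(H_\#^s)^n$, $\dot{\mathbf H}_\#^s=(\dot H_\#^s)^n$, and $\dot{\mathbf H}_{\#\sigma}^s=\{\mathbf w\in\dot{\mathbf H}_\#^s:\operatorname{div}\mathbf w=0\}$. Viscosity tensor. $\mathbb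 A=(a_{kj}^{\alpha\beta})_{1\le k,j,\alpha,\beta\le n}$ has constant real components, with symmetries $a_{kj}^{\alpha\beta}=a_{\alpha j}^{k\beta}=a_{k\beta}^{\alpha j}$, and satisfies the relaxed ellipticity condition: there is $C_{\mathbb A}>0$ such that $a_{kj}^{\alpha\beta}\zeta_{k\alpha}\zeta_{j\beta}\ge C_{\mathbb A}^{-1}|\boldsymbol\zeta|^2$ for all real $n\times n$ matrices $\boldsymbol\zeta=(\zeta_{k\alpha})$ with $\boldsymbol\zeta=\boldsymbol\zeta^\top$ and $\sum_{k=1}^n\zeta_{kk}=0$, where $|\boldsymbol\zeta|^2=\zeta_{k\alpha}\zeta_{k\alpha}$. Stokes operator. $(\boldsymbol{\mathfrak L}\mathbf u)_k=\partial_\alpha\big(a_{kj}^{\alpha\beta}E_{j\beta}(\mathbf u)\big)=\partial_\alpha\big(a_{kj}^{\alpha\beta}\partial_\beta u_j\big)$, $k=1,\dots,n$, where $E_{j\beta}(\mathbf u)=\frac12(\partial_ju_\beta+\partial_\beta u_j)$, and $\boldsymbol{\mathcal L}(\mathbf u,p)=\boldsymbol{\mathfrak L}\mathbf u-\nabla p$. Nonlinear term. Since $s_1>-1+n/2\ge 0$, $\mathbf u$ is square integrable on $\mathbb T$, and for divergence-free $\mathbf u$ the term $(\mathbf u\cdot\nabla)\mathbf u$ is understood as the distribution with components $\partial_j(u_ju_k)$, $k=1,\dots,n$. *)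

theory Defs
  imports "HOL-Analysis.Analysis"
begin

subsection \<open>Smooth periodic functions\<close>

definition partial :: "'n \<Rightarrow> (real^'n::finite \<Rightarrow> complex) \<Rightarrow> real^'n \<Rightarrow> complex" where
  "partial i f x = vector_derivative (\<lambda>t. f (x + t *\<^sub>R axis i 1)) (at 0)"

definition iter_partial :: "'n list \<Rightarrow> (real^'n::finite \<Rightarrow> complex) \<Rightarrow> real^'n \<Rightarrow> complex" where
  "iter_partial is f = foldr partial is f"

text \<open>A function is smooth iff all its iterated partial derivatives (including itself) are
  Frechet differentiable everywhere; in particular they are then all continuous.\<close>

definition smooth :: "(real^'n::finite \<Rightarrow> complex) \<Rightarrow> bool" where
  "smooth f \<longleftrightarrow> (\<forall>is. iter_partial is f differentiable_on UNIV)"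

definition periodic :: "(real^'n::finite \<Rightarrow> complex) \<Rightarrow> bool" where
  "periodic f \<longleftrightarrow> (\<forall>x i. f (x + axis i 1) = f x)"

definition Cinf_per :: "(real^'n::finite \<Rightarrow> complex) set" where
  "Cinf_per = {f. smooth f \<and> periodic f}"

definition Cm_norm :: "nat \<Rightarrow> (real^'n::finite \<Rightarrow> complex) \<Rightarrow> real" where
  "Cm_norm m f = (SUP (is, x) \<in> {is. length is \<le> m} \<times> UNIV. cmod (iter_partial is f x))"

definition torus :: "(real^'n::finite) set" where
  "torus = {x. \<forall>i. 0 \<le> x $ i \<and> x $ i < 1}"

subsection \<open>Periodic distributions\<close>

text \<open>A periodic distribution is represented by a functional on all functions, of which only the
  values on \<^const>\<open>Cinf_per\<close> are relevant. Accordingly, two distributions are equal iff they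
  agree on \<^const>\<open>Cinf_per\<close>. Distributions are complex-valued, the pairing is bilinear (not
  sesquilinear), and real-valued distributions are included as a special case.\<close>

type_synonym 'n pdist = "(real^'n \<Rightarrow> complex) \<Rightarrow> complex"

definition periodic_distributions :: "('n::finite pdist) set" where
  "periodic_distributions = {g.
     (\<forall>\<phi>\<in>Cinf_per. \<forall>\<psi>\<in>Cinf_per. g (\<lambda>x. \<phi> x + \<psi> x) = g \<phi> + g \<psi>) \<and>
     (\<forall>c. \<forall>\<phi>\<in>Cinf_per. g (\<lambda>x. c * \<phi> x) = c * g \<phi>) \<and>
     (\<exists>m C. \<forall>\<phi>\<in>Cinf_per. cmod (g \<phi>) \<le> C * Cm_norm m \<phi>)}"

definition pdist_eq :: "'n::finite pdist \<Rightarrow> 'n pdist \<Rightarrow> bool" where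
  "pdist_eq g h \<longleftrightarrow> (\<forall>\<phi>\<in>Cinf_per. g \<phi> = h \<phi>)"

definition dist_of_fun :: "(real^'n::finite \<Rightarrow> complex) \<Rightarrow> 'n pdist" where
  "dist_of_fun F \<phi> = (LINT x:torus|lborel. F x * \<phi> x)"

definition dist_deriv :: "'n \<Rightarrow> 'n::finite pdist \<Rightarrow> 'n pdist" where
  "dist_deriv i g \<phi> = - g (partial i \<phi>)"

definition real_vec :: "int^'n::finite \<Rightarrow> real^'n" where
  "real_vec \<xi> = (\<chi> i. real_of_int (\<xi> $ i))"

definition fourier_coeff :: "'n::finite pdist \<Rightarrow> int^'n \<Rightarrow> complex" where
  "fourier_coeff g \<xi> = g (\<lambda>x. exp (- 2 * pi * \<i> * complex_of_real (x \<bullet> real_vec \<xi>)))"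

subsection \<open>Function spaces\<close>

definition bessel_weight :: "int^'n::finite \<Rightarrow> real" where
  "bessel_weight \<xi> = sqrt (1 + (norm (real_vec \<xi>))\<^sup>2)"

definition H_per :: "real \<Rightarrow> ('n::finite pdist) set" where
  "H_per s = {g \<in> periodic_distributions.
     (\<lambda>\<xi>. bessel_weight \<xi> powr (2 * s) * (cmod (fourier_coeff g \<xi>))\<^sup>2) summable_on UNIV}"

definition Hdot_per :: "real \<Rightarrow> ('n::finite pdist) set" where
  "Hdot_per s = {g \<in> H_per s. g (\<lambda>_. 1) = 0}"

definition Hdot_per_vec :: "real \<Rightarrow> ('n::finite pdist ^ 'n) set" where
  "Hdot_per_vec s = {w. \<forall>k. w $ k \<in> Hdot_per s}"

definition dist_div :: "'n::finite pdist ^ 'n \<Rightarrow> 'n pdist" where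
  "dist_div w \<phi> = (\<Sum>i\<in>UNIV. dist_deriv i (w $ i) \<phi>)"

definition Hdot_per_sigma :: "real \<Rightarrow> ('n::finite pdist ^ 'n) set" where
  "Hdot_per_sigma s = {w \<in> Hdot_per_vec s. pdist_eq (dist_div w) (\<lambda>_. 0)}"

text \<open>The distributions that are (given by) a smooth periodic function with zero mean.\<close>

definition Cinfdot_per :: "('n::finite pdist) set" where
  "Cinfdot_per = {g. (\<exists>F\<in>Cinf_per. pdist_eq g (dist_of_fun F)) \<and> g (\<lambda>_. 1) = 0}"

definition Cinfdot_per_vec :: "('n::finite pdist ^ 'n) set" where
  "Cinfdot_per_vec = {w. \<forall>k. w $ k \<in> Cinfdot_per}"

subsection \<open>Viscosity tensor\<close>

text \<open>The component with lower indices \<open>k\<close>, \<open>j\<close> and upper indices \<open>\<alpha>\<close>, \<open>\<beta>\<close> is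
  \<open>a k j \<alpha> \<beta>\<close>.\<close>

type_synonym 'n tensor4 = "'n \<Rightarrow> 'n \<Rightarrow> 'n \<Rightarrow> 'n \<Rightarrow> real"

definition tensor_symmetric :: "'n tensor4 \<Rightarrow> bool" where
  "tensor_symmetric a \<longleftrightarrow>
     (\<forall>k j \<alpha> \<beta>. a k j \<alpha> \<beta> = a \<alpha> j k \<beta> \<and> a k j \<alpha> \<beta> = a k \<beta> \<alpha> j)"

definition relaxed_elliptic :: "'n::finite tensor4 \<Rightarrow> bool" where
  "relaxed_elliptic a \<longleftrightarrow> (\<exists>C>0. \<forall>\<zeta>::real^'n^'n. \<zeta> = transpose \<zeta> \<and> trace \<zeta> = 0 \<longrightarrow>
     (\<Sum>k\<in>UNIV. \<Sum>j\<in>UNIV. \<Sum>\<alpha>\<in>UNIV. \<Sum>\<beta>\<in>UNIV. a k j \<alpha> \<beta> * \<zeta> $ k $ \<alpha> * \<zeta> $ j $ \<beta>)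
       \<ge> inverse C * (\<Sum>k\<in>UNIV. \<Sum>\<alpha>\<in>UNIV. \<zeta> $ k $ \<alpha> * \<zeta> $ k $ \<alpha>))"

subsection \<open>The Navier-Stokes system\<close>

definition strain :: "'n::finite pdist ^ 'n \<Rightarrow> 'n \<Rightarrow> 'n \<Rightarrow> 'n pdist" where
  "strain u j \<beta> \<phi> = (dist_deriv j (u $ \<beta>) \<phi> + dist_deriv \<beta> (u $ j) \<phi>) / 2"

definition viscous_op :: "'n::finite tensor4 \<Rightarrow> 'n pdist ^ 'n \<Rightarrow> 'n pdist ^ 'n" where
  "viscous_op a u = (\<chi> k. (\<lambda>\<phi>. \<Sum>\<alpha>\<in>UNIV.
     dist_deriv \<alpha> (\<lambda>\<psi>. \<Sum>j\<in>UNIV. \<Sum>\<beta>\<in>UNIV. complex_of_real (a k j \<alpha> \<beta>) * strain u j \<beta> \<psi>) \<phi>))"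

definition stokes_op :: "'n::finite tensor4 \<Rightarrow> 'n pdist ^ 'n \<Rightarrow> 'n pdist \<Rightarrow> 'n pdist ^ 'n" where
  "stokes_op a u p = (\<chi> k. (\<lambda>\<phi>. (viscous_op a u $ k) \<phi> - dist_deriv k p \<phi>))"

definition L2_density_of :: "(real^'n::finite \<Rightarrow> complex) \<Rightarrow> 'n pdist \<Rightarrow> bool" where
  "L2_density_of U g \<longleftrightarrow> set_borel_measurable lborel torus U \<and>
     set_integrable lborel torus (\<lambda>x. (cmod (U x))\<^sup>2) \<and> pdist_eq g (dist_of_fun U)"

text \<open>A square integrable distribution determines its density up to a null set, so the choice
  made here does not affect products. For distributions that are not square integrable the
  density, and hence the product below, is an arbitrary value without meaning.\<close>

definition L2_density :: "'n::finite pdist \<Rightarrow> real^'n \<Rightarrow> complex" where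
  "L2_density g = (SOME U. L2_density_of U g)"

definition dist_mult :: "'n::finite pdist \<Rightarrow> 'n pdist \<Rightarrow> 'n pdist" where
  "dist_mult g h = dist_of_fun (\<lambda>x. L2_density g x * L2_density h x)"

text \<open>Conservative form of the convective term \<open>(u \<cdot> \<nabla>) u\<close>, for divergence-free \<open>u\<close>.\<close>

definition convection :: "'n::finite pdist ^ 'n \<Rightarrow> 'n pdist ^ 'n" where
  "convection u = (\<chi> k. (\<lambda>\<phi>. \<Sum>j\<in>UNIV. dist_deriv j (dist_mult (u $ j) (u $ k)) \<phi>))"

definition navier_stokes_solution ::
    "'n::finite tensor4 \<Rightarrow> 'n pdist ^ 'n \<Rightarrow> 'n pdist ^ 'n \<Rightarrow> 'n pdist \<Rightarrow> bool" where
  "navier_stokes_solution a f u p \<longleftrightarrow>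
     (\<forall>k. pdist_eq (\<lambda>\<phi>. - (stokes_op a u p $ k) \<phi>)
                   (\<lambda>\<phi>. (f $ k) \<phi> - (convection u $ k) \<phi>))"

end

theory Submission
  imports Defs
begin

text \<open>Everything is transferred to Fourier coefficients. Testing the transformed system with the
  conjugate of \<open>\<hat>u(\<xi>)\<close> removes the pressure, testing it with \<open>\<xi>\<close> then recovers the
  pressure, and relaxed ellipticity on the symmetric trace-free matrix \<open>(\<xi>\<^sub>k v\<^sub>\<alpha> + \<xi>\<^sub>\<alpha> v\<^sub>k) / 2\<close> gives \<open>\<bar>\<xi>\<bar>\<^sup>2 \<bar>\<hat>u(\<xi>)\<bar> + \<bar>\<xi>\<bar> \<bar>\<hat>p(\<xi>)\<bar> \<le> C \<bar>\<hat>h(\<xi>)\<bar>\<close> with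
  \<open>h = f - div (u \<otimes> u)\<close>. If \<open>u\<close> is in \<open>H\<^sup>s\<close> with \<open>s > n/2 - 1\<close>, then \<open>u \<otimes> u\<close> is in
  \<open>H\<^sup>t\<close> whenever \<open>t \<le> s\<close> and \<open>t < 2s - n/2\<close>: the product of the three Bessel weights is controlled
  by a single weight to the power \<open>t - 2s\<close>, which is square summable, so Young's inequality applies.
  Taking \<open>t = s - 1 + \<delta>\<close> with a fixed small \<open>\<delta> > 0\<close>, each step gains \<open>\<delta>\<close> derivatives. The passage
  between distributions, their square integrable densities and their Fourier coefficients rests on
  the completeness of the characters (by Stone-Weierstrass) and the Riesz-Fischer theorem.\<close>

subsection \<open>The torus as a probability space\<close>

text \<open>The exponent \<open>n/2 - 1\<close> is where the gain runs out: with
  \<open>t = s - 1 + \<delta>\<close> the condition \<open>t < 2 s - n/2\<close> reads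
  \<open>\<delta> < s + 1 - n/2\<close>. Since \<open>s\<close> only grows, a gain chosen at
  \<open>s1\<close> serves every later step. For \<open>s\<close> at most \<open>n/2\<close> the
  space need not be an algebra and \<open>u\<close> need not be bounded, so the product is estimated
  with a loss of derivatives in general; the divergence costs one more, and inverting the Stokes
  symbol returns two. A distribution is a functional on all functions of which only the values on
  \<open>Cinf_per\<close> count, and \<open>dist_mult\<close> goes through a density picked by a
  choice operator. Densities therefore enter the estimates only through their Fourier coefficients,
  and the equation is tested with characters alone. That the coefficients determine a distribution
  is used in two places: to identify a distribution with a square integrable density, and to
  recognise one with rapidly decreasing coefficients as a smooth function.\<close>

definition torus_measure :: "(real^'n::finite) measure" where
  "torus_measure = restrict_space lborel torus"

lemma torus_borel [measurable]: "torus \<in> sets borel"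
proof -
  have "torus = (\<Inter>i::'n. {x::real^'n. 0 \<le> x $ i} \<inter> {x. x $ i < 1})"
    by (auto simp: torus_def)
  also have "\<dots> \<in> sets borel"
    by (intro sets.countable_INT'' sets.Int borel_closed borel_open closed_Collect_le open_Collect_less
        continuous_intros) auto
  finally show ?thesis .
qed

text \<open>The half-open cube lies between the open and the closed unit box, both of volume
  one.\<close>

lemma emeasure_torus: "emeasure lborel (torus :: (real^'n::finite) set) = 1"
proof -
  have box: "box 0 1 \<subseteq> (torus :: (real^'n) set)" and cbox: "torus \<subseteq> cbox 0 (1 :: real^'n)"
    by (auto simp: torus_def mem_box_cart less_imp_le)
  have prod: "(\<Prod>b\<in>Basis. (1 :: real^'n) \<bullet> b) = 1"
    by (rule prod.neutral) (auto simp: Basis_vec_def inner_axis)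
  have le: "\<And>b. b \<in> Basis \<Longrightarrow> (0 :: real^'n) \<bullet> b \<le> 1 \<bullet> b"
    by (auto simp: Basis_vec_def inner_axis)
  have "emeasure lborel (torus :: (real^'n) set) \<le> emeasure lborel (cbox 0 (1 :: real^'n))"
    by (rule emeasure_mono[OF cbox]) auto
  also have "\<dots> = 1"
    using emeasure_lborel_cbox[OF le] prod by simp
  finally have 1: "emeasure lborel (torus :: (real^'n) set) \<le> 1" .
  have "1 = emeasure lborel (box 0 (1 :: real^'n))"
    using emeasure_lborel_box[OF le] prod by simp
  also have "\<dots> \<le> emeasure lborel (torus :: (real^'n) set)"
    by (rule emeasure_mono[OF box]) (auto intro: torus_borel)
  finally show ?thesis using 1 by (intro antisym)
qed

lemma space_torus_measure [simp]: "space torus_measure = torus"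
  by (simp add: torus_measure_def space_restrict_space)

lemma emeasure_torus_measure [simp]: "emeasure torus_measure torus = 1"
  by (simp add: torus_measure_def emeasure_restrict_space emeasure_torus)

lemma finite_torus_measure: "finite_measure torus_measure"
  by (rule finite_measureI) simp

lemma measure_torus_measure [simp]: "measure torus_measure torus = 1"
  by (simp add: measure_def)

lemma borel_imp_torus_measurable:
  "f \<in> borel_measurable borel \<Longrightarrow> f \<in> borel_measurable torus_measure"
  unfolding torus_measure_def by (intro measurable_restrict_space1) simp

lemma integrable_torus_iff:
  fixes f :: "real^'n::finite \<Rightarrow> 'b::{banach, second_countable_topology}"
  shows "integrable torus_measure f \<longleftrightarrow> set_integrable lborel torus f"
  unfolding torus_measure_def set_integrable_def
  by (rule integrable_restrict_space) simp

lemma integral_torus_eq: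
  fixes f :: "real^'n::finite \<Rightarrow> 'b::{banach, second_countable_topology}"
  shows "integral\<^sup>L torus_measure f = set_lebesgue_integral lborel torus f"
  unfolding torus_measure_def set_lebesgue_integral_def
  by (rule integral_restrict_space) simp

lemma integrable_torus_bounded:
  fixes f :: "real^'n::finite \<Rightarrow> 'b::{banach, second_countable_topology}"
  assumes "f \<in> borel_measurable torus_measure" and "\<And>x. norm (f x) \<le> B"
  shows "integrable torus_measure f"
  using finite_measure.integrable_const_bound[OF finite_torus_measure _ assms(1), of B] assms(2)
  by auto

text \<open>The bound also covers a non-integrable \<open>f\<close>, whose integral has the default
  value 0.\<close>

lemma norm_integral_torus_le:
  fixes f :: "real^'n::finite \<Rightarrow> 'b::{banach, second_countable_topology}"
  assumes "\<And>x. norm (f x) \<le> B" "0 \<le> B"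
  shows "norm (integral\<^sup>L torus_measure f) \<le> B"
proof -
  interpret finite_measure "torus_measure :: (real^'n) measure" by (rule finite_torus_measure)
  have "norm (integral\<^sup>L torus_measure f) \<le> (\<integral>x. norm (f x) \<partial>torus_measure)"
    by simp
  also have "\<dots> \<le> (\<integral>x. B \<partial>(torus_measure :: (real^'n) measure))"
    using assms by (intro integral_mono') auto
  also have "\<dots> = B" by simp
  finally show ?thesis .
qed

lemma integrable_torus_mult_bounded:
  fixes f g :: "real^'n::finite \<Rightarrow> complex"
  assumes f: "integrable torus_measure f" and g: "g \<in> borel_measurable torus_measure"
    and B: "\<And>x. cmod (g x) \<le> B"
  shows "integrable torus_measure (\<lambda>x. f x * g x)"
proof (rule Bochner_Integration.integrable_bound)
  show "integrable torus_measure (\<lambda>x. B * cmod (f x))" using f by auto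
  show "(\<lambda>x. f x * g x) \<in> borel_measurable torus_measure"
    using f g by measurable
  show "AE x in torus_measure. norm (f x * g x) \<le> norm (B * cmod (f x))"
  proof (rule AE_I2)
    fix x
    have "0 \<le> B" using B[of x] norm_ge_zero[of "g x"] by linarith
    then show "norm (f x * g x) \<le> norm (B * cmod (f x))"
      using mult_left_mono[OF B[of x], of "cmod (f x)"] by (simp add: norm_mult abs_mult ac_simps)
  qed
qed

subsection \<open>Characters\<close>

lemma real_vec_component [simp]: "real_vec \<xi> $ i = real_of_int (\<xi> $ i)"
  by (simp add: real_vec_def)

lemma real_vec_add: "real_vec (\<xi> + \<eta>) = real_vec \<xi> + real_vec \<eta>"
  and real_vec_minus [simp]: "real_vec (- \<xi>) = - real_vec \<xi>"
  and real_vec_zero [simp]: "real_vec 0 = 0"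
  by (auto simp: vec_eq_iff)

definition character :: "int^'n::finite \<Rightarrow> real^'n \<Rightarrow> complex" where
  "character \<xi> x = cis (2 * pi * (x \<bullet> real_vec \<xi>))"

lemma fourier_coeff_eq: "fourier_coeff g \<xi> = g (character (- \<xi>))"
  unfolding fourier_coeff_def
  by (rule arg_cong[where f=g]) (auto simp: fun_eq_iff character_def cis_conv_exp ac_simps)

lemma character_0 [simp]: "character 0 = (\<lambda>_. 1)"
  by (auto simp: character_def)

lemma norm_character [simp]: "cmod (character \<xi> x) = 1"
  by (simp add: character_def)

lemma character_add: "character (\<xi> + \<eta>) x = character \<xi> x * character \<eta> x"
  by (simp add: character_def cis_mult real_vec_add inner_add_right ring_distribs)

lemma character_mult_minus [simp]: "character \<xi> x * character (- \<xi>) x = 1"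
  by (simp flip: character_add)

lemma cnj_character: "cnj (character \<xi> x) = character (- \<xi>) x"
  by (simp add: character_def cis_cnj)

lemma character_plus: "character \<xi> (x + y) = character \<xi> x * character \<xi> y"
  by (simp add: character_def cis_mult inner_add_left ring_distribs)

lemma character_axis: "character \<xi> (t *\<^sub>R axis i 1) = cis (2 * pi * t * real_of_int (\<xi> $ i))"
  by (simp add: character_def inner_axis inner_commute ac_simps)

lemma continuous_on_character [continuous_intros]: "continuous_on A (character \<xi>)"
  unfolding character_def cis_conv_exp by (intro continuous_intros)

lemma character_measurable [measurable]: "character \<xi> \<in> borel_measurable borel"
  by (intro borel_measurable_continuous_onI continuous_on_character)

lemma character_torus_measurable [measurable]: "character \<xi> \<in> borel_measurable torus_measure"
  by (intro borel_imp_torus_measurable character_measurable)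

lemma periodic_character: "periodic (character \<xi>)"
  using character_axis[of \<xi> 1] cis_multiple_2pi[OF Ints_of_int]
  by (simp add: periodic_def character_plus)

lemma integrable_character [simp]: "integrable torus_measure (character \<xi>)"
  by (rule integrable_torus_bounded[where B=1]) auto

text \<open>The function counterpart of \<open>fourier_coeff\<close>;
  \<open>fourier_coeff_dist_of_fun\<close> identifies the two.\<close>

definition torus_coeff :: "(real^'n::finite \<Rightarrow> complex) \<Rightarrow> int^'n \<Rightarrow> complex" where
  "torus_coeff f \<xi> = (\<integral>x. f x * character (- \<xi>) x \<partial>torus_measure)"

lemma integrable_mult_character:
  "integrable torus_measure f \<Longrightarrow> integrable torus_measure (\<lambda>x. f x * character \<xi> x)"
  by (rule integrable_torus_mult_bounded[where B=1]) auto

lemma dist_of_fun_eq: "dist_of_fun f \<phi> = (\<integral>x. f x * \<phi> x \<partial>torus_measure)"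
  by (simp add: dist_of_fun_def integral_torus_eq)

lemma fourier_coeff_dist_of_fun: "fourier_coeff (dist_of_fun f) = torus_coeff f"
  by (auto simp: fun_eq_iff fourier_coeff_eq dist_of_fun_eq torus_coeff_def)

subsection \<open>Translation invariance\<close>

text \<open>Shifting the cube by \<open>t\<close> along one axis trades the slab \<open>R\<close> at
  the lower face for its translate \<open>Q\<close> by one period, and periodicity of
  \<open>f\<close> makes their integrals equal. This gives both the orthogonality of the characters
  and the coefficients of a derivative.\<close>

lemma integral_torus_translate_axis:
  fixes f :: "real^'n::finite \<Rightarrow> complex"
  assumes f: "f \<in> borel_measurable borel" and B: "\<And>x. cmod (f x) \<le> B"
    and per: "\<And>x. f (x + axis i 1) = f x" and t: "0 \<le> t" "t \<le> 1"
  shows "(\<integral>x. f (x + t *\<^sub>R axis i 1) \<partial>torus_measure) = integral\<^sup>L torus_measure f"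
proof -
  define P where "P = {x \<in> torus. t \<le> x $ i}"
  define R where "R = {x \<in> torus. x $ i < t}"
  define Q where "Q = {x. x - axis i 1 \<in> R}"
  have [measurable]: "f \<in> borel_measurable borel" by (rule f)
  have [measurable]: "(\<lambda>x :: real^'n. x $ i) \<in> borel_measurable borel"
    by (intro borel_measurable_continuous_onI continuous_intros)
  have [measurable]: "P \<in> sets borel" "R \<in> sets borel" "Q \<in> sets borel"
    unfolding P_def R_def Q_def by measurable
  have tr: "(\<integral>x. g (x + c) \<partial>lborel) = integral\<^sup>L lborel g"
    if [measurable]: "g \<in> borel_measurable borel" for g :: "real^'n \<Rightarrow> complex" and c
  proof -
    have "integral\<^sup>L lborel g = integral\<^sup>L (distr lborel borel ((+) c)) g"
      by (simp add: lborel_distr_plus)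
    also have "\<dots> = (\<integral>x. g (c + x) \<partial>lborel)"
      by (subst integral_distr) auto
    finally show ?thesis by (simp add: add.commute)
  qed
  have fin: "integrable lborel (\<lambda>x. indicator A x *\<^sub>R f x)"
    if A: "A \<in> sets borel" and e: "emeasure lborel A \<le> 1" for A
  proof (rule Bochner_Integration.integrable_bound)
    show "integrable lborel (\<lambda>x. indicator A x *\<^sub>R B :: real)"
      using A e by (intro integrable_scaleR_left integrable_real_indicator) (auto intro: le_less_trans)
    show "(\<lambda>x. indicator A x *\<^sub>R f x) \<in> borel_measurable lborel"
      using A by measurable
    show "AE x in lborel. norm (indicator A x *\<^sub>R f x) \<le> norm (indicator A x *\<^sub>R B)"
      using order_trans[OF B abs_ge_self] by (auto split: split_indicator)
  qed
  have eP: "emeasure lborel P \<le> 1" and eR: "emeasure lborel R \<le> 1"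
    unfolding emeasure_torus[symmetric, where 'n='n] P_def R_def
    by (auto intro!: emeasure_mono)
  have "emeasure (distr lborel borel ((+) (- axis i 1))) R = emeasure lborel Q"
    by (subst emeasure_distr) (auto simp: Q_def vimage_def)
  then have eQ: "emeasure lborel Q \<le> 1" using eR by (simp add: lborel_distr_plus)
  have torus_PR: "indicator torus x = indicator P x + (indicator R x :: real)" for x
    by (auto simp: P_def R_def split: split_indicator)
  \<comment> \<open>The shifted cube is the part \<open>P\<close> that stays inside the torus
    together with the slab \<open>Q\<close> that sticks out beyond the upper face.\<close>
  have shift: "x - t *\<^sub>R axis i 1 \<in> torus \<longleftrightarrow> x \<in> P \<or> x \<in> Q" for x
  proof -
    have split: "(\<forall>k. Q k) \<longleftrightarrow> (\<forall>k. k \<noteq> i \<longrightarrow> Q k) \<and> Q i" for Q by metis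
    have "x - t *\<^sub>R axis i 1 \<in> torus \<longleftrightarrow> (\<forall>k. k \<noteq> i \<longrightarrow> 0 \<le> x $ k \<and> x $ k < 1) \<and> t \<le> x $ i \<and> x $ i < 1 + t"
      by (auto simp: torus_def axis_def split: if_splits)
    moreover have "x \<in> P \<longleftrightarrow> (\<forall>k. k \<noteq> i \<longrightarrow> 0 \<le> x $ k \<and> x $ k < 1) \<and> t \<le> x $ i \<and> x $ i < 1"
      unfolding P_def torus_def mem_Collect_eq by (subst split) (use t in auto)
    moreover have "x \<in> Q \<longleftrightarrow> (\<forall>k. k \<noteq> i \<longrightarrow> 0 \<le> x $ k \<and> x $ k < 1) \<and> 1 \<le> x $ i \<and> x $ i < 1 + t"
      using t by (auto simp: torus_def Q_def R_def axis_def split: if_splits)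
    ultimately show ?thesis using t by auto
  qed
  have disj: "x \<notin> Q" if "x \<in> P" for x
  proof -
    have "x $ i < 1" using that by (auto simp: P_def torus_def)
    then have "(x - axis i 1) $ i < 0" by simp
    then have "x - axis i 1 \<notin> torus" unfolding torus_def mem_Collect_eq not_le[symmetric] by metis
    then show ?thesis by (auto simp: Q_def R_def)
  qed
  have "(\<integral>x. f (x + t *\<^sub>R axis i 1) \<partial>torus_measure)
      = (\<integral>x. indicator torus x *\<^sub>R f (x + t *\<^sub>R axis i 1) \<partial>lborel)"
    by (simp add: integral_torus_eq set_lebesgue_integral_def)
  also have "\<dots> = (\<integral>x. indicator torus (x - t *\<^sub>R axis i 1) *\<^sub>R f x \<partial>lborel)"
    using tr[of "\<lambda>x. indicator torus (x - t *\<^sub>R axis i 1) *\<^sub>R f x" "t *\<^sub>R axis i 1"] by simp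
  also have "\<dots> = (\<integral>x. indicator P x *\<^sub>R f x + indicator Q x *\<^sub>R f x \<partial>lborel)"
    using shift disj by (intro Bochner_Integration.integral_cong) (auto split: split_indicator)
  also have "\<dots> = (\<integral>x. indicator P x *\<^sub>R f x \<partial>lborel) + (\<integral>x. indicator Q x *\<^sub>R f x \<partial>lborel)"
    using eP eQ by (intro Bochner_Integration.integral_add fin) auto
  also have "(\<integral>x. indicator Q x *\<^sub>R f x \<partial>lborel) = (\<integral>x. indicator R x *\<^sub>R f x \<partial>lborel)"
    using tr[of "\<lambda>x. indicator Q x *\<^sub>R f x" "axis i 1"]
    by (simp add: per Q_def indicator_def of_bool_def)
  also have "(\<integral>x. indicator P x *\<^sub>R f x \<partial>lborel) + (\<integral>x. indicator R x *\<^sub>R f x \<partial>lborel)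
      = (\<integral>x. indicator P x *\<^sub>R f x + indicator R x *\<^sub>R f x \<partial>lborel)"
    using eP eR by (intro Bochner_Integration.integral_add[symmetric] fin) auto
  also have "\<dots> = integral\<^sup>L torus_measure f"
    by (simp add: integral_torus_eq set_lebesgue_integral_def torus_PR scaleR_add_left)
  finally show ?thesis .
qed

text \<open>Along an axis with nonzero frequency component, \<open>t\<close> is half a wavelength:
  the shift changes the sign of the character but not its integral.\<close>

lemma integral_character:
  "integral\<^sup>L torus_measure (character \<xi>) = (if \<xi> = 0 then 1 else 0)"
proof (cases "\<xi> = 0")
  case False
  then obtain i where i: "\<xi> $ i \<noteq> 0" by (auto simp: vec_eq_iff)
  define t where "t = 1 / (2 * \<bar>real_of_int (\<xi> $ i)\<bar>)"
  have "1 \<le> \<bar>\<xi> $ i\<bar>" using i by linarith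
  then have "1 \<le> \<bar>real_of_int (\<xi> $ i)\<bar>" by linarith
  then have t: "0 \<le> t" "t \<le> 1" by (auto simp: t_def field_simps)
  have "2 * pi * t * real_of_int (\<xi> $ i) = pi \<or> 2 * pi * t * real_of_int (\<xi> $ i) = - pi"
    using i by (auto simp: t_def abs_if field_simps)
  then have m1: "character \<xi> (t *\<^sub>R axis i 1) = -1"
    unfolding character_axis by (elim disjE) (simp_all only: cis_pi, simp add: complex_eq_iff)
  have "integral\<^sup>L torus_measure (character \<xi>)
      = (\<integral>x. character \<xi> (x + t *\<^sub>R axis i 1) \<partial>torus_measure)"
    by (rule integral_torus_translate_axis[symmetric, where B=1])
       (use t periodic_character[of \<xi>] in \<open>auto simp: periodic_def\<close>)
  also have "\<dots> = - integral\<^sup>L torus_measure (character \<xi>)"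
    by (simp add: character_plus m1)
  finally show ?thesis using False by simp
qed simp

lemma torus_coeff_character: "torus_coeff (character \<eta>) \<xi> = (if \<xi> = \<eta> then 1 else 0)"
  using integral_character[of "\<eta> - \<xi>"]
  by (auto simp: torus_coeff_def character_add[symmetric])

subsection \<open>Uniqueness of Fourier coefficients\<close>

text \<open>Realises the torus inside a compact product of unit circles. There Stone-Weierstrass is
  available, and polynomials in the coordinates pull back to trigonometric polynomials.\<close>

definition torus_embed :: "real^'n::finite \<Rightarrow> complex^'n" where
  "torus_embed x = (\<chi> i. cis (2 * pi * x $ i))"

lemma continuous_on_torus_embed: "continuous_on A torus_embed"
  unfolding torus_embed_def cis_conv_exp by (intro continuous_intros)

lemma inj_on_torus_embed: "inj_on torus_embed torus"
proof (rule inj_onI)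
  fix x y :: "real^'n" assume xy: "x \<in> torus" "y \<in> torus" and eq: "torus_embed x = torus_embed y"
  have "x $ i = y $ i" for i
  proof -
    have "cis (2 * pi * x $ i) = cis (2 * pi * y $ i)"
      using arg_cong[OF eq, of "\<lambda>z. z $ i"] by (simp add: torus_embed_def)
    then have "cis (2 * pi * x $ i - 2 * pi * y $ i) = 1"
      by (simp flip: cis_divide)
    then have "cos (2 * pi * x $ i - 2 * pi * y $ i) = 1"
      by (auto simp: complex_eq_iff)
    then obtain n :: int where n: "2 * pi * x $ i - 2 * pi * y $ i = of_int n * 2 * pi"
      using cos_one_2pi_int[of "2 * pi * x $ i - 2 * pi * y $ i"] by auto
    then have "pi * (2 * (x $ i - y $ i)) = pi * (2 * of_int n)" by (simp add: algebra_simps)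
    then have d: "x $ i - y $ i = of_int n" by simp
    moreover have "0 \<le> x $ i" "x $ i < 1" "0 \<le> y $ i" "y $ i < 1"
      using xy by (auto simp: torus_def)
    ultimately have "n = 0" by linarith
    with d show ?thesis by simp
  qed
  then show "x = y" by (simp add: vec_eq_iff)
qed

lemma bounded_linear_torus_embed:
  fixes f :: "complex^'n::finite \<Rightarrow> real"
  assumes "bounded_linear f"
  obtains \<alpha> where "\<And>x. complex_of_real (f (torus_embed x)) =
    (\<Sum>i\<in>UNIV. \<alpha> i * character (axis i 1) x + cnj (\<alpha> i) * character (- axis i 1) x)"
proof
  interpret bounded_linear f by (rule assms)
  \<comment> \<open>Chosen so that \<open>\<alpha> z + cnj \<alpha> cnj z\<close>, twice the real
    part of \<open>\<alpha> z\<close>, is the given real-linear functional of \<open>z\<close> in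
    coordinate \<open>i\<close>. On the circle, \<open>z\<close> and \<open>cnj z\<close> are the
    characters of frequency plus and minus one.\<close>
  define \<alpha> where "\<alpha> i = Complex (f (axis i 1)) (- f (axis i \<i>)) / 2" for i
  fix x :: "real^'n"
  have rv: "real_vec (axis i 1 :: int^'n) = axis i 1" for i
    by (auto simp: vec_eq_iff axis_def)
  have ch: "character (axis i 1) x = torus_embed x $ i" for i
    by (simp add: character_def torus_embed_def rv inner_axis)
  have ch': "character (- axis i 1) x = cnj (torus_embed x $ i)" for i
    by (simp flip: ch add: cnj_character)
  have axis: "f (axis i z) = Re z * f (axis i 1) + Im z * f (axis i \<i>)" for i z
  proof -
    have "axis i z = Re z *\<^sub>R axis i 1 + Im z *\<^sub>R axis i \<i>"
      by (auto simp: vec_eq_iff axis_def complex_eq_iff)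
    then show ?thesis by (simp add: add scaleR)
  qed
  have "torus_embed x = (\<Sum>i\<in>UNIV. axis i (torus_embed x $ i))"
    by (simp add: vec_eq_iff axis_def if_distrib cong: if_cong)
  then have "f (torus_embed x) = (\<Sum>i\<in>UNIV. f (axis i (torus_embed x $ i)))"
    by (metis sum)
  moreover have "complex_of_real (f (axis i z)) = \<alpha> i * z + cnj (\<alpha> i) * cnj z" for i z
    by (subst axis) (simp add: \<alpha>_def complex_eq_iff field_simps)
  ultimately show "complex_of_real (f (torus_embed x)) =
      (\<Sum>i\<in>UNIV. \<alpha> i * character (axis i 1) x + cnj (\<alpha> i) * character (- axis i 1) x)"
    by (simp add: ch ch')
qed

text \<open>The functions to be shown null almost everywhere. Multiplication by a character only
  shifts the coefficients, so this class is stable under it; everything below builds on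
  that.\<close>

definition coeff_free :: "(real^'n::finite \<Rightarrow> complex) \<Rightarrow> bool" where
  "coeff_free V \<longleftrightarrow> integrable torus_measure V \<and> (\<forall>\<xi>. torus_coeff V \<xi> = 0)"

lemma coeff_free_add: "coeff_free V \<Longrightarrow> coeff_free W \<Longrightarrow> coeff_free (\<lambda>x. V x + W x)"
  by (simp add: coeff_free_def torus_coeff_def ring_distribs integrable_mult_character)

lemma coeff_free_cmult: "coeff_free V \<Longrightarrow> coeff_free (\<lambda>x. c * V x)"
  by (simp add: coeff_free_def torus_coeff_def mult.assoc)

lemma coeff_free_sum: "(\<And>i. i \<in> I \<Longrightarrow> coeff_free (V i)) \<Longrightarrow> coeff_free (\<lambda>x. \<Sum>i\<in>I. V i x)"
proof (induction I rule: infinite_finite_induct)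
  case (insert i I)
  then show ?case by (simp add: coeff_free_add)
qed (auto simp: coeff_free_def torus_coeff_def)

lemma coeff_free_character:
  assumes "coeff_free V" shows "coeff_free (\<lambda>x. V x * character \<eta> x)"
proof -
  have "torus_coeff (\<lambda>x. V x * character \<eta> x) \<xi> = torus_coeff V (\<xi> - \<eta>)" for \<xi>
    by (simp add: torus_coeff_def mult.assoc character_add[symmetric])
  with assms show ?thesis by (simp add: coeff_free_def integrable_mult_character)
qed

text \<open>Multiplying by a product of polynomials means multiplying twice in succession, which is
  why the induction keeps \<open>V\<close> arbitrary.\<close>

lemma coeff_free_polynomial:
  fixes q :: "complex^'n::finite \<Rightarrow> real"
  assumes "real_polynomial_function q" "coeff_free V"
  shows "coeff_free (\<lambda>x. V x * complex_of_real (q (torus_embed x)))"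
  using assms
proof (induction arbitrary: V)
  case (linear f)
  obtain \<alpha> where \<alpha>: "\<And>x. complex_of_real (f (torus_embed x)) =
    (\<Sum>i\<in>UNIV. \<alpha> i * character (axis i 1) x + cnj (\<alpha> i) * character (- axis i 1) x)"
    using bounded_linear_torus_embed[OF linear(1)] by blast
  have "coeff_free (\<lambda>x. \<Sum>i\<in>UNIV. \<alpha> i * (V x * character (axis i 1) x)
      + cnj (\<alpha> i) * (V x * character (- axis i 1) x))"
    by (intro coeff_free_sum coeff_free_add coeff_free_cmult coeff_free_character linear)
  also have "(\<lambda>x. \<Sum>i\<in>UNIV. \<alpha> i * (V x * character (axis i 1) x)
      + cnj (\<alpha> i) * (V x * character (- axis i 1) x))
      = (\<lambda>x. V x * complex_of_real (f (torus_embed x)))"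
    unfolding \<alpha> sum_distrib_left by (intro ext sum.cong) (auto simp: algebra_simps)
  finally show ?case .
next
  case (const c)
  then show ?case using coeff_free_cmult[of V "of_real c"] by (simp add: mult.commute)
next
  case (add f g)
  show ?case using coeff_free_add[OF add.IH[OF add.prems]] by (simp add: ring_distribs)
next
  case (mult f g)
  show ?case using mult.IH(2)[OF mult.IH(1)[OF mult.prems]] by (simp add: mult.assoc)
qed

text \<open>A polynomial within \<open>e\<close> of \<open>f\<close> on the compact set
  \<open>S\<close> contributes nothing to the integral, so what remains is at most \<open>e\<close>
  times the L1 norm of \<open>V\<close>.\<close>

lemma coeff_free_integral_continuous:
  fixes f :: "complex^'n::finite \<Rightarrow> real"
  assumes V: "coeff_free V" and f: "continuous_on UNIV f"
  shows "(\<integral>x. V x * complex_of_real (f (torus_embed x)) \<partial>torus_measure) = 0"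
proof -
  define S where "S = {z :: complex^'n. \<forall>i. cmod (z $ i) = 1}"
  define I where "I = (\<integral>x. V x * complex_of_real (f (torus_embed x)) \<partial>torus_measure)"
  have ES: "torus_embed x \<in> S" for x by (simp add: S_def torus_embed_def)
  have "S = (\<Inter>i. {z. cmod (z $ i) = 1})" by (auto simp: S_def)
  moreover have "closed {z :: complex^'n. cmod (z $ i) = 1}" for i
    by (intro closed_Collect_eq continuous_intros)
  ultimately have "closed S" by auto
  moreover have "bounded S"
    by (rule bounded_subset[OF bounded_cball[of 0 "real CARD('n)"]])
      (auto simp: S_def norm_vec_def intro!: order_trans[OF L2_set_le_sum])
  ultimately have S: "compact S" by (simp add: compact_eq_bounded_closed)
  have Vi: "integrable torus_measure V" using V by (simp add: coeff_free_def)
  obtain B where B: "\<And>z. z \<in> S \<Longrightarrow> \<bar>f z\<bar> \<le> B"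
    using compact_imp_bounded[OF compact_continuous_image[OF continuous_on_subset[OF f] S]]
    by (auto simp: bounded_iff)
  have "(\<lambda>x. complex_of_real (f (torus_embed x))) \<in> borel_measurable borel"
    by (intro borel_measurable_continuous_onI continuous_intros
        continuous_on_compose2[OF f continuous_on_torus_embed]) auto
  then have fi: "integrable torus_measure (\<lambda>x. V x * complex_of_real (f (torus_embed x)))"
    using B ES by (intro integrable_torus_mult_bounded[where B=B] Vi borel_imp_torus_measurable) auto
  have "cmod I \<le> e * (\<integral>x. cmod (V x) \<partial>torus_measure)" if e: "e > 0" for e
  proof -
    obtain q where q: "real_polynomial_function q" "\<And>z. z \<in> S \<Longrightarrow> \<bar>f z - q z\<bar> < e"
      using Stone_Weierstrass_real_polynomial_function[OF S continuous_on_subset[OF f subset_UNIV] e]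
      by blast
    have Vq: "coeff_free (\<lambda>x. V x * complex_of_real (q (torus_embed x)))"
      by (rule coeff_free_polynomial[OF q(1) V])
    then have qi: "integrable torus_measure (\<lambda>x. V x * complex_of_real (q (torus_embed x)))"
      and q0: "(\<integral>x. V x * complex_of_real (q (torus_embed x)) \<partial>torus_measure) = 0"
      by (auto simp: coeff_free_def torus_coeff_def dest: spec[of _ 0])
    have "I = (\<integral>x. V x * complex_of_real (f (torus_embed x))
        - V x * complex_of_real (q (torus_embed x)) \<partial>torus_measure)"
      using fi qi q0 by (simp add: I_def)
    also have "cmod \<dots> \<le> (\<integral>x. e * cmod (V x) \<partial>torus_measure)"
    proof (rule Bochner_Integration.integral_norm_bound_integral)
      fix x
      have "cmod (V x * complex_of_real (f (torus_embed x)) - V x * complex_of_real (q (torus_embed x)))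
          = cmod (V x) * \<bar>f (torus_embed x) - q (torus_embed x)\<bar>"
        by (simp flip: right_diff_distrib of_real_diff add: norm_mult)
      also have "\<dots> \<le> cmod (V x) * e"
        using q(2)[OF ES] by (intro mult_left_mono) (auto intro: less_imp_le)
      also have "\<dots> = e * cmod (V x)" by (rule mult.commute)
      finally show "norm (V x * complex_of_real (f (torus_embed x))
          - V x * complex_of_real (q (torus_embed x))) \<le> e * cmod (V x)" .
    qed (use fi qi Vi in auto)
    finally show ?thesis by simp
  qed
  note le = this
  define J where "J = (\<integral>x. cmod (V x) \<partial>torus_measure)"
  have J: "J \<ge> 0" unfolding J_def by (rule Bochner_Integration.integral_nonneg) simp
  have "cmod I \<le> 0"
  proof (rule field_le_epsilon)
    fix e :: real assume e: "e > 0"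
    \<comment> \<open>Dividing by \<open>J + 1\<close> rather than \<open>J\<close> keeps the choice
      legitimate when the L1 norm is zero.\<close>
    have "cmod I \<le> e / (J + 1) * J" using le[of "e / (J + 1)", folded J_def] e J by simp
    also have "\<dots> \<le> e" using e J by (simp add: field_simps)
    finally show "cmod I \<le> 0 + e" by simp
  qed
  then have "I = 0" by simp
  then show ?thesis by (simp add: I_def)
qed

text \<open>The indicator of a compact set is the pointwise limit of continuous cut-offs of a
  distance, dominated by 1. The distance is measured in the image of \<open>torus_embed\<close>,
  where the continuous case applies; injectivity on the torus makes the limit the indicator of
  \<open>K\<close> itself.\<close>

lemma coeff_free_integral_compact:
  fixes K :: "(real^'n::finite) set"
  assumes V: "coeff_free V" and K: "compact K" "K \<subseteq> torus"
  shows "(\<integral>x. indicator K x *\<^sub>R V x \<partial>torus_measure) = 0"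
proof (cases "K = {}")
  case False
  define C where "C = torus_embed ` K"
  define f where "f m z = max 0 (1 - real m * infdist z C)" for m and z :: "complex^'n"
  have C: "closed C" "C \<noteq> {}"
    using False compact_imp_closed[OF compact_continuous_image[OF continuous_on_torus_embed K(1)]]
    by (auto simp: C_def)
  have lim: "(\<lambda>m. f m z) \<longlonglongrightarrow> indicator C z" for z
  proof (cases "z \<in> C")
    case True
    then show ?thesis by (simp add: f_def)
  next
    case False
    then have pos: "infdist z C > 0" using C by (simp add: infdist_pos_not_in_closed)
    obtain N :: nat where N: "1 / infdist z C < real N" using reals_Archimedean2 by blast
    have "f m z = 0" if "m \<ge> N" for m
    proof -
      have "1 \<le> real N * infdist z C" using N pos by (simp add: divide_less_eq less_imp_le)
      also have "\<dots> \<le> real m * infdist z C" using that pos by simp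
      finally show ?thesis by (simp add: f_def)
    qed
    then have "eventually (\<lambda>m. f m z = 0) sequentially" by (auto simp: eventually_sequentially)
    with False show ?thesis by (simp add: tendsto_eventually)
  qed
  have Vi: "integrable torus_measure V" using V by (simp add: coeff_free_def)
  have cf: "continuous_on UNIV (f m)" for m unfolding f_def by (intro continuous_intros)
  have [measurable]: "(\<lambda>x. f m (torus_embed x)) \<in> borel_measurable torus_measure" for m
    by (intro borel_imp_torus_measurable borel_measurable_continuous_onI
        continuous_on_compose2[OF cf continuous_on_torus_embed]) auto
  have [measurable]: "K \<in> sets borel" using K by (simp add: compact_imp_closed)
  have "(\<lambda>x. indicator K x :: real) \<in> borel_measurable torus_measure"
    by (intro borel_imp_torus_measurable) measurable
  moreover have [measurable]: "V \<in> borel_measurable torus_measure" using Vi by auto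
  ultimately have m1: "(\<lambda>x. indicator K x *\<^sub>R V x) \<in> borel_measurable torus_measure"
    by measurable
  have "(\<lambda>m. \<integral>x. V x * complex_of_real (f m (torus_embed x)) \<partial>torus_measure)
      \<longlonglongrightarrow> (\<integral>x. indicator K x *\<^sub>R V x \<partial>torus_measure)"
  proof (rule integral_dominated_convergence[where w="\<lambda>x. cmod (V x)"])
    show "AE x in torus_measure.
      (\<lambda>m. V x * complex_of_real (f m (torus_embed x))) \<longlonglongrightarrow> indicator K x *\<^sub>R V x"
    proof (rule AE_I2)
      fix x :: "real^'n" assume "x \<in> space torus_measure"
      then have x: "x \<in> torus" by simp
      then have "torus_embed x \<in> C \<longleftrightarrow> x \<in> K"
        using inj_on_image_mem_iff[OF inj_on_torus_embed x K(2)] by (simp add: C_def)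
      then have "indicator K x *\<^sub>R V x = V x * complex_of_real (indicator C (torus_embed x))"
        by (auto split: split_indicator)
      then show "(\<lambda>m. V x * complex_of_real (f m (torus_embed x))) \<longlonglongrightarrow> indicator K x *\<^sub>R V x"
        by (simp only:) (intro tendsto_intros lim)
    qed
    show "AE x in torus_measure. norm (V x * complex_of_real (f m (torus_embed x))) \<le> cmod (V x)" for m
      using infdist_nonneg[of _ C] by (auto simp: norm_mult f_def intro!: AE_I2 mult_left_le)
  qed (use Vi m1 in \<open>auto\<close>)
  then show ?thesis
    by (simp add: coeff_free_integral_continuous[OF V cf] LIMSEQ_const_iff)
qed simp

text \<open>The vanishing of the integral spreads from compact subsets of the cube to closed sets,
  and from these to all Borel sets because closed sets form an intersection-stable generator. A
  function with zero integral over every Borel set is null.\<close>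

lemma coeff_free_AE_zero:
  fixes V :: "real^'n::finite \<Rightarrow> complex"
  assumes V: "coeff_free V"
  shows "AE x in torus_measure. V x = 0"
proof -
  define W where "W x = indicator torus x *\<^sub>R V x" for x
  have Vi: "integrable torus_measure V" using V by (simp add: coeff_free_def)
  then have Wi: "integrable lborel W"
    by (simp add: W_def[abs_def] integrable_torus_iff set_integrable_def)
  have Wt: "(\<integral>x. indicator K x *\<^sub>R V x \<partial>torus_measure) = (\<integral>x\<in>K. W x \<partial>lborel)" for K
    by (simp add: integral_torus_eq set_lebesgue_integral_def W_def mult.commute)
  have Wint: "set_integrable lborel A W" if "A \<in> sets borel" for A
    unfolding set_integrable_def using Wi that by (intro integrable_mult_indicator) auto
  have cl: "(\<integral>x\<in>K. W x \<partial>lborel) = 0" if "closed K" for K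
  proof -
    \<comment> \<open>The cube is not closed at its upper faces, so \<open>K\<close> is exhausted
      from inside; a point of the torus has all coordinates strictly below 1 and is eventually
      caught.\<close>
    define L where "L m = K \<inter> cbox 0 (\<chi> i. 1 - 1 / real (Suc m))" for m
    have L: "compact (L m)" "L m \<subseteq> torus" for m
    proof -
      show "compact (L m)" using that by (simp add: L_def closed_Int_compact)
      have less: "1 - 1 / real (Suc m) < 1" by (simp del: of_nat_Suc)
      show "L m \<subseteq> torus"
      proof
        fix x assume "x \<in> L m"
        then have "0 \<le> x $ i" "x $ i \<le> 1 - 1 / real (Suc m)" for i
          by (auto simp only: L_def mem_box_cart Int_iff vec_lambda_beta zero_index)
        then have "0 \<le> x $ i \<and> x $ i < 1" for i using le_less_trans[OF _ less] by blast
        then show "x \<in> torus" by (simp add: torus_def)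
      qed
    qed
    have [measurable]: "K \<in> sets borel" "L m \<in> sets borel" for m
      using that L by (auto simp: compact_imp_closed)
    have [measurable]: "W \<in> borel_measurable borel" using Wi by auto
    have "(\<lambda>m. \<integral>x. indicator (L m) x *\<^sub>R W x \<partial>lborel) \<longlonglongrightarrow> (\<integral>x. indicator K x *\<^sub>R W x \<partial>lborel)"
    proof (rule integral_dominated_convergence[where w="\<lambda>x. cmod (W x)"])
      show "AE x in lborel. (\<lambda>m. indicator (L m) x *\<^sub>R W x) \<longlonglongrightarrow> indicator K x *\<^sub>R W x"
      proof (rule AE_I2)
        fix x :: "real^'n"
        show "(\<lambda>m. indicator (L m) x *\<^sub>R W x) \<longlonglongrightarrow> indicator K x *\<^sub>R W x"
        proof (cases "x \<in> torus \<and> x \<in> K")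
          case True
          have "\<exists>N. \<forall>m\<ge>N. x $ i \<le> 1 - 1 / real (Suc m)" for i
          proof -
            have "1 - x $ i > 0" using True by (simp add: torus_def)
            then obtain N where N: "inverse (real (Suc N)) < 1 - x $ i"
              using reals_Archimedean by blast
            have "x $ i \<le> 1 - 1 / real (Suc m)" if "m \<ge> N" for m
            proof -
              have "1 / real (Suc m) \<le> inverse (real (Suc N))" using that by (simp add: field_simps)
              then show ?thesis using N by linarith
            qed
            then show ?thesis by blast
          qed
          then have "eventually (\<lambda>m. \<forall>i. x $ i \<le> 1 - 1 / real (Suc m)) sequentially"
            by (intro eventually_all_finite) (simp add: eventually_sequentially)
          then have "eventually (\<lambda>m. indicator (L m) x *\<^sub>R W x = indicator K x *\<^sub>R W x) sequentially"
            by eventually_elim (use True in \<open>auto simp: L_def mem_box_cart torus_def\<close>)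
          then show ?thesis by (rule tendsto_eventually)
        next
          case False
          then have "indicator (L m) x *\<^sub>R W x = 0" "indicator K x *\<^sub>R W x = 0" for m
            by (auto simp: W_def L_def split: split_indicator)
          then show ?thesis by (simp only: tendsto_const)
        qed
      qed
      show "AE x in lborel. norm (indicator (L m) x *\<^sub>R W x) \<le> cmod (W x)" for m
        by (auto split: split_indicator)
    qed (use Wi in auto)
    moreover have "(\<integral>x. indicator (L m) x *\<^sub>R W x \<partial>lborel) = 0" for m
      using coeff_free_integral_compact[OF V L] Wt[of "L m"] by (simp add: set_lebesgue_integral_def)
    ultimately show ?thesis
      by (simp add: set_lebesgue_integral_def LIMSEQ_const_iff)
  qed
  have "(\<integral>x\<in>A. W x \<partial>lborel) = 0" if "A \<in> sets lborel" for A
  proof -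
    have stable: "Int_stable {K :: (real^'n) set. closed K}"
      by (auto simp: Int_stable_def)
    have sig: "sets borel = sigma_sets UNIV {K :: (real^'n) set. closed K}"
      by (subst borel_eq_closed) simp
    have "{K :: (real^'n) set. closed K} \<subseteq> Pow UNIV" by simp
    moreover have "A \<in> sigma_sets UNIV {K :: (real^'n) set. closed K}" using that sig by simp
    ultimately show ?thesis
    proof (induction rule: sigma_sets_induct_disjoint[OF stable, consumes 2, case_names basic empty compl union])
      case (compl A)
      then have A: "A \<in> sets borel" by (simp add: sig)
      have "(\<integral>x\<in>UNIV. W x \<partial>lborel) = (\<integral>x\<in>A \<union> (UNIV - A). W x \<partial>lborel)" by simp
      also have "\<dots> = (\<integral>x\<in>A. W x \<partial>lborel) + (\<integral>x\<in>UNIV - A. W x \<partial>lborel)"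
        using A by (intro set_integral_Un Wint) auto
      finally show ?case using compl cl[of UNIV] by simp
    next
      case (union A)
      then have A: "\<And>i. A i \<in> sets borel" by (auto simp: sig)
      have "(\<integral>x\<in>(\<Union>i. A i). W x \<partial>lborel) = (\<Sum>i. (\<integral>x\<in>A i. W x \<partial>lborel))"
        using A union by (intro lebesgue_integral_countable_add Wint) (auto simp: disjoint_family_on_def)
      then show ?case using union by simp
    qed (use cl in \<open>auto simp: set_lebesgue_integral_def\<close>)
  qed
  then have "AE x in lborel. W x = 0" by (rule sigma_finite_measure.density_zero[OF sigma_finite_lborel Wi])
  then show ?thesis
    unfolding torus_measure_def by (subst AE_restrict_space_iff) (auto simp: W_def)
qed

subsection \<open>Summability of the Bessel weights\<close>

notation bessel_weight ("\<rho>")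

lemma bessel_weight_ge_1: "1 \<le> \<rho> \<xi>"
  by (simp add: bessel_weight_def)

lemma bessel_weight_pos [simp]: "0 < \<rho> \<xi>"
  using bessel_weight_ge_1[of \<xi>] by linarith

lemma bessel_weight_neq_0 [simp]: "\<rho> \<xi> \<noteq> 0"
  using bessel_weight_pos[of \<xi>] by linarith

lemma bessel_weight_nonneg [simp]: "0 \<le> \<rho> \<xi>"
  by (simp add: less_imp_le)

lemma norm_le_bessel_weight: "norm (real_vec \<xi>) \<le> \<rho> \<xi>"
  unfolding bessel_weight_def by (rule real_le_rsqrt) simp

lemma component_le_bessel_weight: "\<bar>real_of_int (\<xi> $ i)\<bar> \<le> \<rho> \<xi>"
  using order_trans[OF component_le_norm_cart norm_le_bessel_weight, of \<xi> i] by simp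

lemma bessel_weight_le: "\<rho> \<xi> \<le> 1 + (\<Sum>i\<in>UNIV. \<bar>real_of_int (\<xi> $ i)\<bar>)"
proof -
  have "\<rho> \<xi> \<le> 1 + norm (real_vec \<xi>)"
    unfolding bessel_weight_def by (rule real_le_lsqrt) (auto simp: power2_sum)
  also have "norm (real_vec \<xi>) \<le> (\<Sum>i\<in>UNIV. \<bar>real_of_int (\<xi> $ i)\<bar>)"
    using norm_le_l1_cart[of "real_vec \<xi>"] by simp
  finally show ?thesis by simp
qed

text \<open>The weight of \<open>\<xi>\<close> is the Euclidean norm of \<open>(1, \<xi>)\<close>.
  Raising the first entry of the sum from 1 to 2 only increases the norm, and then the triangle
  inequality applies.\<close>

lemma bessel_weight_sum_le: "\<rho> (\<xi> + \<eta>) \<le> \<rho> \<xi> + \<rho> \<eta>"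
proof -
  have *: "\<rho> \<zeta> = norm (1 :: real, real_vec \<zeta>)" for \<zeta> :: "int^'n"
    by (simp add: bessel_weight_def norm_Pair)
  have "\<rho> (\<xi> + \<eta>) \<le> norm ((1 :: real, real_vec \<xi>) + (1, real_vec \<eta>))"
    unfolding bessel_weight_def by (simp add: norm_Pair real_vec_add)
  also have "\<dots> \<le> \<rho> \<xi> + \<rho> \<eta>"
    unfolding * by (rule norm_triangle_ineq)
  finally show ?thesis .
qed

lemma summable_on_int_powr:
  assumes "a > (1/2 :: real)"
  shows "(\<lambda>z::int. (1 + (real_of_int z)\<^sup>2) powr (- a)) summable_on UNIV"
proof -
  define h where "h z = (1 + (real_of_int z)\<^sup>2) powr (- a)" for z
  have "summable (\<lambda>n. h (int n))"
  proof (rule summable_comparison_test)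
    show "summable (\<lambda>n. real n powr (- 2 * a))" using assms by (simp add: summable_real_powr_iff)
    have "norm (h (int n)) \<le> real n powr (- 2 * a)" if "n \<ge> 1" for n
    proof -
      have "h (int n) \<le> ((real n)\<^sup>2) powr (- a)"
        unfolding h_def using assms that by (intro powr_mono2') auto
      also have "\<dots> = real n powr (- 2 * a)"
        using that by (simp add: powr_powr flip: powr_numeral)
      finally show ?thesis by (simp add: h_def)
    qed
    then show "\<exists>N. \<forall>n\<ge>N. norm (h (int n)) \<le> real n powr (- 2 * a)" by blast
  qed
  then have 1: "(\<lambda>n. h (int n)) summable_on UNIV"
    by (rule summable_nonneg_imp_summable_on) (simp add: h_def)
  then have "h summable_on range int"
    by (subst summable_on_reindex) (auto simp: o_def)
  moreover from 1 have "h summable_on range (\<lambda>n. - int n)"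
    by (subst summable_on_reindex) (auto simp: o_def h_def inj_on_def)
  ultimately have "h summable_on (range int \<union> range (\<lambda>n. - int n))"
    by (rule summable_on_union)
  moreover have "z \<in> range int \<union> range (\<lambda>n. - int n)" for z
    by (cases z rule: int_cases2) auto
  then have "range int \<union> range (\<lambda>n. - int n) = UNIV" by blast
  ultimately show ?thesis by (simp add: h_def[abs_def])
qed

text \<open>Since \<open>1 + \<bar>\<xi>\<bar>\<^sup>2\<close> dominates each \<open>1 + \<xi>\<^sub>i\<^sup>2\<close>, it dominates their geometric mean; this decouples the
  coordinates and still gives the optimal exponent.\<close>

lemma summable_on_bessel_weight:
  assumes \<kappa>: "real CARD('n::finite) < 2 * \<kappa>"
  shows "(\<lambda>\<xi>::int^'n. \<rho> \<xi> powr (- 2 * \<kappa>)) summable_on UNIV"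
proof -
  define a where "a = \<kappa> / real CARD('n)"
  define h where "h z = (1 + (real_of_int z)\<^sup>2) powr (- a)" for z
  have a: "a > 1/2" using \<kappa> by (simp add: a_def field_simps)
  have hs: "h summable_on UNIV" unfolding h_def using summable_on_int_powr[OF a] by simp
  have h0: "0 \<le> h z" for z by (simp add: h_def)
  have le: "\<rho> \<xi> powr (- 2 * \<kappa>) \<le> (\<Prod>i\<in>UNIV. h (\<xi> $ i))" for \<xi> :: "int^'n"
  proof -
    have "\<rho> \<xi> powr (- 2 * \<kappa>) = ((\<rho> \<xi>)\<^sup>2) powr (- \<kappa>)"
      by (simp add: powr_powr flip: powr_numeral)
    also have "\<dots> = (((\<rho> \<xi>)\<^sup>2) powr (- a)) ^ CARD('n)"
    proof -
      define b where "b = ((\<rho> \<xi>)\<^sup>2) powr (- a)"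
      have "b > 0" using bessel_weight_pos[of \<xi>] by (simp add: b_def del: bessel_weight_pos)
      then have "b ^ CARD('n) = b powr real CARD('n)" by (simp add: powr_realpow)
      also have "\<dots> = ((\<rho> \<xi>)\<^sup>2) powr (- \<kappa>)" by (simp add: b_def powr_powr a_def)
      finally show ?thesis by (simp add: b_def)
    qed
    also have "\<dots> = (\<Prod>i\<in>(UNIV::'n set). ((\<rho> \<xi>)\<^sup>2) powr (- a))" by simp
    also have "\<dots> \<le> (\<Prod>i\<in>UNIV. h (\<xi> $ i))"
    proof (intro prod_mono conjI)
      fix i :: 'n
      have "(real_of_int (\<xi> $ i))\<^sup>2 \<le> (norm (real_vec \<xi>))\<^sup>2"
        using component_le_norm_cart[of "real_vec \<xi>" i] by (simp add: abs_le_square_iff[symmetric])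
      then show "((\<rho> \<xi>)\<^sup>2) powr (- a) \<le> h (\<xi> $ i)"
        unfolding h_def bessel_weight_def using a by (intro powr_mono2') (auto simp: add_pos_nonneg)
    qed auto
    finally show ?thesis .
  qed
  have "sum (\<lambda>\<xi>. \<Prod>i\<in>UNIV. h (\<xi> $ i)) F \<le> (infsum h UNIV) ^ CARD('n)" if F: "finite F"
    for F :: "(int^'n) set"
  proof -
    \<comment> \<open>A finite set of frequencies lies in the product of its coordinate projections,
      over which the sum of products factorises.\<close>
    define B where "B i = (\<lambda>\<xi>. \<xi> $ i) ` F" for i
    have inj: "inj_on (($) :: int^'n \<Rightarrow> _) F" by (auto simp: inj_on_def vec_eq_iff)
    have "sum (\<lambda>\<xi>. \<Prod>i\<in>UNIV. h (\<xi> $ i)) F = sum (\<lambda>g. \<Prod>i\<in>UNIV. h (g i)) (($) ` F)"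
      by (simp add: sum.reindex[OF inj])
    also have "\<dots> \<le> sum (\<lambda>g. \<Prod>i\<in>UNIV. h (g i)) (PiE UNIV B)"
      using F by (intro sum_mono2 prod_nonneg finite_PiE) (auto simp: B_def h0)
    also have "\<dots> = (\<Prod>i\<in>UNIV. \<Sum>z\<in>B i. h z)"
      using F by (intro prod_sum_PiE[symmetric]) (auto simp: B_def)
    also have "\<dots> \<le> (\<Prod>i\<in>(UNIV::'n set). infsum h UNIV)"
      using F hs by (intro prod_mono conjI finite_sum_le_infsum sum_nonneg) (auto simp: B_def h0)
    finally show ?thesis by simp
  qed
  then have "(\<lambda>\<xi>::int^'n. \<Prod>i\<in>UNIV. h (\<xi> $ i)) summable_on UNIV"
    by (intro nonneg_bdd_above_summable_on prod_nonneg bdd_aboveI2) (auto simp: h0)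
  then show ?thesis by (rule summable_on_comparison_test) (use le in auto)
qed

subsection \<open>Rapidly decreasing Fourier series\<close>

text \<open>Decay is expressed by weighted absolute summability because termwise differentiation and
  the seminorm bounds use exactly these sums; \<open>rapidI_bounded\<close> shows that boundedness
  of all weighted coefficients suffices.\<close>

definition rapid :: "(int^'n::finite \<Rightarrow> complex) \<Rightarrow> bool" where
  "rapid c \<longleftrightarrow> (\<forall>m. (\<lambda>\<xi>. \<rho> \<xi> ^ m * cmod (c \<xi>)) summable_on UNIV)"

definition fseries :: "(int^'n::finite \<Rightarrow> complex) \<Rightarrow> real^'n \<Rightarrow> complex" where
  "fseries c x = (\<Sum>\<^sub>\<infinity>\<xi>. c \<xi> * character \<xi> x)"

lemma rapidI_bounded:
  fixes c :: "int^'n::finite \<Rightarrow> complex"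
  assumes "\<And>m. \<exists>B. \<forall>\<xi>. \<rho> \<xi> ^ m * cmod (c \<xi>) \<le> B"
  shows "rapid c"
  unfolding rapid_def
proof
  fix m
  \<comment> \<open>One power more than the dimension: the remaining factor
    \<open>\<rho> \<xi> powr (- k)\<close> is then summable over the lattice.\<close>
  define k where "k = CARD('n) + 1"
  obtain B where B: "\<And>\<xi>. \<rho> \<xi> ^ (m + k) * cmod (c \<xi>) \<le> B" using assms by blast
  have "(\<lambda>\<xi>::int^'n. \<rho> \<xi> powr (- 2 * (real k / 2))) summable_on UNIV"
    by (rule summable_on_bessel_weight) (simp add: k_def)
  then have "(\<lambda>\<xi>::int^'n. B * \<rho> \<xi> powr (- real k)) summable_on UNIV"
    by (intro summable_on_cmult_right) simp
  then show "(\<lambda>\<xi>. \<rho> \<xi> ^ m * cmod (c \<xi>)) summable_on UNIV"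
  proof (rule summable_on_comparison_test)
    fix \<xi>
    have "\<rho> \<xi> ^ m * cmod (c \<xi>) = \<rho> \<xi> ^ (m + k) * cmod (c \<xi>) * \<rho> \<xi> powr (- real k)"
      by (simp add: powr_minus powr_realpow power_add field_simps)
    also have "\<dots> \<le> B * \<rho> \<xi> powr (- real k)"
      by (intro mult_right_mono B) auto
    finally show "\<rho> \<xi> ^ m * cmod (c \<xi>) \<le> B * \<rho> \<xi> powr (- real k)" .
  qed auto
qed

lemma rapid_mono:
  assumes "rapid c" and "\<And>\<xi>. cmod (d \<xi>) \<le> K * \<rho> \<xi> ^ k * cmod (c \<xi>)"
  shows "rapid d"
  unfolding rapid_def
proof
  fix m
  have "(\<lambda>\<xi>. K * (\<rho> \<xi> ^ (m + k) * cmod (c \<xi>))) summable_on UNIV"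
    using assms(1) unfolding rapid_def by (intro summable_on_cmult_right) blast
  then show "(\<lambda>\<xi>. \<rho> \<xi> ^ m * cmod (d \<xi>)) summable_on UNIV"
  proof (rule summable_on_comparison_test)
    fix \<xi>
    show "\<rho> \<xi> ^ m * cmod (d \<xi>) \<le> K * (\<rho> \<xi> ^ (m + k) * cmod (c \<xi>))"
      using mult_left_mono[OF assms(2), of "\<rho> \<xi> ^ m" \<xi>] by (simp add: power_add ac_simps)
  qed auto
qed

lemma rapid_summable: "rapid c \<Longrightarrow> (\<lambda>\<xi>. cmod (c \<xi>)) summable_on UNIV"
  by (auto simp: rapid_def dest: spec[of _ 0])

lemma rapid_deriv: "rapid c \<Longrightarrow> rapid (\<lambda>\<xi>. 2 * pi * \<i> * of_int (\<xi> $ i) * c \<xi>)"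
  by (rule rapid_mono[where K="2*pi" and k=1])
    (auto simp: norm_mult intro!: mult_right_mono component_le_bessel_weight)

lemma rapid_restrict: "rapid c \<Longrightarrow> rapid (\<lambda>\<xi>. if P \<xi> then c \<xi> else 0)"
  by (rule rapid_mono[where K=1 and k=0]) auto

lemma rapid_finite: "finite F \<Longrightarrow> rapid (\<lambda>\<xi>. if \<xi> \<in> F then c \<xi> else 0)"
  unfolding rapid_def
  by (auto intro!: finite_nonzero_values_imp_summable_on elim!: finite_subset[rotated] split: if_splits)

lemma abs_summable_character:
  "(\<lambda>\<xi>. cmod (c \<xi>)) summable_on UNIV \<Longrightarrow> (\<lambda>\<xi>. cmod (c \<xi> * character \<xi> x)) summable_on UNIV"
  by (simp add: norm_mult)

lemma summable_character:
  "(\<lambda>\<xi>. cmod (c \<xi>)) summable_on UNIV \<Longrightarrow> (\<lambda>\<xi>. c \<xi> * character \<xi> x) summable_on UNIV"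
  by (rule abs_summable_summable) (rule abs_summable_character)

lemma fseries_bound:
  assumes "(\<lambda>\<xi>. cmod (c \<xi>)) summable_on UNIV"
  shows "cmod (fseries c x) \<le> (\<Sum>\<^sub>\<infinity>\<xi>. cmod (c \<xi>))"
  unfolding fseries_def using norm_infsum_bound[OF abs_summable_character[OF assms]]
  by (simp add: norm_mult)

lemma fseries_finite:
  assumes "finite F"
  shows "fseries (\<lambda>\<xi>. if \<xi> \<in> F then c \<xi> else 0) x = (\<Sum>\<xi>\<in>F. c \<xi> * character \<xi> x)"
proof -
  have "fseries (\<lambda>\<xi>. if \<xi> \<in> F then c \<xi> else 0) x = infsum (\<lambda>\<xi>. c \<xi> * character \<xi> x) F"
    unfolding fseries_def by (rule infsum_cong_neutral) auto
  with assms show ?thesis by simp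
qed

text \<open>The form in which a series can be fed to something merely additive: a trigonometric
  polynomial plus a tail that a norm makes small.\<close>

lemma fseries_split:
  assumes "rapid c" "finite F"
  shows "fseries c x = (\<Sum>\<xi>\<in>F. c \<xi> * character \<xi> x) + fseries (\<lambda>\<xi>. if \<xi> \<notin> F then c \<xi> else 0) x"
proof -
  have "fseries c x = (\<Sum>\<^sub>\<infinity>\<xi>. (if \<xi> \<in> F then c \<xi> else 0) * character \<xi> x
     + (if \<xi> \<notin> F then c \<xi> else 0) * character \<xi> x)"
    unfolding fseries_def by (rule infsum_cong) auto
  also have "\<dots> = fseries (\<lambda>\<xi>. if \<xi> \<in> F then c \<xi> else 0) x + fseries (\<lambda>\<xi>. if \<xi> \<notin> F then c \<xi> else 0) x"
    unfolding fseries_def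
    by (intro infsum_add summable_character rapid_summable rapid_restrict assms)
  finally show ?thesis by (simp add: fseries_finite assms)
qed

text \<open>Second-order Taylor remainder, half of it from the cosine and half from the sine. The
  quadratic rate is what differentiates Fourier series termwise.\<close>

lemma norm_cis_minus_linear: "cmod (cis t - 1 - \<i> * t) \<le> t\<^sup>2"
proof -
  have "\<bar>cos t - 1\<bar> \<le> t\<^sup>2 / 2"
  proof -
    have "cos t = 1 - 2 * (sin (t / 2))\<^sup>2" using cos_double_sin[of "t/2"] by simp
    moreover have "(sin (t/2))\<^sup>2 \<le> (t/2)\<^sup>2" using abs_sin_x_le_abs_x[of "t/2"] by (simp add: abs_le_square_iff[symmetric])
    ultimately show ?thesis by (simp add: power_divide)
  qed
  moreover have "\<bar>sin t - t\<bar> \<le> t\<^sup>2 / 2"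
    using Maclaurin_sin_bound[of t 2] by (simp add: numeral_2_eq_2 sin_coeff_def)
  moreover have "cmod (cis t - 1 - \<i> * t) \<le> \<bar>cos t - 1\<bar> + \<bar>sin t - t\<bar>"
    using cmod_le[of "cis t - 1 - \<i> * t"] by simp
  ultimately show ?thesis by (simp add: field_simps)
qed

text \<open>The Taylor remainder of the term at \<open>\<xi>\<close> is at most
  \<open>4 pi^2\<close> times the squares of \<open>norm h\<close> and \<open>\<rho> \<xi>\<close>
  times the coefficient. These bounds sum to \<open>K2\<close> times the square of
  \<open>norm h\<close>, so the series of linear parts is the derivative.\<close>

lemma fseries_has_derivative:
  assumes c: "rapid c"
  shows "(fseries c has_derivative
    (\<lambda>h. \<Sum>\<^sub>\<infinity>\<xi>. (2 * pi * \<i> * complex_of_real (h \<bullet> real_vec \<xi>) * c \<xi>) * character \<xi> x)) (at x)"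
proof -
  define T where "T h \<xi> = (2 * pi * \<i> * complex_of_real (h \<bullet> real_vec \<xi>) * c \<xi>) * character \<xi> x" for h \<xi>
  define K1 where "K1 = (\<Sum>\<^sub>\<infinity>\<xi>. 2 * pi * (\<rho> \<xi> ^ 1 * cmod (c \<xi>)))"
  define K2 where "K2 = (\<Sum>\<^sub>\<infinity>\<xi>. 4 * pi\<^sup>2 * (\<rho> \<xi> ^ 2 * cmod (c \<xi>)))"
  have s: "(\<lambda>\<xi>. k * (\<rho> \<xi> ^ m * cmod (c \<xi>))) summable_on UNIV" for k m
    using c unfolding rapid_def by (intro summable_on_cmult_right) blast
  have inner: "\<bar>h \<bullet> real_vec \<xi>\<bar> \<le> norm h * \<rho> \<xi>" for h \<xi>
    by (rule order_trans[OF Cauchy_Schwarz_ineq2]) (intro mult_left_mono norm_le_bessel_weight norm_ge_zero)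
  have Tle: "cmod (T h \<xi>) \<le> norm h * (2 * pi * (\<rho> \<xi> ^ 1 * cmod (c \<xi>)))" for h \<xi>
    using mult_right_mono[OF inner[of h \<xi>], of "2 * pi * cmod (c \<xi>)"]
    by (simp add: T_def norm_mult algebra_simps)
  have Tabs: "(\<lambda>\<xi>. cmod (T h \<xi>)) summable_on UNIV" for h
    by (rule Infinite_Sum.abs_summable_on_comparison_test'[OF _ Tle]) (intro summable_on_cmult_right s)
  have Tsum: "T h summable_on UNIV" for h by (rule abs_summable_summable[OF Tabs])
  have bl: "bounded_linear (\<lambda>h. infsum (T h) UNIV)"
  proof (rule bounded_linear_intro[where K=K1])
    show "infsum (T (g + h)) UNIV = infsum (T g) UNIV + infsum (T h) UNIV" for g h
      by (subst infsum_add[symmetric]) (auto intro!: Tsum infsum_cong simp: T_def inner_add_left algebra_simps)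
    show "infsum (T (r *\<^sub>R h)) UNIV = r *\<^sub>R infsum (T h) UNIV" for r h
      by (subst infsum_scaleR_right[symmetric]) (auto intro!: infsum_cong simp: T_def inner_scaleR_left scaleR_conv_of_real[where 'a=complex] algebra_simps)
    show "norm (infsum (T h) UNIV) \<le> norm h * K1" for h
    proof -
      have "norm (infsum (T h) UNIV) \<le> (\<Sum>\<^sub>\<infinity>\<xi>. cmod (T h \<xi>))" by (rule norm_infsum_bound[OF Tabs])
      also have "\<dots> \<le> (\<Sum>\<^sub>\<infinity>\<xi>. norm h * (2 * pi * (\<rho> \<xi> ^ 1 * cmod (c \<xi>))))"
        by (intro infsum_mono Tabs summable_on_cmult_right s Tle)
      also have "\<dots> = norm h * K1" unfolding K1_def by (rule infsum_cmult_right')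
      finally show ?thesis .
    qed
  qed
  have "(fseries c has_derivative (\<lambda>h. infsum (T h) UNIV)) (at x)"
  proof (rule has_derivativeI_sandwich[where e=1 and H="\<lambda>y. K2 * norm (y - x)"])
    show "((\<lambda>y. K2 * norm (y - x)) \<longlongrightarrow> 0) (at x)"
      by (auto intro!: tendsto_eq_intros)
    fix y assume "y \<noteq> x"
    define h where "h = y - x"
    have y: "y = x + h" by (simp add: h_def)
    define R where "R \<xi> = c \<xi> * character \<xi> y - c \<xi> * character \<xi> x - T h \<xi>" for \<xi>
    have Rle: "cmod (R \<xi>) \<le> (norm h)\<^sup>2 * (4 * pi\<^sup>2 * (\<rho> \<xi> ^ 2 * cmod (c \<xi>)))" for \<xi>
    proof -
      define t where "t = 2 * pi * (h \<bullet> real_vec \<xi>)"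
      have "R \<xi> = c \<xi> * character \<xi> x * (cis t - 1 - \<i> * t)"
        by (simp add: R_def y character_plus T_def t_def algebra_simps)
          (simp add: character_def algebra_simps)
      then have "cmod (R \<xi>) = cmod (c \<xi>) * cmod (cis t - 1 - \<i> * t)"
        by (simp only: norm_mult norm_character mult_1_right)
      also have "\<dots> \<le> cmod (c \<xi>) * t\<^sup>2"
        by (intro mult_left_mono norm_cis_minus_linear) simp
      also have "\<dots> = cmod (c \<xi>) * 4 * pi\<^sup>2 * \<bar>h \<bullet> real_vec \<xi>\<bar>\<^sup>2"
        by (simp add: t_def power_mult_distrib)
      also have "\<dots> \<le> cmod (c \<xi>) * 4 * pi\<^sup>2 * (norm h * \<rho> \<xi>)\<^sup>2"
        by (intro mult_left_mono power_mono inner) auto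
      finally show ?thesis by (simp add: power_mult_distrib ac_simps)
    qed
    have Rabs: "(\<lambda>\<xi>. cmod (R \<xi>)) summable_on UNIV"
      by (rule Infinite_Sum.abs_summable_on_comparison_test'[OF _ Rle]) (intro summable_on_cmult_right s)
    have cs: "(\<lambda>\<xi>. c \<xi> * character \<xi> z) summable_on UNIV" for z
      by (intro summable_character rapid_summable c)
    have "(R has_sum (fseries c y + - fseries c x + - infsum (T h) UNIV)) UNIV"
      unfolding R_def fseries_def diff_conv_add_uminus
      by (intro has_sum_add has_sum_uminusI has_sum_infsum cs Tsum)
    then have "infsum R UNIV = fseries c y - fseries c x - infsum (T h) UNIV"
      by (simp add: infsumI)
    then have "norm (fseries c y - fseries c x - infsum (T (y - x)) UNIV) = cmod (infsum R UNIV)"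
      by (simp add: h_def)
    also have "\<dots> \<le> (\<Sum>\<^sub>\<infinity>\<xi>. cmod (R \<xi>))" by (rule norm_infsum_bound[OF Rabs])
    also have "\<dots> \<le> (\<Sum>\<^sub>\<infinity>\<xi>. (norm h)\<^sup>2 * (4 * pi\<^sup>2 * (\<rho> \<xi> ^ 2 * cmod (c \<xi>))))"
      by (intro infsum_mono Rabs summable_on_cmult_right s Rle)
    also have "\<dots> = (norm h)\<^sup>2 * K2" unfolding K2_def by (rule infsum_cmult_right')
    finally show "norm ((fseries c y - fseries c x) - infsum (T (y - x)) UNIV) / norm (y - x) \<le> K2 * norm (y - x)"
      using \<open>y \<noteq> x\<close> by (simp add: h_def divide_le_eq power2_eq_square ac_simps)
  qed (auto intro: bl)
  then show ?thesis by (simp add: T_def[abs_def])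
qed

lemma partial_eq_derivative:
  assumes "(f has_derivative D) (at x)"
  shows "((\<lambda>t. f (x + t *\<^sub>R axis i 1)) has_vector_derivative D (axis i 1)) (at 0)"
    and "partial i f x = D (axis i 1)"
proof -
  have D: "linear D" using assms has_derivative_linear by blast
  have "((\<lambda>t::real. x + t *\<^sub>R axis i 1) has_derivative (\<lambda>t. t *\<^sub>R axis i 1)) (at 0)"
    by (auto intro!: derivative_eq_intros)
  from has_derivative_compose[OF this, of f D]
  show "((\<lambda>t. f (x + t *\<^sub>R axis i 1)) has_vector_derivative D (axis i 1)) (at 0)"
    using assms by (simp add: has_vector_derivative_def linear_cmul[OF D])
  then show "partial i f x = D (axis i 1)"
    unfolding partial_def by (rule vector_derivative_at)
qed

lemma partial_fseries:
  assumes "rapid c"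
  shows "partial i (fseries c) = fseries (\<lambda>\<xi>. 2 * pi * \<i> * of_int (\<xi> $ i) * c \<xi>)"
  by (rule ext, subst partial_eq_derivative(2)[OF fseries_has_derivative[OF assms]])
    (simp add: fseries_def inner_axis inner_commute)

lemma iter_partial_fseries:
  assumes "rapid c"
  shows "iter_partial is (fseries c) = fseries (\<lambda>\<xi>. (\<Prod>i\<leftarrow>is. 2 * pi * \<i> * of_int (\<xi> $ i)) * c \<xi>)"
    and "rapid (\<lambda>\<xi>. (\<Prod>i\<leftarrow>is. 2 * pi * \<i> * of_int (\<xi> $ i)) * c \<xi>)"
proof -
  have "iter_partial is (fseries c) = fseries (\<lambda>\<xi>. (\<Prod>i\<leftarrow>is. 2 * pi * \<i> * of_int (\<xi> $ i)) * c \<xi>) \<and>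
    rapid (\<lambda>\<xi>. (\<Prod>i\<leftarrow>is. 2 * pi * \<i> * of_int (\<xi> $ i)) * c \<xi>)"
  proof (induction "is")
    case Nil
    then show ?case using assms by (simp add: iter_partial_def)
  next
    case (Cons i "is")
    then show ?case
      using partial_fseries[of "\<lambda>\<xi>. (\<Prod>i\<leftarrow>is. 2 * pi * \<i> * of_int (\<xi> $ i)) * c \<xi>" i]
        rapid_deriv[of "\<lambda>\<xi>. (\<Prod>i\<leftarrow>is. 2 * pi * \<i> * of_int (\<xi> $ i)) * c \<xi>" i]
      by (simp add: iter_partial_def mult.assoc)
  qed
  then show "iter_partial is (fseries c) = fseries (\<lambda>\<xi>. (\<Prod>i\<leftarrow>is. 2 * pi * \<i> * of_int (\<xi> $ i)) * c \<xi>)"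
    and "rapid (\<lambda>\<xi>. (\<Prod>i\<leftarrow>is. 2 * pi * \<i> * of_int (\<xi> $ i)) * c \<xi>)" by auto
qed

lemma fseries_Cinf_per:
  assumes "rapid c" shows "fseries c \<in> Cinf_per"
proof -
  have "iter_partial is (fseries c) differentiable at x" for "is" x
    unfolding iter_partial_fseries(1)[OF assms]
    using fseries_has_derivative[OF iter_partial_fseries(2)[OF assms]] differentiableI by blast
  then have "smooth (fseries c)"
    by (simp add: smooth_def differentiable_on_def)
  moreover have "periodic (fseries c)"
  proof -
    have "character \<xi> (x + axis i 1) = character \<xi> x" for \<xi> :: "int^'a" and x i
      using periodic_character[of \<xi>] by (simp add: periodic_def)
    then show ?thesis by (simp add: periodic_def fseries_def)
  qed
  ultimately show ?thesis by (simp add: Cinf_per_def)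
qed

lemma trig_poly_Cinf_per: "finite F \<Longrightarrow> (\<lambda>x. \<Sum>\<xi>\<in>F. c \<xi> * character \<xi> x) \<in> Cinf_per"
  using fseries_Cinf_per[OF rapid_finite[of F c]] fseries_finite[of F c] by (simp add: fseries_def[abs_def])

lemma character_Cinf_per: "character \<xi> \<in> Cinf_per"
  using trig_poly_Cinf_per[of "{\<xi>}" "\<lambda>_. 1"] by simp

text \<open>A multiple of a character is a one-term series. The scalar is carried along because in a
  second-order operator the inner derivative meets a test function that is already a multiple of a
  character.\<close>

lemma partial_cmult_character:
  "partial i (\<lambda>x. c * character \<xi> x) = (\<lambda>x. (c * (2 * pi * \<i> * of_int (\<xi> $ i))) * character \<xi> x)"
proof -
  have r: "rapid (\<lambda>\<eta>. if \<eta> \<in> {\<xi>} then c else 0)" by (rule rapid_finite) simp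
  have 1: "fseries (\<lambda>\<eta>. if \<eta> \<in> {\<xi>} then d \<eta> else 0) = (\<lambda>x. d \<xi> * character \<xi> x)" for d
    using fseries_finite[of "{\<xi>}" d] by auto
  have "partial i (fseries (\<lambda>\<eta>. if \<eta> \<in> {\<xi>} then c else 0))
     = fseries (\<lambda>\<eta>. if \<eta> \<in> {\<xi>} then c * (2 * pi * \<i> * of_int (\<eta> $ i)) else 0)"
    unfolding partial_fseries[OF r] by (rule arg_cong[where f=fseries]) auto
  then show ?thesis unfolding 1 by simp
qed

lemma partial_character: "partial i (character \<xi>) = (\<lambda>x. 2 * pi * \<i> * of_int (\<xi> $ i) * character \<xi> x)"
  using partial_cmult_character[of i 1] by simp

section \<open>Seminorms and tails of Fourier series\<close>

lemma iter_partial_fseries_bound: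
  fixes c :: "int^'n::finite \<Rightarrow> complex"
  assumes c: "rapid c" and len: "length is \<le> m"
  shows "cmod (iter_partial is (fseries c) x) \<le> (\<Sum>\<^sub>\<infinity>\<xi>. (2 * pi) ^ m * (\<rho> \<xi> ^ m * cmod (c \<xi>)))"
proof -
  let ?P = "\<lambda>\<xi>. (\<Prod>i\<leftarrow>is. 2 * pi * \<i> * of_int (\<xi> $ i)) :: complex"
  have P: "cmod (?P \<xi>) \<le> (2 * pi * \<rho> \<xi>) ^ m" for \<xi>
  proof -
    have "cmod (?P \<xi>) \<le> (2 * pi * \<rho> \<xi>) ^ length is"
    proof (induction "is")
      case (Cons i "is")
      then show ?case
        by (auto simp: norm_mult intro!: mult_mono component_le_bessel_weight)
    qed simp
    also have "\<dots> \<le> (2 * pi * \<rho> \<xi>) ^ m"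
    proof (rule power_increasing[OF len])
      have "1 \<le> 2 * pi" using pi_ge_two by simp
      then show "1 \<le> 2 * pi * \<rho> \<xi>"
        using mult_mono[of 1 "2 * pi" 1 "\<rho> \<xi>"] bessel_weight_ge_1[of \<xi>] by simp
    qed
    finally show ?thesis .
  qed
  have r: "rapid (\<lambda>\<xi>. ?P \<xi> * c \<xi>)" by (rule iter_partial_fseries(2)[OF c])
  have "cmod (iter_partial is (fseries c) x) \<le> (\<Sum>\<^sub>\<infinity>\<xi>. cmod (?P \<xi> * c \<xi>))"
    unfolding iter_partial_fseries(1)[OF c] by (rule fseries_bound[OF rapid_summable[OF r]])
  also have "\<dots> \<le> (\<Sum>\<^sub>\<infinity>\<xi>. (2 * pi) ^ m * (\<rho> \<xi> ^ m * cmod (c \<xi>)))"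
  proof (rule infsum_mono[OF rapid_summable[OF r]])
    show "(\<lambda>\<xi>. (2 * pi) ^ m * (\<rho> \<xi> ^ m * cmod (c \<xi>))) summable_on UNIV"
      using c unfolding rapid_def by (intro summable_on_cmult_right) blast
    show "cmod (?P \<xi> * c \<xi>) \<le> (2 * pi) ^ m * (\<rho> \<xi> ^ m * cmod (c \<xi>))" for \<xi>
      using mult_right_mono[OF P[of \<xi>], of "cmod (c \<xi>)"] by (simp add: norm_mult power_mult_distrib ac_simps)
  qed
  finally show ?thesis .
qed

text \<open>A real supremum dominates its members only for a family bounded above. The derivative
  bound provides this, hence the nonnegativity, which later allows a constant of unknown sign to be
  replaced by its absolute value.\<close>

lemma Cm_norm_fseries:
  fixes c :: "int^'n::finite \<Rightarrow> complex"
  assumes c: "rapid c"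
  shows "Cm_norm m (fseries c) \<le> (\<Sum>\<^sub>\<infinity>\<xi>. (2 * pi) ^ m * (\<rho> \<xi> ^ m * cmod (c \<xi>)))" (is "_ \<le> ?B")
    and "0 \<le> Cm_norm m (fseries c)"
proof -
  let ?I = "{is :: 'n list. length is \<le> m} \<times> (UNIV :: (real^'n) set)"
  let ?f = "\<lambda>(is, x). cmod (iter_partial is (fseries c) x)"
  have b: "?f z \<le> ?B" if "z \<in> ?I" for z
    using that iter_partial_fseries_bound[OF c] by auto
  have I: "([], 0) \<in> ?I" by simp
  show "Cm_norm m (fseries c) \<le> ?B"
    unfolding Cm_norm_def by (rule cSUP_least[OF _ b]) (use I in blast)
  have "0 \<le> ?f ([], 0)" by simp
  also have "\<dots> \<le> Cm_norm m (fseries c)"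
    unfolding Cm_norm_def by (rule cSUP_upper[OF I]) (rule bdd_aboveI2[OF b])
  finally show "0 \<le> Cm_norm m (fseries c)" .
qed

lemma tail_small:
  fixes f :: "'a \<Rightarrow> real"
  assumes f: "f summable_on UNIV" and pos: "\<And>x. 0 \<le> f x" and e: "0 < e"
  obtains F where "finite F" "infsum (\<lambda>x. if x \<notin> F then f x else 0) UNIV \<le> e"
proof -
  obtain F where F: "finite F" "dist (sum f F) (infsum f UNIV) \<le> e"
    using infsum_finite_approximation[OF f e] by auto
  have "infsum (\<lambda>x. if x \<notin> F then f x else 0) UNIV = infsum f (UNIV - F)"
    by (rule infsum_cong_neutral) auto
  also have "\<dots> = infsum f UNIV - infsum f F"
    using F by (intro infsum_Diff f) auto
  also have "\<dots> \<le> e" using F by (auto simp: dist_real_def)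
  finally show ?thesis using F that by blast
qed

lemma continuous_on_Cinf_per: "\<phi> \<in> Cinf_per \<Longrightarrow> continuous_on A \<phi>"
proof -
  assume "\<phi> \<in> Cinf_per"
  then have "smooth \<phi>" by (simp add: Cinf_per_def)
  then have "iter_partial [] \<phi> differentiable_on UNIV" unfolding smooth_def by blast
  then have "continuous_on UNIV \<phi>"
    by (simp add: iter_partial_def differentiable_imp_continuous_on)
  then show ?thesis by (rule continuous_on_subset) simp
qed

text \<open>Sum and integral are exchanged by splitting: orthogonality evaluates the finite part,
  and the tail contributes at most its absolute sum.\<close>

lemma torus_coeff_fseries:
  assumes c: "rapid c"
  shows "torus_coeff (fseries c) \<eta> = c \<eta>"
proof -
  have int: "integrable torus_measure (fseries d)" if "rapid d" for d :: "int^'a \<Rightarrow> complex"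
    using fseries_bound[OF rapid_summable[OF that]] continuous_on_Cinf_per[OF fseries_Cinf_per[OF that]]
    by (intro integrable_torus_bounded borel_imp_torus_measurable borel_measurable_continuous_onI)
  have "cmod (torus_coeff (fseries c) \<eta> - c \<eta>) \<le> 0"
  proof (rule field_le_epsilon)
    fix e :: real assume "e > 0"
    then obtain F where F: "finite F" "infsum (\<lambda>\<xi>. if \<xi> \<notin> F then cmod (c \<xi>) else 0) UNIV \<le> e"
      using tail_small[OF rapid_summable[OF c] norm_ge_zero] by blast
    \<comment> \<open>Including \<open>\<eta>\<close> makes the finite part yield exactly
      \<open>c \<eta>\<close>.\<close>
    let ?G = "insert \<eta> F"
    let ?d = "\<lambda>\<xi>. if \<xi> \<notin> ?G then c \<xi> else 0"
    have r: "rapid ?d" by (rule rapid_restrict[OF c])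
    have "torus_coeff (fseries c) \<eta> = (\<integral>x. (\<Sum>\<xi>\<in>?G. c \<xi> * (character \<xi> x * character (- \<eta>) x))
        + fseries ?d x * character (- \<eta>) x \<partial>torus_measure)"
      unfolding torus_coeff_def using F
      by (subst fseries_split[OF c, of ?G]) (simp_all add: ring_distribs sum_distrib_right mult.assoc)
    also have "\<dots> = (\<Sum>\<xi>\<in>?G. c \<xi> * torus_coeff (character \<xi>) \<eta>) + torus_coeff (fseries ?d) \<eta>"
    proof -
      have I: "integrable torus_measure (\<lambda>x. c \<xi> * (character \<xi> x * character (- \<eta>) x))" for \<xi>
        by (intro integrable_mult_right integrable_mult_character integrable_character)
      show ?thesis
        unfolding torus_coeff_def
        by (subst Bochner_Integration.integral_add)
          (use I integrable_mult_character[OF int[OF r]] in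
            \<open>simp_all only: Bochner_Integration.integral_sum Bochner_Integration.integrable_sum
              integral_mult_right_zero\<close>)
    qed
    also have "(\<Sum>\<xi>\<in>?G. c \<xi> * torus_coeff (character \<xi>) \<eta>) = c \<eta>"
      using F by (simp add: torus_coeff_character if_distrib cong: if_cong)
    finally have "cmod (torus_coeff (fseries c) \<eta> - c \<eta>) = cmod (torus_coeff (fseries ?d) \<eta>)"
      by simp
    also have "\<dots> \<le> (\<Sum>\<^sub>\<infinity>\<xi>. cmod (?d \<xi>))"
      unfolding torus_coeff_def using fseries_bound[OF rapid_summable[OF r]]
      by (intro norm_integral_torus_le infsum_nonneg) (auto simp: norm_mult)
    also have "\<dots> \<le> infsum (\<lambda>\<xi>. if \<xi> \<notin> F then cmod (c \<xi>) else 0) UNIV"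
    proof (rule infsum_mono[OF rapid_summable[OF r]])
      show "(\<lambda>\<xi>. if \<xi> \<notin> F then cmod (c \<xi>) else 0) summable_on UNIV"
        using rapid_summable[OF rapid_restrict[OF c, of "\<lambda>\<xi>. \<xi> \<notin> F"]] by (simp add: if_distrib cong: if_cong)
    qed auto
    also have "\<dots> \<le> e" by (rule F)
    finally show "cmod (torus_coeff (fseries c) \<eta> - c \<eta>) \<le> 0 + e" by simp
  qed
  then show ?thesis by simp
qed

subsection \<open>Fourier expansion of smooth periodic functions\<close>

lemma periodic_shift_of_nat:
  assumes "periodic f" shows "f (x + real n *\<^sub>R axis i 1) = f x"
proof (induction n)
  case (Suc n)
  have "f (x + real (Suc n) *\<^sub>R axis i 1) = f ((x + real n *\<^sub>R axis i 1) + axis i 1)"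
    by (simp add: algebra_simps)
  also have "\<dots> = f x" using assms Suc by (simp add: periodic_def)
  finally show ?case .
qed simp

lemma periodic_shift_of_int:
  assumes "periodic f" shows "f (x + real_of_int z *\<^sub>R axis i 1) = f x"
proof (cases z rule: int_cases2)
  case (nonneg n)
  then show ?thesis using periodic_shift_of_nat[OF assms] by simp
next
  case (nonpos n)
  then show ?thesis
    using periodic_shift_of_nat[OF assms, of "x - real n *\<^sub>R axis i 1" n i] by simp
qed

lemma periodic_shift:
  assumes "periodic f" shows "f (x + real_vec \<xi>) = f x"
proof -
  have "f (x + (\<Sum>i\<in>I. real_of_int (\<xi> $ i) *\<^sub>R axis i 1)) = f x" if "finite I" for I
    using that
  proof (induction I)
    case (insert i I)
    then show ?case
      using periodic_shift_of_int[OF assms, of "x + (\<Sum>i\<in>I. real_of_int (\<xi> $ i) *\<^sub>R axis i 1)" "\<xi> $ i" i]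
      by (simp add: algebra_simps)
  qed simp
  moreover have "(\<Sum>i\<in>UNIV. real_of_int (\<xi> $ i) *\<^sub>R axis i 1) = real_vec \<xi>"
    by (simp add: vec_eq_iff axis_def if_distrib cong: if_cong)
  ultimately show ?thesis by (metis finite_class.finite_UNIV)
qed

lemma periodic_representative:
  fixes f :: "real^'n::finite \<Rightarrow> complex"
  assumes "periodic f" obtains y where "y \<in> torus" "f y = f x"
proof
  let ?\<xi> = "(\<chi> i. - \<lfloor>x $ i\<rfloor>) :: int^'n"
  show "x + real_vec ?\<xi> \<in> torus"
    by (auto simp: torus_def) linarith
  show "f (x + real_vec ?\<xi>) = f x" by (rule periodic_shift[OF assms])
qed

lemma continuous_periodic_bounded:
  fixes f :: "real^'n::finite \<Rightarrow> complex"
  assumes "continuous_on UNIV f" "periodic f"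
  obtains B where "\<And>x. cmod (f x) \<le> B"
proof -
  have "compact (f ` cbox 0 1)"
    by (intro compact_continuous_image continuous_on_subset[OF assms(1)]) auto
  then obtain B where "\<forall>z\<in>f ` cbox 0 1. cmod z \<le> B"
    using compact_imp_bounded bounded_iff by blast
  then have B: "cmod (f y) \<le> B" if "y \<in> cbox 0 1" for y using that by blast
  have "cmod (f x) \<le> B" for x
  proof -
    obtain y where "y \<in> torus" "f y = f x" using periodic_representative[OF assms(2)] by blast
    with B[of y] show ?thesis by (auto simp: torus_def mem_box_cart less_imp_le)
  qed
  then show ?thesis by (rule that)
qed

lemma continuous_periodic_integrable:
  fixes f :: "real^'n::finite \<Rightarrow> complex"
  assumes "continuous_on UNIV f" "periodic f"
  shows "integrable torus_measure f"
  using continuous_periodic_bounded[OF assms]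
  by (metis assms(1) integrable_torus_bounded borel_imp_torus_measurable borel_measurable_continuous_onI)

lemma Cinf_per_D:
  assumes "\<phi> \<in> Cinf_per"
  shows "continuous_on UNIV \<phi>" "periodic \<phi>" "\<phi> differentiable at x"
    "integrable torus_measure \<phi>" "partial i \<phi> \<in> Cinf_per"
proof -
  show c: "continuous_on UNIV \<phi>" using assms by (rule continuous_on_Cinf_per)
  show p: "periodic \<phi>" using assms by (simp add: Cinf_per_def)
  show "integrable torus_measure \<phi>" by (rule continuous_periodic_integrable[OF c p])
  have s: "iter_partial is \<phi> differentiable at x" for "is" x
    using assms by (auto simp: Cinf_per_def smooth_def differentiable_on_def)
  show "\<phi> differentiable at x" using s[of "[]"] by (simp add: iter_partial_def)
  have "iter_partial is (partial i \<phi>) = iter_partial (is @ [i]) \<phi>" for "is"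
    by (simp add: iter_partial_def)
  then have "smooth (partial i \<phi>)" using s by (simp add: smooth_def differentiable_on_def)
  moreover have "periodic (partial i \<phi>)"
  proof -
    have "\<phi> (x + axis k 1 + t *\<^sub>R axis i 1) = \<phi> (x + t *\<^sub>R axis i 1)" for x k t
      using p unfolding periodic_def by (metis add.assoc add.commute)
    then show ?thesis by (simp add: periodic_def partial_def)
  qed
  ultimately show "partial i \<phi> \<in> Cinf_per" by (simp add: Cinf_per_def)
qed

text \<open>Replaces the limit along a real parameter by one along a sequence, as dominated
  convergence takes it.\<close>

lemma vector_derivative_sequence:
  fixes g :: "real \<Rightarrow> complex"
  assumes "(g has_vector_derivative D) (at 0)"
  shows "(\<lambda>n. (g (inverse (real (Suc n))) - g 0) /\<^sub>R inverse (real (Suc n))) \<longlonglongrightarrow> D"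
proof -
  define t where "t n = inverse (real (Suc n))" for n
  have t: "t n \<noteq> 0" for n by (simp add: t_def)
  have "((\<lambda>h. norm (g (0 + h) - g 0 - h *\<^sub>R D) / norm h) \<longlongrightarrow> 0) (at 0)"
    using assms unfolding has_vector_derivative_def has_derivative_at by simp
  moreover have "filterlim t (at 0) sequentially"
    unfolding filterlim_at using LIMSEQ_inverse_real_of_nat t by (auto simp: t_def[abs_def])
  ultimately have "(\<lambda>n. norm (g (0 + t n) - g 0 - t n *\<^sub>R D) / norm (t n)) \<longlonglongrightarrow> 0"
    by (rule filterlim_compose)
  moreover have "norm (g (0 + t n) - g 0 - t n *\<^sub>R D) / norm (t n) = norm ((g (t n) - g 0) /\<^sub>R t n - D)" for n
  proof -
    have "(g (t n) - g 0) /\<^sub>R t n - D = (g (t n) - g 0 - t n *\<^sub>R D) /\<^sub>R t n"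
      using t[of n] by (simp add: scaleR_diff_right)
    then show ?thesis by (simp add: divide_inverse mult.commute)
  qed
  ultimately have "(\<lambda>n. (g (t n) - g 0) /\<^sub>R t n - D) \<longlonglongrightarrow> 0"
    by (simp add: tendsto_norm_zero_iff)
  then show ?thesis unfolding t_def by (rule LIM_zero_cancel)
qed

text \<open>Integration by parts through difference quotients: translation invariance moves the
  shift from \<open>\<phi>\<close> onto the character, where the limit is explicit. The mean value
  inequality bounds the quotients by the supremum \<open>K\<close> of the derivative, which serves
  as the dominating constant.\<close>

lemma torus_coeff_partial:
  fixes \<phi> :: "real^'n::finite \<Rightarrow> complex"
  assumes \<phi>: "\<phi> \<in> Cinf_per"
  shows "torus_coeff (partial i \<phi>) \<xi> = 2 * pi * \<i> * of_int (\<xi> $ i) * torus_coeff \<phi> \<xi>"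
proof -
  define t where "t n = inverse (real (Suc n))" for n
  have t: "0 < t n" "t n \<le> 1" for n by (auto simp: t_def field_simps)
  define c where "c = torus_coeff \<phi> \<xi>"
  note P = Cinf_per_D(5)[OF \<phi>, of i]
  obtain B where B: "\<And>x. cmod (\<phi> x) \<le> B"
    using continuous_periodic_bounded[OF Cinf_per_D(1,2)[OF \<phi>]] by blast
  obtain K where K: "\<And>x. cmod (partial i \<phi> x) \<le> K"
    using continuous_periodic_bounded[OF Cinf_per_D(1,2)[OF P]] by blast
  have [measurable]: "\<phi> \<in> borel_measurable borel" "partial i \<phi> \<in> borel_measurable borel"
    using Cinf_per_D(1)[OF \<phi>] Cinf_per_D(1)[OF P] by (auto intro: borel_measurable_continuous_onI)
  have vd: "((\<lambda>s. \<phi> (x + s *\<^sub>R axis i 1)) has_vector_derivative partial i \<phi> (x + r *\<^sub>R axis i 1)) (at r)"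
    for x r
  proof -
    obtain D where D: "(\<phi> has_derivative D) (at (x + r *\<^sub>R axis i 1))"
      using Cinf_per_D(3)[OF \<phi>] by (auto simp: differentiable_def)
    have "((\<lambda>s. \<phi> ((x + r *\<^sub>R axis i 1) + (s + (- r)) *\<^sub>R axis i 1)) has_vector_derivative D (axis i 1)) (at r)"
    proof -
      have "((\<lambda>s. \<phi> ((x + r *\<^sub>R axis i 1) + s *\<^sub>R axis i 1)) has_vector_derivative D (axis i 1)) (at (r + (- r)))"
        using partial_eq_derivative(1)[OF D] by simp
      moreover have "((\<lambda>s. s + (- r)) has_vector_derivative 1) (at r)"
        by (auto intro!: derivative_eq_intros)
      ultimately show ?thesis
        using vector_diff_chain_at[of "\<lambda>s. s + (- r)" 1 r] by (simp add: o_def)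
    qed
    then show ?thesis using partial_eq_derivative(2)[OF D] by (simp add: algebra_simps)
  qed
  have lip: "cmod (\<phi> (x + s *\<^sub>R axis i 1) - \<phi> x) \<le> K * s" if "s \<ge> 0" for x s
  proof -
    have on: "onorm (\<lambda>h. h *\<^sub>R partial i \<phi> y) \<le> K" for y
    proof (rule onorm_bound)
      show "0 \<le> K" by (rule order_trans[OF norm_ge_zero K])
      show "norm (h *\<^sub>R partial i \<phi> y) \<le> K * norm h" for h
        using mult_left_mono[OF K, of "\<bar>h\<bar>" y] by (simp add: mult.commute)
    qed
    have "norm (\<phi> (x + s *\<^sub>R axis i 1) - \<phi> (x + 0 *\<^sub>R axis i 1)) \<le> K * norm (s - 0)"
      by (rule differentiable_bound[where S=UNIV and f'="\<lambda>r h. h *\<^sub>R partial i \<phi> (x + r *\<^sub>R axis i 1)"])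
        (use vd on in \<open>auto simp: has_vector_derivative_def\<close>)
    then show ?thesis using that by simp
  qed
  have tc: "(\<integral>x. \<phi> (x + t n *\<^sub>R axis i 1) * character (- \<xi>) x \<partial>torus_measure)
      = character \<xi> (t n *\<^sub>R axis i 1) * c" for n
  proof -
    let ?f = "\<lambda>x. \<phi> x * character (- \<xi>) x"
    have "(\<integral>x. ?f (x + t n *\<^sub>R axis i 1) \<partial>torus_measure) = c"
      unfolding c_def torus_coeff_def
      by (rule integral_torus_translate_axis[where B=B])
        (use B t Cinf_per_D(2)[OF \<phi>] periodic_character[of "- \<xi>"] in
          \<open>auto simp: norm_mult periodic_def less_imp_le\<close>)
    then have "(\<integral>x. character (- \<xi>) (t n *\<^sub>R axis i 1) * (\<phi> (x + t n *\<^sub>R axis i 1) * character (- \<xi>) x) \<partial>torus_measure) = c"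
      by (simp add: character_plus ac_simps)
    then have "character \<xi> (t n *\<^sub>R axis i 1) * (character (- \<xi>) (t n *\<^sub>R axis i 1) *
        (\<integral>x. \<phi> (x + t n *\<^sub>R axis i 1) * character (- \<xi>) x \<partial>torus_measure)) = character \<xi> (t n *\<^sub>R axis i 1) * c"
      by simp
    then show ?thesis by (simp flip: mult.assoc)
  qed
  define h where "h n x = (\<phi> (x + t n *\<^sub>R axis i 1) - \<phi> x) /\<^sub>R t n * character (- \<xi>) x" for n x
  have "(\<lambda>n. integral\<^sup>L torus_measure (h n)) \<longlonglongrightarrow> torus_coeff (partial i \<phi>) \<xi>"
    unfolding torus_coeff_def
  proof (rule integral_dominated_convergence[where w="\<lambda>_. K"])
    show "AE x in torus_measure. (\<lambda>n. h n x) \<longlonglongrightarrow> partial i \<phi> x * character (- \<xi>) x"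
    proof (rule AE_I2)
      fix x :: "real^'n"
      have "(\<lambda>n. (\<phi> (x + t n *\<^sub>R axis i 1) - \<phi> x) /\<^sub>R t n) \<longlonglongrightarrow> partial i \<phi> x"
        using vector_derivative_sequence[of "\<lambda>s. \<phi> (x + s *\<^sub>R axis i 1)"] vd[of x 0] by (simp add: t_def)
      then show "(\<lambda>n. h n x) \<longlonglongrightarrow> partial i \<phi> x * character (- \<xi>) x"
        unfolding h_def by (intro tendsto_mult tendsto_const)
    qed
    show "AE x in torus_measure. norm (h n x) \<le> K" for n
    proof (rule AE_I2)
      fix x :: "real^'n"
      have "norm (h n x) = cmod (\<phi> (x + t n *\<^sub>R axis i 1) - \<phi> x) / t n"
        using t[of n] by (simp add: h_def norm_mult divide_inverse ac_simps)
      also have "\<dots> \<le> K" using lip[of "t n" x] t[of n] by (simp add: divide_le_eq less_imp_le)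
      finally show "norm (h n x) \<le> K" .
    qed
    show "(\<lambda>x. partial i \<phi> x * character (- \<xi>) x) \<in> borel_measurable torus_measure"
      "h n \<in> borel_measurable torus_measure" for n
      unfolding h_def by (auto intro!: borel_imp_torus_measurable)
    show "integrable torus_measure (\<lambda>_. K)"
      by (simp add: finite_measure.integrable_const finite_torus_measure)
  qed
  moreover have "integral\<^sup>L torus_measure (h n) = (character \<xi> (t n *\<^sub>R axis i 1) - 1) /\<^sub>R t n * c" for n
  proof -
    have 1: "integrable torus_measure (\<lambda>x. \<phi> (x + t n *\<^sub>R axis i 1) * character (- \<xi>) x)"
      by (rule integrable_torus_bounded[where B=B]) (auto simp: norm_mult B intro!: borel_imp_torus_measurable)
    have 2: "integrable torus_measure (\<lambda>x. \<phi> x * character (- \<xi>) x)"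
      by (intro integrable_mult_character Cinf_per_D(4) \<phi>)
    have "integral\<^sup>L torus_measure (h n) =
      (\<integral>x. (\<phi> (x + t n *\<^sub>R axis i 1) * character (- \<xi>) x - \<phi> x * character (- \<xi>) x) /\<^sub>R t n \<partial>torus_measure)"
      unfolding h_def by (intro Bochner_Integration.integral_cong refl) (simp add: algebra_simps)
    also have "\<dots> = (character \<xi> (t n *\<^sub>R axis i 1) * c - c) /\<^sub>R t n"
      using 1 2 tc[of n] by (simp add: c_def torus_coeff_def)
    finally show ?thesis by (simp add: algebra_simps)
  qed
  moreover have "(\<lambda>n. (character \<xi> (t n *\<^sub>R axis i 1) - 1) /\<^sub>R t n * c) \<longlonglongrightarrow> 2 * pi * \<i> * of_int (\<xi> $ i) * c"
  proof -
    obtain D where D: "(character \<xi> has_derivative D) (at 0)"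
      using Cinf_per_D(3)[OF character_Cinf_per[of \<xi>], of 0] by (auto simp: differentiable_def)
    have 0: "character \<xi> 0 = 1" by (simp add: character_def)
    have "D (axis i 1) = 2 * pi * \<i> * of_int (\<xi> $ i)"
      using partial_eq_derivative(2)[OF D, of i] by (simp add: partial_character 0)
    then have "((\<lambda>s. character \<xi> (s *\<^sub>R axis i 1)) has_vector_derivative 2 * pi * \<i> * of_int (\<xi> $ i)) (at 0)"
      using partial_eq_derivative(1)[OF D, of i] by simp
    from vector_derivative_sequence[OF this] show ?thesis
      by (intro tendsto_mult tendsto_const) (simp add: t_def 0)
  qed
  ultimately show ?thesis unfolding c_def by (auto intro: LIMSEQ_unique)
qed

text \<open>A derivative in direction \<open>i\<close> buys a factor \<open>\<xi> $ i\<close>, and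
  the weight is at most 1 plus the sum of these in absolute value. Hence one more power of the
  weight costs the induction hypothesis for \<open>\<phi>\<close> and for all its first partial
  derivatives, so \<open>\<phi>\<close> is kept arbitrary.\<close>

lemma rapid_torus_coeff:
  fixes \<phi> :: "real^'n::finite \<Rightarrow> complex"
  assumes "\<phi> \<in> Cinf_per"
  shows "rapid (torus_coeff \<phi>)"
proof (rule rapidI_bounded)
  fix m show "\<exists>B. \<forall>\<xi>. \<rho> \<xi> ^ m * cmod (torus_coeff \<phi> \<xi>) \<le> B"
    using assms
  proof (induction m arbitrary: \<phi>)
    case 0
    obtain B where B: "\<And>x. cmod (\<phi> x) \<le> B"
      using continuous_periodic_bounded[OF Cinf_per_D(1,2)[OF 0]] by blast
    have "cmod (torus_coeff \<phi> \<xi>) \<le> B" for \<xi>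
      unfolding torus_coeff_def
      by (rule norm_integral_torus_le) (use B order_trans[OF norm_ge_zero B] in \<open>auto simp: norm_mult\<close>)
    then show ?case by auto
  next
    case (Suc m)
    obtain B where B: "\<And>\<xi>. \<rho> \<xi> ^ m * cmod (torus_coeff \<phi> \<xi>) \<le> B"
      using Suc by blast
    have "\<forall>i. \<exists>B. \<forall>\<xi>. \<rho> \<xi> ^ m * cmod (torus_coeff (partial i \<phi>) \<xi>) \<le> B"
      using Suc.IH[OF Cinf_per_D(5)[OF Suc.prems]] by blast
    then obtain D where D: "\<And>i \<xi>. \<rho> \<xi> ^ m * cmod (torus_coeff (partial i \<phi>) \<xi>) \<le> D i"
      by metis
    have "\<rho> \<xi> ^ Suc m * cmod (torus_coeff \<phi> \<xi>) \<le> B + (\<Sum>i\<in>UNIV. D i)" for \<xi>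
    proof -
      let ?c = "cmod (torus_coeff \<phi> \<xi>)"
      have i: "\<rho> \<xi> ^ m * (\<bar>real_of_int (\<xi> $ i)\<bar> * ?c) \<le> D i" for i
      proof -
        have "1 * (\<bar>real_of_int (\<xi> $ i)\<bar> * ?c) \<le> 2 * pi * (\<bar>real_of_int (\<xi> $ i)\<bar> * ?c)"
          using pi_ge_two by (intro mult_right_mono) auto
        also have "\<dots> = cmod (torus_coeff (partial i \<phi>) \<xi>)"
          by (simp add: torus_coeff_partial[OF Suc.prems] norm_mult)
        finally have "\<bar>real_of_int (\<xi> $ i)\<bar> * ?c \<le> cmod (torus_coeff (partial i \<phi>) \<xi>)" by simp
        from order_trans[OF mult_left_mono[OF this] D[of \<xi> i]] show ?thesis by simp
      qed
      have "\<rho> \<xi> ^ Suc m * ?c = \<rho> \<xi> * (\<rho> \<xi> ^ m * ?c)" by simp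
      also have "\<dots> \<le> (1 + (\<Sum>i\<in>UNIV. \<bar>real_of_int (\<xi> $ i)\<bar>)) * (\<rho> \<xi> ^ m * ?c)"
        by (intro mult_right_mono bessel_weight_le) auto
      also have "\<dots> = \<rho> \<xi> ^ m * ?c + (\<Sum>i\<in>UNIV. \<rho> \<xi> ^ m * (\<bar>real_of_int (\<xi> $ i)\<bar> * ?c))"
        by (simp add: ring_distribs sum_distrib_right sum_distrib_left ac_simps)
      also have "\<dots> \<le> B + (\<Sum>i\<in>UNIV. D i)" by (intro add_mono sum_mono B i)
      finally show ?thesis .
    qed
    then show ?case by blast
  qed
qed

text \<open>A nonempty open set is not null, so vanishing almost everywhere becomes vanishing
  everywhere. A representative with nonzero value may sit on a face of the cube; a nearby point in
  the open box is then obtained from the closure.\<close>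

lemma continuous_periodic_coeff_zero:
  fixes f :: "real^'n::finite \<Rightarrow> complex"
  assumes c: "continuous_on UNIV f" and p: "periodic f" and 0: "\<And>\<xi>. torus_coeff f \<xi> = 0"
  shows "f x = 0"
proof (rule ccontr)
  assume "f x \<noteq> 0"
  then obtain y where y: "y \<in> torus" "f y \<noteq> 0"
    using periodic_representative[OF p] by metis
  define S where "S = box 0 1 \<inter> {z. f z \<noteq> 0}"
  have o: "open {z. f z \<noteq> 0}" by (intro open_Collect_neq c continuous_intros)
  then have "open S" by (auto simp: S_def)
  have "box 0 (1::real^'n) \<noteq> {}" by (auto simp: box_ne_empty Basis_vec_def inner_axis)
  then have "y \<in> closure (box 0 1)"
    using y by (auto simp: closure_box torus_def mem_box_cart less_imp_le)
  then have "box 0 1 \<inter> {z. f z \<noteq> 0} \<noteq> {}"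
    using open_Int_closure_eq_empty[OF o, of "box 0 1"] y by blast
  then have "S \<noteq> {}" by (simp add: S_def)
  have "AE x in torus_measure. f x = 0"
    using coeff_free_AE_zero[of f] continuous_periodic_integrable[OF c p] 0 by (simp add: coeff_free_def)
  then have "AE x in lborel. x \<in> torus \<longrightarrow> f x = 0"
    unfolding torus_measure_def by (subst (asm) AE_restrict_space_iff) auto
  then have "AE x in lborel. x \<notin> S"
    by eventually_elim (auto simp: S_def torus_def mem_box_cart less_imp_le)
  then have "emeasure lborel S = 0"
    using \<open>open S\<close> by (subst (asm) AE_iff_measurable[of S]) auto
  then have "negligible S"
    using \<open>open S\<close> by (simp add: negligible_iff_emeasure0)
  with \<open>open S\<close> \<open>S \<noteq> {}\<close> show False using open_not_negligible by blast
qed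

lemma Cinf_per_expansion:
  assumes "\<phi> \<in> Cinf_per"
  shows "\<phi> = fseries (torus_coeff \<phi>)"
proof
  fix x
  note r = rapid_torus_coeff[OF assms]
  note \<psi> = fseries_Cinf_per[OF r]
  have "\<phi> x - fseries (torus_coeff \<phi>) x = 0"
  proof (rule continuous_periodic_coeff_zero)
    show "continuous_on UNIV (\<lambda>x. \<phi> x - fseries (torus_coeff \<phi>) x)"
      by (intro continuous_intros Cinf_per_D(1) assms \<psi>)
    show "periodic (\<lambda>x. \<phi> x - fseries (torus_coeff \<phi>) x)"
      using Cinf_per_D(2)[OF assms] Cinf_per_D(2)[OF \<psi>] by (simp add: periodic_def)
    show "torus_coeff (\<lambda>x. \<phi> x - fseries (torus_coeff \<phi>) x) \<xi> = 0" for \<xi>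
      using torus_coeff_fseries[OF r, of \<xi>]
        integrable_mult_character[OF Cinf_per_D(4)[OF assms], of "- \<xi>"]
        integrable_mult_character[OF Cinf_per_D(4)[OF \<psi>], of "- \<xi>"]
      by (simp add: torus_coeff_def left_diff_distrib)
  qed
  then show "\<phi> x = fseries (torus_coeff \<phi>) x" by simp
qed

subsection \<open>Distributions are determined by their Fourier coefficients\<close>

lemma pdist_add:
  "g \<in> periodic_distributions \<Longrightarrow> \<phi> \<in> Cinf_per \<Longrightarrow> \<psi> \<in> Cinf_per \<Longrightarrow>
    g (\<lambda>x. \<phi> x + \<psi> x) = g \<phi> + g \<psi>"
  by (simp add: periodic_distributions_def)

lemma pdist_cmult:
  "g \<in> periodic_distributions \<Longrightarrow> \<phi> \<in> Cinf_per \<Longrightarrow> g (\<lambda>x. c * \<phi> x) = c * g \<phi>"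
  by (simp add: periodic_distributions_def)

lemma pdist_trig_poly:
  assumes g: "g \<in> periodic_distributions" and F: "finite F"
  shows "g (\<lambda>x. \<Sum>\<xi>\<in>F. c \<xi> * character \<xi> x) = (\<Sum>\<xi>\<in>F. c \<xi> * g (character \<xi>))"
  using F
proof induction
  case empty
  show ?case using pdist_cmult[OF g character_Cinf_per, of 0 0] by simp
next
  case (insert \<xi> F)
  have "(\<lambda>x. c \<xi> * character \<xi> x) \<in> Cinf_per"
    using trig_poly_Cinf_per[of "{\<xi>}" c] by simp
  then show ?case
    using insert pdist_add[OF g _ trig_poly_Cinf_per[OF insert(1)]] pdist_cmult[OF g character_Cinf_per]
    by simp
qed

text \<open>Split the expansion of a test function into a trigonometric polynomial and a tail. On
  the polynomial the functionals agree by linearity; on the tail both are small by their finite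
  order, since every seminorm of the tail tends to zero.\<close>

lemma pdist_eqI:
  assumes g: "g \<in> periodic_distributions" and h: "h \<in> periodic_distributions"
    and eq: "fourier_coeff g = fourier_coeff h"
  shows "pdist_eq g h"
  unfolding pdist_eq_def
proof
  fix \<phi> :: "real^'a \<Rightarrow> complex" assume \<phi>: "\<phi> \<in> Cinf_per"
  define c where "c = torus_coeff \<phi>"
  have c: "rapid c" unfolding c_def by (rule rapid_torus_coeff[OF \<phi>])
  have eqc: "g (character \<xi>) = h (character \<xi>)" for \<xi>
    using fun_cong[OF eq, of "- \<xi>"] by (simp add: fourier_coeff_eq)
  obtain m C where C: "\<And>\<psi>. \<psi> \<in> Cinf_per \<Longrightarrow> cmod (g \<psi>) \<le> C * Cm_norm m \<psi>"
    using g unfolding periodic_distributions_def by blast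
  obtain m' C' where C': "\<And>\<psi>. \<psi> \<in> Cinf_per \<Longrightarrow> cmod (h \<psi>) \<le> C' * Cm_norm m' \<psi>"
    using h unfolding periodic_distributions_def by blast
  \<comment> \<open>The two functionals may have different orders; one weight \<open>w\<close> at
    the larger order controls both tails.\<close>
  define M where "M = max m m'"
  define w where "w \<xi> = (2 * pi) ^ M * (\<rho> \<xi> ^ M * cmod (c \<xi>))" for \<xi>
  have ws: "w summable_on UNIV"
    using c unfolding w_def rapid_def by (intro summable_on_cmult_right) blast
  have w0: "0 \<le> w \<xi>" for \<xi> by (simp add: w_def)
  have tail: "\<bar>K\<bar> * Cm_norm k (fseries (\<lambda>\<xi>. if \<xi> \<notin> F then c \<xi> else 0)) \<le>
      \<bar>K\<bar> * infsum (\<lambda>\<xi>. if \<xi> \<notin> F then w \<xi> else 0) UNIV" if "k \<le> M" for k K F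
  proof (rule mult_left_mono)
    let ?d = "\<lambda>\<xi>. if \<xi> \<notin> F then c \<xi> else 0"
    have r: "rapid ?d" by (rule rapid_restrict[OF c])
    have "Cm_norm k (fseries ?d) \<le> (\<Sum>\<^sub>\<infinity>\<xi>. (2 * pi) ^ k * (\<rho> \<xi> ^ k * cmod (?d \<xi>)))"
      by (rule Cm_norm_fseries(1)[OF r])
    also have "\<dots> \<le> infsum (\<lambda>\<xi>. if \<xi> \<notin> F then w \<xi> else 0) UNIV"
    proof (rule infsum_mono)
      show "(\<lambda>\<xi>. (2 * pi) ^ k * (\<rho> \<xi> ^ k * cmod (?d \<xi>))) summable_on UNIV"
        using r unfolding rapid_def by (intro summable_on_cmult_right) blast
      show "(\<lambda>\<xi>. if \<xi> \<notin> F then w \<xi> else 0) summable_on UNIV"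
        using w0 by (intro summable_on_comparison_test[OF ws]) auto
      show "(2 * pi) ^ k * (\<rho> \<xi> ^ k * cmod (?d \<xi>)) \<le> (if \<xi> \<notin> F then w \<xi> else 0)" for \<xi>
        using that pi_ge_two bessel_weight_ge_1[of \<xi>]
        by (auto simp: w_def intro!: mult_mono power_increasing)
    qed
    finally show "Cm_norm k (fseries ?d) \<le> infsum (\<lambda>\<xi>. if \<xi> \<notin> F then w \<xi> else 0) UNIV" .
  qed simp
  have "cmod (g \<phi> - h \<phi>) \<le> 0"
  proof (rule field_le_epsilon)
    fix e :: real assume e: "e > 0"
    \<comment> \<open>The added 1 keeps the divisor positive when both continuity constants
      vanish.\<close>
    define K where "K = \<bar>C\<bar> + \<bar>C'\<bar> + 1"
    have K: "K > 0" by (simp add: K_def)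
    then obtain F where F: "finite F" "infsum (\<lambda>\<xi>. if \<xi> \<notin> F then w \<xi> else 0) UNIV \<le> e / K"
      using tail_small[OF ws w0, of "e / K"] e by auto
    let ?T = "infsum (\<lambda>\<xi>. if \<xi> \<notin> F then w \<xi> else 0) UNIV"
    have T0: "0 \<le> ?T" by (rule infsum_nonneg) (simp add: w0)
    define r where "r = fseries (\<lambda>\<xi>. if \<xi> \<notin> F then c \<xi> else 0)"
    have r: "r \<in> Cinf_per" unfolding r_def by (intro fseries_Cinf_per rapid_restrict c)
    \<comment> \<open>The constants \<open>C\<close> and \<open>C'\<close> are of unknown sign, so
      they are first replaced by their absolute values.\<close>
    have le: "z \<le> \<bar>K\<bar> * ?T" if "z \<le> K * Cm_norm k r" "k \<le> M" for z K k
    proof -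
      have "0 \<le> Cm_norm k r" unfolding r_def by (intro Cm_norm_fseries(2) rapid_restrict c)
      then have "K * Cm_norm k r \<le> \<bar>K\<bar> * Cm_norm k r" by (intro mult_right_mono) auto
      with that(1) tail[OF that(2), of K F] show ?thesis by (simp add: r_def)
    qed
    have \<phi>_eq: "\<phi> = (\<lambda>x. (\<Sum>\<xi>\<in>F. c \<xi> * character \<xi> x) + r x)"
    proof
      fix x
      have "\<phi> x = fseries c x" unfolding c_def by (subst Cinf_per_expansion[OF \<phi>]) simp
      also have "\<dots> = (\<Sum>\<xi>\<in>F. c \<xi> * character \<xi> x) + r x"
        unfolding r_def by (rule fseries_split[OF c F(1)])
      finally show "\<phi> x = (\<Sum>\<xi>\<in>F. c \<xi> * character \<xi> x) + r x" .
    qed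
    have "k \<phi> = (\<Sum>\<xi>\<in>F. c \<xi> * k (character \<xi>)) + k r" if k: "k \<in> periodic_distributions" for k
      unfolding \<phi>_eq using pdist_add[OF k trig_poly_Cinf_per[OF F(1)] r] pdist_trig_poly[OF k F(1)] by simp
    from this[OF g] this[OF h] have "g \<phi> - h \<phi> = g r - h r" by (simp add: eqc)
    also have "cmod \<dots> \<le> cmod (g r) + cmod (h r)" by (rule norm_triangle_ineq4)
    also have "cmod (g r) \<le> \<bar>C\<bar> * ?T" by (rule le[OF C[OF r]]) (simp add: M_def)
    also have "cmod (h r) \<le> \<bar>C'\<bar> * ?T" by (rule le[OF C'[OF r]]) (simp add: M_def)
    finally have "cmod (g \<phi> - h \<phi>) \<le> (\<bar>C\<bar> + \<bar>C'\<bar>) * ?T" by (simp add: ring_distribs)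
    also have "\<dots> \<le> K * (e / K)"
      using F T0 by (intro mult_mono) (auto simp: K_def)
    also have "\<dots> = e" using K by simp
    finally show "cmod (g \<phi> - h \<phi>) \<le> 0 + e" by simp
  qed
  then show "g \<phi> = h \<phi>" by simp
qed

lemma dist_of_fun_periodic_distribution:
  assumes U: "integrable torus_measure U"
  shows "dist_of_fun U \<in> periodic_distributions"
proof -
  have i: "integrable torus_measure (\<lambda>x. U x * \<phi> x)" if \<phi>: "\<phi> \<in> Cinf_per" for \<phi>
  proof -
    obtain B where B: "\<And>x. cmod (\<phi> x) \<le> B"
      using continuous_periodic_bounded[OF Cinf_per_D(1,2)[OF \<phi>]] by blast
    show ?thesis
      by (rule integrable_torus_mult_bounded[OF U _ B])
        (intro borel_imp_torus_measurable borel_measurable_continuous_onI Cinf_per_D(1) \<phi>)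
  qed
  have "cmod (dist_of_fun U \<phi>) \<le> (\<integral>x. cmod (U x) \<partial>torus_measure) * Cm_norm 0 \<phi>" if \<phi>: "\<phi> \<in> Cinf_per" for \<phi>
  proof -
    obtain B where B: "\<And>x. cmod (\<phi> x) \<le> B"
      using continuous_periodic_bounded[OF Cinf_per_D(1,2)[OF \<phi>]] by blast
    have "bdd_above ((\<lambda>(is, x). cmod (iter_partial is \<phi> x)) ` ({is. length is \<le> 0} \<times> UNIV))"
      using B by (intro bdd_aboveI[where M=B]) (auto simp: iter_partial_def)
    then have le: "cmod (\<phi> x) \<le> Cm_norm 0 \<phi>" for x
      unfolding Cm_norm_def
      using cSUP_upper[of "([], x)" _ "\<lambda>(is, x). cmod (iter_partial is \<phi> x)"] by (simp add: iter_partial_def)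
    have "cmod (dist_of_fun U \<phi>) \<le> (\<integral>x. cmod (U x * \<phi> x) \<partial>torus_measure)"
      unfolding dist_of_fun_eq by (rule integral_norm_bound)
    also have "\<dots> \<le> (\<integral>x. cmod (U x) * Cm_norm 0 \<phi> \<partial>torus_measure)"
      using integrable_norm[OF i[OF \<phi>]] U le by (intro integral_mono) (auto simp: norm_mult intro!: mult_left_mono)
    finally show ?thesis by simp
  qed
  then show ?thesis
    using i unfolding periodic_distributions_def dist_of_fun_eq
    by (auto simp: ring_distribs mult.left_commute[of "U _"])
qed

subsection \<open>Square integrable functions on the torus\<close>

lemma integrable_mult_square:
  fixes f g :: "'a \<Rightarrow> real"
  assumes [measurable]: "f \<in> borel_measurable M" "g \<in> borel_measurable M"
    and f: "integrable M (\<lambda>x. (f x)\<^sup>2)" and g: "integrable M (\<lambda>x. (g x)\<^sup>2)"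
  shows "integrable M (\<lambda>x. f x * g x)"
proof (rule Bochner_Integration.integrable_bound)
  show "integrable M (\<lambda>x. (f x)\<^sup>2 + (g x)\<^sup>2)" using f g by simp
  show "AE x in M. norm (f x * g x) \<le> norm ((f x)\<^sup>2 + (g x)\<^sup>2)"
  proof (rule AE_I2)
    fix x
    have "2 * (\<bar>f x\<bar> * \<bar>g x\<bar>) \<le> (f x)\<^sup>2 + (g x)\<^sup>2"
      using sum_squares_bound[of "\<bar>f x\<bar>" "\<bar>g x\<bar>"] by simp
    moreover have "0 \<le> \<bar>f x\<bar> * \<bar>g x\<bar>" by simp
    moreover have "norm (f x * g x) = \<bar>f x\<bar> * \<bar>g x\<bar>" by (simp add: abs_mult)
    moreover have "norm ((f x)\<^sup>2 + (g x)\<^sup>2) = (f x)\<^sup>2 + (g x)\<^sup>2" by simp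
    ultimately show "norm (f x * g x) \<le> norm ((f x)\<^sup>2 + (g x)\<^sup>2)" by linarith
  qed
qed simp

text \<open>The integral of the square of \<open>t f + g\<close> is a quadratic polynomial in
  \<open>t\<close> that is never negative.\<close>

lemma Cauchy_Schwarz_integral:
  fixes f g :: "'a \<Rightarrow> real"
  assumes m: "f \<in> borel_measurable M" "g \<in> borel_measurable M"
    and f: "integrable M (\<lambda>x. (f x)\<^sup>2)" and g: "integrable M (\<lambda>x. (g x)\<^sup>2)"
  shows "(\<integral>x. f x * g x \<partial>M)\<^sup>2 \<le> (\<integral>x. (f x)\<^sup>2 \<partial>M) * (\<integral>x. (g x)\<^sup>2 \<partial>M)"
proof -
  define A B I where "A = (\<integral>x. (f x)\<^sup>2 \<partial>M)" and "B = (\<integral>x. (g x)\<^sup>2 \<partial>M)" and "I = (\<integral>x. f x * g x \<partial>M)"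
  note fg = integrable_mult_square[OF m f g]
  have q: "0 \<le> t\<^sup>2 * A + 2 * t * I + B" for t
  proof -
    have "0 \<le> (\<integral>x. (t * f x + g x)\<^sup>2 \<partial>M)" by simp
    also have "\<dots> = (\<integral>x. t\<^sup>2 * (f x)\<^sup>2 + 2 * t * (f x * g x) + (g x)\<^sup>2 \<partial>M)"
      by (simp add: power2_sum power_mult_distrib algebra_simps)
    also have "\<dots> = t\<^sup>2 * A + 2 * t * I + B" using f g fg by (simp add: A_def B_def I_def)
    finally show ?thesis .
  qed
  have AB: "0 \<le> A" "0 \<le> B" by (simp_all add: A_def B_def)
  have "I\<^sup>2 \<le> A * B"
  proof (cases "A = 0")
    case True
    have "I = 0"
    proof (rule ccontr)
      assume "I \<noteq> 0"
      \<comment> \<open>With \<open>A = 0\<close> the polynomial is linear in \<open>t\<close>, and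
        at this point it takes the value -1.\<close>
      then show False using q[of "- (B + 1) / (2 * I)"] True by (simp add: field_simps)
    qed
    then show ?thesis using True by simp
  next
    case False
    then have "A > 0" using AB by simp
    \<comment> \<open>The minimiser of the quadratic.\<close>
    have "0 \<le> (- I / A)\<^sup>2 * A + 2 * (- I / A) * I + B" by (rule q)
    also have "\<dots> = B - I\<^sup>2 / A" using False by (simp add: power2_eq_square field_simps)
    finally show ?thesis using \<open>A > 0\<close> by (simp add: field_simps)
  qed
  then show ?thesis by (simp add: A_def B_def I_def)
qed

definition square_integrable :: "(real^'n::finite \<Rightarrow> complex) \<Rightarrow> bool" where
  "square_integrable U \<longleftrightarrow> U \<in> borel_measurable torus_measure \<and>
    integrable torus_measure (\<lambda>x. (cmod (U x))\<^sup>2)"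

definition L2_sq :: "(real^'n::finite \<Rightarrow> complex) \<Rightarrow> real" where
  "L2_sq U = (\<integral>x. (cmod (U x))\<^sup>2 \<partial>torus_measure)"

lemma square_integrable_mult:
  assumes U: "square_integrable U" and V: "square_integrable V"
  shows "integrable torus_measure (\<lambda>x. U x * V x)"
    and "(cmod (\<integral>x. U x * V x \<partial>torus_measure))\<^sup>2 \<le> L2_sq U * L2_sq V"
proof -
  have [measurable]: "U \<in> borel_measurable torus_measure" "V \<in> borel_measurable torus_measure"
    and i: "integrable torus_measure (\<lambda>x. (cmod (U x))\<^sup>2)" "integrable torus_measure (\<lambda>x. (cmod (V x))\<^sup>2)"
    using U V by (auto simp: square_integrable_def)
  have "integrable torus_measure (\<lambda>x. cmod (U x) * cmod (V x))"
    by (rule integrable_mult_square[OF _ _ i]) auto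
  then have "integrable torus_measure (\<lambda>x. cmod (U x * V x))" by (simp add: norm_mult)
  then show int: "integrable torus_measure (\<lambda>x. U x * V x)"
    by (rule integrable_norm_cancel) measurable
  have "cmod (\<integral>x. U x * V x \<partial>torus_measure) \<le> (\<integral>x. cmod (U x) * cmod (V x) \<partial>torus_measure)"
    using integral_norm_bound[of torus_measure "\<lambda>x. U x * V x"] by (simp add: norm_mult)
  then have "(cmod (\<integral>x. U x * V x \<partial>torus_measure))\<^sup>2 \<le> (\<integral>x. cmod (U x) * cmod (V x) \<partial>torus_measure)\<^sup>2"
    by (intro power_mono) auto
  also have "\<dots> \<le> L2_sq U * L2_sq V"
    unfolding L2_sq_def by (rule Cauchy_Schwarz_integral[OF _ _ i]) auto
  finally show "(cmod (\<integral>x. U x * V x \<partial>torus_measure))\<^sup>2 \<le> L2_sq U * L2_sq V" .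
qed

lemma square_integrable_bounded:
  assumes "f \<in> borel_measurable torus_measure" "\<And>x. cmod (f x) \<le> B"
  shows "square_integrable f"
  unfolding square_integrable_def
proof
  show "integrable torus_measure (\<lambda>x. (cmod (f x))\<^sup>2)"
    by (rule integrable_torus_bounded[where B="B\<^sup>2"]) (use assms in \<open>auto intro: power_mono\<close>)
qed (rule assms)

lemma square_integrable_add:
  assumes U: "square_integrable U" and V: "square_integrable V"
  shows "square_integrable (\<lambda>x. U x + V x)"
proof -
  have [measurable]: "U \<in> borel_measurable torus_measure" "V \<in> borel_measurable torus_measure"
    and i: "integrable torus_measure (\<lambda>x. 2 * (cmod (U x))\<^sup>2 + 2 * (cmod (V x))\<^sup>2)"
    using U V by (auto simp: square_integrable_def)
  have "integrable torus_measure (\<lambda>x. (cmod (U x + V x))\<^sup>2)"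
  proof (rule Bochner_Integration.integrable_bound[OF i])
    show "AE x in torus_measure. norm ((cmod (U x + V x))\<^sup>2) \<le> norm (2 * (cmod (U x))\<^sup>2 + 2 * (cmod (V x))\<^sup>2)"
    proof (rule AE_I2)
      fix x
      have "(cmod (U x + V x))\<^sup>2 \<le> (cmod (U x) + cmod (V x))\<^sup>2"
        by (intro power_mono norm_triangle_ineq) simp
      also have "\<dots> \<le> 2 * (cmod (U x))\<^sup>2 + 2 * (cmod (V x))\<^sup>2"
        using sum_squares_bound[of "cmod (U x)" "cmod (V x)"] by (simp add: power2_sum)
      finally show "norm ((cmod (U x + V x))\<^sup>2) \<le> norm (2 * (cmod (U x))\<^sup>2 + 2 * (cmod (V x))\<^sup>2)" by simp
    qed
  qed measurable
  then show ?thesis by (simp add: square_integrable_def)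
qed

lemma square_integrable_cmult:
  "square_integrable U \<Longrightarrow> square_integrable (\<lambda>x. c * U x)"
  by (auto simp: square_integrable_def norm_mult power_mult_distrib)

lemma square_integrable_diff:
  "square_integrable U \<Longrightarrow> square_integrable V \<Longrightarrow> square_integrable (\<lambda>x. U x - V x)"
  using square_integrable_add[of U "\<lambda>x. -1 * V x"] square_integrable_cmult[of V "-1"] by simp

lemma square_integrable_character: "square_integrable (character \<xi>)"
  by (rule square_integrable_bounded[where B=1]) auto

lemma square_integrable_integrable:
  assumes "square_integrable U" shows "integrable torus_measure U"
  using square_integrable_mult(1)[OF assms square_integrable_character[of 0]] by simp

lemma L2_sq_character: "L2_sq (character \<xi>) = 1"
  by (simp add: L2_sq_def)

lemma square_integrable_mult_character:
  assumes "square_integrable V"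
  shows "square_integrable (\<lambda>x. V x * character \<xi> x)" "L2_sq (\<lambda>x. V x * character \<xi> x) = L2_sq V"
  using assms by (auto simp: square_integrable_def L2_sq_def norm_mult)

section \<open>Parseval for trigonometric polynomials and the Riesz-Fischer theorem\<close>

lemma square_integrable_trig_poly:
  "finite F \<Longrightarrow> square_integrable (\<lambda>x. \<Sum>\<xi>\<in>F. c \<xi> * character \<xi> x)"
proof (induction F rule: finite_induct)
  case empty
  show ?case by (rule square_integrable_bounded[where B=0]) auto
next
  case (insert \<xi> F)
  then show ?case
    by (simp add: square_integrable_add square_integrable_cmult square_integrable_character)
qed

lemma L2_sq_trig_poly:
  assumes F: "finite F"
  shows "L2_sq (\<lambda>x. \<Sum>\<xi>\<in>F. c \<xi> * character \<xi> x) = (\<Sum>\<xi>\<in>F. (cmod (c \<xi>))\<^sup>2)"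
proof -
  let ?S = "\<lambda>x. \<Sum>\<xi>\<in>F. c \<xi> * character \<xi> x"
  have eq: "complex_of_real ((cmod (?S x))\<^sup>2)
      = (\<Sum>\<xi>\<in>F. \<Sum>\<eta>\<in>F. c \<xi> * cnj (c \<eta>) * (character \<xi> x * character (- \<eta>) x))" for x
    unfolding complex_norm_square
    by (simp add: sum_product cnj_character ac_simps)
  have I: "integrable torus_measure (\<lambda>x. c \<xi> * cnj (c \<eta>) * (character \<xi> x * character (- \<eta>) x))" for \<xi> \<eta>
    by (intro integrable_mult_right integrable_mult_character integrable_character)
  have "complex_of_real (L2_sq ?S) = (\<integral>x. complex_of_real ((cmod (?S x))\<^sup>2) \<partial>torus_measure)"
    unfolding L2_sq_def by (rule integral_complex_of_real[symmetric])
  also have "\<dots> = (\<Sum>\<xi>\<in>F. \<Sum>\<eta>\<in>F. c \<xi> * cnj (c \<eta>) * torus_coeff (character \<xi>) \<eta>)"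
    unfolding eq torus_coeff_def
    using I by (simp only: Bochner_Integration.integral_sum Bochner_Integration.integrable_sum
        integral_mult_right_zero)
  also have "\<dots> = complex_of_real (\<Sum>\<xi>\<in>F. (cmod (c \<xi>))\<^sup>2)"
    using F by (simp add: torus_coeff_character complex_norm_square[symmetric] if_distrib cong: if_cong)
  finally show ?thesis by (simp only: of_real_eq_iff)
qed

lemma torus_coeff_trig_poly:
  assumes "finite F"
  shows "torus_coeff (\<lambda>x. \<Sum>\<xi>\<in>F. c \<xi> * character \<xi> x) \<eta> = (if \<eta> \<in> F then c \<eta> else 0)"
  using torus_coeff_fseries[OF rapid_finite[OF assms], of c \<eta>] fseries_finite[OF assms, of c]
  by (simp add: fseries_def[abs_def])

text \<open>Frequencies are listed through \<open>to_nat\<close>; since the square sums converge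
  unconditionally, the order is immaterial. A sequence of partial sums, rather than a net, is what
  subsequence extraction and Fatou's lemma work with.\<close>

definition fpartial :: "nat \<Rightarrow> (int^'n::finite \<Rightarrow> complex) \<Rightarrow> real^'n \<Rightarrow> complex" where
  "fpartial n c x = (\<Sum>\<xi> | to_nat \<xi> < n. c \<xi> * character \<xi> x)"

lemma finite_to_nat_less [simp]: "finite {\<xi> :: 'a::countable. to_nat \<xi> < n}"
  by (rule finite_imageD[of to_nat]) (auto intro: finite_subset[of _ "{..<n}"] inj_on_subset[OF inj_to_nat])

lemma sum_to_nat_tendsto:
  fixes f :: "'a::countable \<Rightarrow> real"
  assumes "f summable_on UNIV"
  shows "(\<lambda>n. \<Sum>\<xi> | to_nat \<xi> < n. f \<xi>) \<longlonglongrightarrow> infsum f UNIV"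
proof -
  have "filterlim (\<lambda>n. {\<xi> :: 'a. to_nat \<xi> < n}) (finite_subsets_at_top UNIV) sequentially"
    unfolding filterlim_finite_subsets_at_top
  proof safe
    fix X :: "'a set" assume X: "finite X"
    show "\<forall>\<^sub>F n in sequentially. finite {\<xi> :: 'a. to_nat \<xi> < n} \<and> X \<subseteq> {\<xi>. to_nat \<xi> < n} \<and> {\<xi> :: 'a. to_nat \<xi> < n} \<subseteq> UNIV"
      using eventually_gt_at_top[of "Max (insert 0 (to_nat ` X))"]
      by eventually_elim (use X in auto)
  qed
  from filterlim_compose[OF infsum_tendsto[OF assms] this] show ?thesis by simp
qed

text \<open>The partial sums are Cauchy in the square mean, with the tail \<open>\<tau>\<close> of
  the coefficient series as modulus. They are thus Cauchy in L1, a subsequence converges almost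
  everywhere to \<open>U\<close>, and Fatou's lemma carries the modulus over to \<open>U\<close>.
  The convergence in the third conclusion is what later evaluates products.\<close>

lemma Riesz_Fischer:
  fixes c :: "int^'n::finite \<Rightarrow> complex"
  assumes c: "(\<lambda>\<xi>. (cmod (c \<xi>))\<^sup>2) summable_on UNIV"
  obtains U where "square_integrable U" "torus_coeff U = c" "(\<lambda>n. L2_sq (\<lambda>x. U x - fpartial n c x)) \<longlonglongrightarrow> 0"
proof -
  define S where "S n = fpartial n c" for n
  define \<tau> where "\<tau> n = infsum (\<lambda>\<xi>. (cmod (c \<xi>))\<^sup>2) UNIV - (\<Sum>\<xi> | to_nat \<xi> < n. (cmod (c \<xi>))\<^sup>2)" for n
  have \<tau>_lim: "\<tau> \<longlonglongrightarrow> 0"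
    unfolding \<tau>_def using tendsto_diff[OF tendsto_const[of "infsum (\<lambda>\<xi>. (cmod (c \<xi>))\<^sup>2) UNIV"] sum_to_nat_tendsto[OF c]]
    by simp
  have Ssq: "square_integrable (S n)" for n
    unfolding S_def fpartial_def by (rule square_integrable_trig_poly) simp
  have [measurable]: "S n \<in> borel_measurable torus_measure" for n
    using Ssq[of n] by (simp add: square_integrable_def)
  have L2: "L2_sq (\<lambda>x. S m x - S n x) \<le> \<tau> n" if "n \<le> m" for m n
  proof -
    let ?D = "{\<xi> :: int^'n. to_nat \<xi> < m} - {\<xi>. to_nat \<xi> < n}"
    have sub: "{\<xi> :: int^'n. to_nat \<xi> < n} \<subseteq> {\<xi>. to_nat \<xi> < m}" using that by auto
    have "S m x - S n x = (\<Sum>\<xi>\<in>?D. c \<xi> * character \<xi> x)" for x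
      unfolding S_def fpartial_def by (rule sum_diff[symmetric]) (use sub in auto)
    then have "L2_sq (\<lambda>x. S m x - S n x) = (\<Sum>\<xi>\<in>?D. (cmod (c \<xi>))\<^sup>2)"
      by (simp add: L2_sq_trig_poly)
    also have "\<dots> = (\<Sum>\<xi> | to_nat \<xi> < m. (cmod (c \<xi>))\<^sup>2) - (\<Sum>\<xi> | to_nat \<xi> < n. (cmod (c \<xi>))\<^sup>2)"
      by (rule sum_diff) (use sub in auto)
    also have "\<dots> \<le> \<tau> n"
      unfolding \<tau>_def using finite_sum_le_infsum[OF c, of "{\<xi>. to_nat \<xi> < m}"] by simp
    finally show ?thesis .
  qed
  have "\<exists>N. \<forall>i\<ge>N. \<forall>j\<ge>N. LINT x|torus_measure. norm (S i x - S j x) < e" if "e > 0" for e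
  proof -
    obtain N where N: "\<And>n. n \<ge> N \<Longrightarrow> \<bar>\<tau> n\<bar> < e\<^sup>2"
      using LIMSEQ_D[OF \<tau>_lim, of "e\<^sup>2"] \<open>e > 0\<close> by auto
    have "LINT x|torus_measure. norm (S i x - S j x) < e" if "i \<ge> N" "j \<ge> N" for i j
    proof -
      let ?f = "\<lambda>x. S i x - S j x"
      have sq: "square_integrable ?f" by (intro square_integrable_diff Ssq)
      have "L2_sq ?f < e\<^sup>2"
      proof (cases "i \<le> j")
        case True
        have "L2_sq ?f = L2_sq (\<lambda>x. S j x - S i x)" by (simp add: L2_sq_def norm_minus_commute)
        then show ?thesis using L2[OF True] N[OF that(1)] by simp
      next
        case False
        then show ?thesis using L2[of j i] N[OF that(2)] by simp
      qed
      \<comment> \<open>Cauchy-Schwarz against the constant 1, whose square integral over the torus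
        is 1, descends from the square mean to L1.\<close>
      moreover have "(LINT x|torus_measure. cmod (?f x) * 1)\<^sup>2 \<le> L2_sq ?f * (LINT x|(torus_measure :: (real^'n) measure). 1\<^sup>2)"
        unfolding L2_sq_def using sq integrable_character[of "0 :: int^'n"]
        by (intro Cauchy_Schwarz_integral) (auto simp: square_integrable_def finite_measure.integrable_const finite_torus_measure)
      ultimately have "(LINT x|torus_measure. cmod (?f x))\<^sup>2 < e\<^sup>2" by simp
      then show ?thesis using \<open>e > 0\<close> by (simp add: power_less_imp_less_base)
    qed
    then show ?thesis by blast
  qed
  then obtain r where r: "strict_mono r" and AE_C: "AE x in torus_measure. Cauchy (\<lambda>i. S (r i) x)"
    using cauchy_L1_AE_cauchy_subseq[of torus_measure S] square_integrable_integrable[OF Ssq] by blast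
  define U where "U x = lim (\<lambda>i. S (r i) x)" for x
  have [measurable]: "U \<in> borel_measurable torus_measure"
    unfolding U_def by (rule borel_measurable_lim_metric) simp
  have AE_U: "AE x in torus_measure. (\<lambda>i. S (r i) x) \<longlonglongrightarrow> U x"
    using AE_C by eventually_elim (auto simp: U_def Cauchy_convergent_iff convergent_LIMSEQ_iff)
  \<comment> \<open>Fatou's lemma along the subsequence; nonnegative integrals are used because
    square integrability of the limit is only a consequence of this bound.\<close>
  have nn: "(\<integral>\<^sup>+x. ennreal ((cmod (U x - S n x))\<^sup>2) \<partial>torus_measure) \<le> ennreal (\<tau> n)" for n
  proof -
    have "(\<integral>\<^sup>+x. ennreal ((cmod (U x - S n x))\<^sup>2) \<partial>torus_measure)
      = (\<integral>\<^sup>+x. liminf (\<lambda>i. ennreal ((cmod (S (r i) x - S n x))\<^sup>2)) \<partial>torus_measure)"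
    proof (rule nn_integral_cong_AE)
      show "AE x in torus_measure. ennreal ((cmod (U x - S n x))\<^sup>2)
          = liminf (\<lambda>i. ennreal ((cmod (S (r i) x - S n x))\<^sup>2))"
        using AE_U
      proof eventually_elim
        case (elim x)
        have "(\<lambda>i. ennreal ((cmod (S (r i) x - S n x))\<^sup>2)) \<longlonglongrightarrow> ennreal ((cmod (U x - S n x))\<^sup>2)"
          by (intro tendsto_intros elim)
        from lim_imp_Liminf[OF _ this] show ?case by simp
      qed
    qed
    also have "\<dots> \<le> liminf (\<lambda>i. \<integral>\<^sup>+x. ennreal ((cmod (S (r i) x - S n x))\<^sup>2) \<partial>torus_measure)"
      by (rule nn_integral_liminf) measurable
    also have "\<dots> \<le> liminf (\<lambda>i::nat. ennreal (\<tau> n))"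
    proof (rule Liminf_mono)
      show "\<forall>\<^sub>F i in sequentially. (\<integral>\<^sup>+x. ennreal ((cmod (S (r i) x - S n x))\<^sup>2) \<partial>torus_measure) \<le> ennreal (\<tau> n)"
        using eventually_ge_at_top[of n]
      proof eventually_elim
        case (elim i)
        then have "n \<le> r i" using seq_suble[OF r, of i] by linarith
        have "(\<integral>\<^sup>+x. ennreal ((cmod (S (r i) x - S n x))\<^sup>2) \<partial>torus_measure) = ennreal (L2_sq (\<lambda>x. S (r i) x - S n x))"
          unfolding L2_sq_def using square_integrable_diff[OF Ssq Ssq, of "r i" n]
          by (intro nn_integral_eq_integral) (auto simp: square_integrable_def)
        also have "\<dots> \<le> ennreal (\<tau> n)" by (intro ennreal_leI L2 \<open>n \<le> r i\<close>)
        finally show ?case .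
      qed
    qed
    also have "\<dots> = ennreal (\<tau> n)" by (simp add: Liminf_const)
    finally show ?thesis .
  qed
  have \<tau>0: "0 \<le> \<tau> n" for n
    using order_trans[OF _ L2[of n n]] by (simp add: L2_sq_def)
  have US: "square_integrable (\<lambda>x. U x - S n x)" for n
    unfolding square_integrable_def
  proof
    show "integrable torus_measure (\<lambda>x. (cmod (U x - S n x))\<^sup>2)"
      unfolding integrable_iff_bounded using le_less_trans[OF nn[of n] ennreal_less_top] by simp
  qed measurable
  have UL2: "L2_sq (\<lambda>x. U x - S n x) \<le> \<tau> n" for n
  proof -
    have "ennreal (L2_sq (\<lambda>x. U x - S n x)) \<le> ennreal (\<tau> n)"
      unfolding L2_sq_def using US[of n] nn[of n]
      by (subst nn_integral_eq_integral[symmetric]) (auto simp: square_integrable_def)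
    then show ?thesis using \<tau>0 by (simp add: ennreal_le_iff)
  qed
  have lim: "(\<lambda>n. L2_sq (\<lambda>x. U x - S n x)) \<longlonglongrightarrow> 0"
    by (rule tendsto_sandwich[OF _ _ tendsto_const \<tau>_lim]) (auto simp: L2_sq_def UL2[unfolded L2_sq_def])
  \<comment> \<open>The empty partial sum is zero, so the estimate at index 0 is the square
    integrability of \<open>U\<close> itself.\<close>
  have "S 0 x = 0" for x by (simp add: S_def fpartial_def)
  then have U: "square_integrable U" using US[of 0] by simp
  have "torus_coeff U \<xi> = c \<xi>" for \<xi>
  proof -
    have "(cmod (torus_coeff U \<xi> - c \<xi>))\<^sup>2 \<le> L2_sq (\<lambda>x. U x - S n x)" if "n > to_nat \<xi>" for n
    proof -
      have "c \<xi> = torus_coeff (S n) \<xi>"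
        unfolding S_def fpartial_def[abs_def] using that by (simp add: torus_coeff_trig_poly)
      then have "torus_coeff U \<xi> - c \<xi> = (\<integral>x. (U x - S n x) * character (- \<xi>) x \<partial>torus_measure)"
        using square_integrable_integrable[OF U] square_integrable_integrable[OF Ssq[of n]]
        by (simp add: torus_coeff_def left_diff_distrib integrable_mult_character)
      then show ?thesis
        using square_integrable_mult(2)[OF US[of n] square_integrable_character[of "- \<xi>"]]
        by (simp add: L2_sq_character)
    qed
    then have "(cmod (torus_coeff U \<xi> - c \<xi>))\<^sup>2 \<le> 0"
      by (intro LIMSEQ_le_const[OF lim]) (auto intro!: exI[of _ "Suc (to_nat \<xi>)"])
    then show ?thesis by simp
  qed
  then show ?thesis using that[OF U] lim by (auto simp: S_def)
qed

text \<open>Only this inequality is needed below; the convolution theorem would give equality without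
  the absolute values.\<close>

lemma torus_coeff_mult_le:
  fixes U V :: "real^'n::finite \<Rightarrow> complex"
  assumes U: "square_integrable U" and V: "square_integrable V"
    and Us: "(\<lambda>\<xi>. (cmod (torus_coeff U \<xi>))\<^sup>2) summable_on UNIV"
    and conv: "(\<lambda>\<eta>. cmod (torus_coeff U \<eta>) * cmod (torus_coeff V (\<xi> - \<eta>))) summable_on UNIV"
  shows "cmod (torus_coeff (\<lambda>x. U x * V x) \<xi>)
    \<le> (\<Sum>\<^sub>\<infinity>\<eta>. cmod (torus_coeff U \<eta>) * cmod (torus_coeff V (\<xi> - \<eta>)))" (is "_ \<le> ?R")
proof -
  define c where "c = torus_coeff U"
  obtain W where W: "square_integrable W" "torus_coeff W = c" "(\<lambda>n. L2_sq (\<lambda>x. W x - fpartial n c x)) \<longlonglongrightarrow> 0"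
    using Riesz_Fischer[OF Us] unfolding c_def by blast
  \<comment> \<open>By uniqueness of coefficients \<open>U\<close> may be replaced by the
    Riesz-Fischer function \<open>W\<close>, for which the partial sums are known to converge in the
    square mean.\<close>
  have "coeff_free (\<lambda>x. U x - W x)"
    using W(2) square_integrable_integrable[OF U] square_integrable_integrable[OF W(1)]
    by (auto simp: coeff_free_def torus_coeff_def left_diff_distrib integrable_mult_character c_def fun_eq_iff)
  then have "AE x in torus_measure. U x = W x"
    using coeff_free_AE_zero[of "\<lambda>x. U x - W x"] by simp
  then have "AE x in torus_measure. U x * V x * character (- \<xi>) x = W x * V x * character (- \<xi>) x"
    by eventually_elim simp
  then have eq: "torus_coeff (\<lambda>x. U x * V x) \<xi> = torus_coeff (\<lambda>x. W x * V x) \<xi>"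
    using U V W unfolding torus_coeff_def square_integrable_def by (intro integral_cong_AE) auto
  \<comment> \<open>Multiplying a partial sum by \<open>V\<close> gives a finite convolution sum,
    bounded by \<open>?R\<close>; Cauchy-Schwarz makes these coefficients converge to that of the
    product.\<close>
  define P where "P n = torus_coeff (\<lambda>x. fpartial n c x * V x) \<xi>" for n
  note VV = square_integrable_mult_character[OF V, of "- \<xi>"]
  have fp: "square_integrable (fpartial n c)" for n
    unfolding fpartial_def[abs_def] by (rule square_integrable_trig_poly) simp
  have "(\<lambda>n. (cmod (torus_coeff (\<lambda>x. W x * V x) \<xi> - P n))\<^sup>2) \<longlonglongrightarrow> 0"
  proof (rule tendsto_sandwich[OF _ _ tendsto_const])
    show "(\<lambda>n. L2_sq (\<lambda>x. W x - fpartial n c x) * L2_sq V) \<longlonglongrightarrow> 0"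
      using tendsto_mult_left_zero[OF W(3)] by simp
    have "(cmod (torus_coeff (\<lambda>x. W x * V x) \<xi> - P n))\<^sup>2 \<le> L2_sq (\<lambda>x. W x - fpartial n c x) * L2_sq V" for n
    proof -
      have "torus_coeff (\<lambda>x. W x * V x) \<xi> - P n
          = (\<integral>x. (W x - fpartial n c x) * (V x * character (- \<xi>) x) \<partial>torus_measure)"
        using square_integrable_mult(1)[OF W(1) VV(1)] square_integrable_mult(1)[OF fp[of n] VV(1)]
        by (simp add: P_def torus_coeff_def left_diff_distrib mult.assoc)
      then show ?thesis
        using square_integrable_mult(2)[OF square_integrable_diff[OF W(1) fp[of n]] VV(1)]
        by (simp add: VV(2))
    qed
    then show "\<forall>\<^sub>F n in sequentially. (cmod (torus_coeff (\<lambda>x. W x * V x) \<xi> - P n))\<^sup>2 \<le> L2_sq (\<lambda>x. W x - fpartial n c x) * L2_sq V"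
      by simp
  qed simp
  then have "(\<lambda>n. cmod (torus_coeff (\<lambda>x. W x * V x) \<xi> - P n)) \<longlonglongrightarrow> 0"
    using tendsto_real_sqrt by fastforce
  then have "(\<lambda>n. torus_coeff (\<lambda>x. W x * V x) \<xi> - P n) \<longlonglongrightarrow> 0"
    by (rule tendsto_norm_zero_cancel)
  then have "P \<longlonglongrightarrow> torus_coeff (\<lambda>x. W x * V x) \<xi>"
    using tendsto_diff[OF tendsto_const[of "torus_coeff (\<lambda>x. W x * V x) \<xi>"]] by fastforce
  then have "(\<lambda>n. cmod (P n)) \<longlonglongrightarrow> cmod (torus_coeff (\<lambda>x. W x * V x) \<xi>)"
    by (rule tendsto_norm)
  moreover have "cmod (P n) \<le> ?R" for n
  proof -
    let ?F = "{\<eta> :: int^'n. to_nat \<eta> < n}"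
    have I: "integrable torus_measure (\<lambda>x. c \<eta> * (V x * character (- (\<xi> - \<eta>)) x))" for \<eta>
      by (intro integrable_mult_right integrable_mult_character square_integrable_integrable V)
    have "P n = (\<integral>x. (\<Sum>\<eta>\<in>?F. c \<eta> * (V x * character (- (\<xi> - \<eta>)) x)) \<partial>torus_measure)"
      unfolding P_def torus_coeff_def fpartial_def
    proof (intro Bochner_Integration.integral_cong refl)
      fix x
      have "character (- (\<xi> - \<eta>)) x = character \<eta> x * character (- \<xi>) x" for \<eta>
        by (simp flip: character_add)
      then show "(\<Sum>\<eta>\<in>?F. c \<eta> * character \<eta> x) * V x * character (- \<xi>) x
          = (\<Sum>\<eta>\<in>?F. c \<eta> * (V x * character (- (\<xi> - \<eta>)) x))"
        by (simp add: sum_distrib_right sum_distrib_left ac_simps)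
    qed
    also have "\<dots> = (\<Sum>\<eta>\<in>?F. c \<eta> * torus_coeff V (\<xi> - \<eta>))"
      unfolding torus_coeff_def
      using I by (simp only: Bochner_Integration.integral_sum integral_mult_right_zero)
    finally have "cmod (P n) \<le> (\<Sum>\<eta>\<in>?F. cmod (c \<eta>) * cmod (torus_coeff V (\<xi> - \<eta>)))"
      by (simp add: sum_norm_le norm_mult)
    also have "\<dots> \<le> ?R"
      unfolding c_def by (intro finite_sum_le_infsum conv) auto
    finally show ?thesis .
  qed
  ultimately show ?thesis
    unfolding eq by (intro LIMSEQ_le_const2) auto
qed

section \<open>Densities of square integrable distributions\<close>

lemma L2_density_of_iff:
  "L2_density_of U g \<longleftrightarrow> square_integrable U \<and> pdist_eq g (dist_of_fun U)"
  unfolding L2_density_of_def square_integrable_def integrable_torus_iff set_borel_measurable_def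
  by (simp add: torus_measure_def borel_measurable_restrict_space_iff)

text \<open>Riesz-Fischer provides a witness for the choice in \<open>L2_density\<close>. The chosen
  function need not be that witness, but every density represents \<open>g\<close> and so has the
  coefficients of \<open>g\<close>.\<close>

lemma L2_density_exists:
  fixes g :: "'n::finite pdist"
  assumes g: "g \<in> periodic_distributions"
    and s: "(\<lambda>\<xi>. (cmod (fourier_coeff g \<xi>))\<^sup>2) summable_on UNIV"
  shows "square_integrable (L2_density g)" "torus_coeff (L2_density g) = fourier_coeff g"
proof -
  obtain U where U: "square_integrable U" "torus_coeff U = fourier_coeff g"
    using Riesz_Fischer[OF s] by blast
  have "pdist_eq g (dist_of_fun U)"
    by (intro pdist_eqI g dist_of_fun_periodic_distribution square_integrable_integrable U)
      (simp add: fourier_coeff_dist_of_fun U)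
  then have "L2_density_of U g" using U(1) by (simp add: L2_density_of_iff)
  then have "L2_density_of (L2_density g) g"
    unfolding L2_density_def by (rule someI[of "\<lambda>U. L2_density_of U g"])
  then have d: "square_integrable (L2_density g)" "pdist_eq g (dist_of_fun (L2_density g))"
    by (simp_all add: L2_density_of_iff)
  then show "square_integrable (L2_density g)" by simp
  have "fourier_coeff g = fourier_coeff (dist_of_fun (L2_density g))"
    using d(2) by (auto simp: fun_eq_iff fourier_coeff_eq pdist_eq_def character_Cinf_per)
  then show "torus_coeff (L2_density g) = fourier_coeff g"
    by (simp only: fourier_coeff_dist_of_fun)
qed

subsection \<open>Convolutions of square summable families\<close>

definition square_summable :: "('a \<Rightarrow> real) \<Rightarrow> bool" where
  "square_summable f \<longleftrightarrow> (\<lambda>x. (f x)\<^sup>2) summable_on UNIV"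

lemma square_summable_mono:
  assumes "square_summable g" and "\<And>x. \<bar>f x\<bar> \<le> g x"
  shows "square_summable f"
  unfolding square_summable_def
proof (rule summable_on_comparison_test)
  show "(\<lambda>x. (g x)\<^sup>2) summable_on UNIV" using assms(1) by (simp add: square_summable_def)
  show "(f x)\<^sup>2 \<le> (g x)\<^sup>2" for x
    using power_mono[OF assms(2)[of x], of 2] by simp
qed simp

lemma square_summable_cmult: "square_summable f \<Longrightarrow> square_summable (\<lambda>x. c * f x)"
  by (simp add: square_summable_def power_mult_distrib summable_on_cmult_right)

lemma square_summable_add:
  assumes "square_summable f" "square_summable g"
  shows "square_summable (\<lambda>x. f x + g x)"
  unfolding square_summable_def
proof (rule summable_on_comparison_test)
  show "(\<lambda>x. 2 * (f x)\<^sup>2 + 2 * (g x)\<^sup>2) summable_on UNIV"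
    using assms unfolding square_summable_def by (intro summable_on_add summable_on_cmult_right)
  show "(f x + g x)\<^sup>2 \<le> 2 * (f x)\<^sup>2 + 2 * (g x)\<^sup>2" for x
    using sum_squares_bound[of "f x" "g x"] by (simp add: power2_sum)
qed simp

lemma square_summable_sum:
  "(\<And>i. i \<in> I \<Longrightarrow> square_summable (f i)) \<Longrightarrow> square_summable (\<lambda>x. \<Sum>i\<in>I. f i x)"
proof (induction I rule: infinite_finite_induct)
  case (insert i I)
  then show ?case by (simp add: square_summable_add)
qed (auto simp: square_summable_def)

lemma square_summable_bounded:
  assumes "square_summable f" shows "\<bar>f x\<bar> \<le> sqrt (\<Sum>\<^sub>\<infinity>x. (f x)\<^sup>2)"
proof -
  have "(f x)\<^sup>2 \<le> (\<Sum>\<^sub>\<infinity>x. (f x)\<^sup>2)"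
    using finite_sum_le_infsum[of "\<lambda>x. (f x)\<^sup>2" UNIV "{x}"] assms by (simp add: square_summable_def)
  then show ?thesis by (simp add: real_le_rsqrt)
qed

lemma square_summable_shift:
  fixes f :: "'a::ab_group_add \<Rightarrow> real"
  shows "square_summable f \<Longrightarrow> square_summable (\<lambda>\<eta>. f (\<xi> - \<eta>))"
    and "(\<Sum>\<^sub>\<infinity>\<eta>. (f (\<xi> - \<eta>))\<^sup>2) = (\<Sum>\<^sub>\<infinity>\<eta>. (f \<eta>)\<^sup>2)"
proof -
  have bij: "bij_betw (\<lambda>\<eta>. \<xi> - \<eta>) (UNIV :: 'a set) UNIV"
    by (rule bij_betw_byWitness[where f'="\<lambda>\<eta>. \<xi> - \<eta>"]) auto
  show "square_summable f \<Longrightarrow> square_summable (\<lambda>\<eta>. f (\<xi> - \<eta>))"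
    using summable_on_reindex_bij_betw[OF bij, of "\<lambda>\<eta>. (f \<eta>)\<^sup>2"] by (simp add: square_summable_def)
  show "(\<Sum>\<^sub>\<infinity>\<eta>. (f (\<xi> - \<eta>))\<^sup>2) = (\<Sum>\<^sub>\<infinity>\<eta>. (f \<eta>)\<^sup>2)"
    by (rule infsum_reindex_bij_betw[OF bij])
qed

lemma Cauchy_Schwarz_infsum:
  fixes f g :: "'a \<Rightarrow> real"
  assumes f: "square_summable f" and g: "square_summable g"
    and nn: "\<And>x. 0 \<le> f x" "\<And>x. 0 \<le> g x"
  shows "(\<lambda>x. f x * g x) summable_on UNIV"
    and "(\<Sum>\<^sub>\<infinity>x. f x * g x) \<le> sqrt ((\<Sum>\<^sub>\<infinity>x. (f x)\<^sup>2) * (\<Sum>\<^sub>\<infinity>x. (g x)\<^sup>2))" (is "_ \<le> ?R")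
proof -
  have le: "(\<Sum>x\<in>F. f x * g x) \<le> ?R" if "finite F" for F
  proof (rule real_le_rsqrt)
    have "(\<Sum>x\<in>F. f x * g x)\<^sup>2 \<le> (\<Sum>x\<in>F. (f x)\<^sup>2) * (\<Sum>x\<in>F. (g x)\<^sup>2)"
      by (rule Cauchy_Schwarz_ineq_sum)
    also have "\<dots> \<le> (\<Sum>\<^sub>\<infinity>x. (f x)\<^sup>2) * (\<Sum>\<^sub>\<infinity>x. (g x)\<^sup>2)"
      using that f g unfolding square_summable_def
      by (intro mult_mono finite_sum_le_infsum infsum_nonneg sum_nonneg) auto
    finally show "(\<Sum>x\<in>F. f x * g x)\<^sup>2 \<le> (\<Sum>\<^sub>\<infinity>x. (f x)\<^sup>2) * (\<Sum>\<^sub>\<infinity>x. (g x)\<^sup>2)" .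
  qed
  show s: "(\<lambda>x. f x * g x) summable_on UNIV"
    by (rule nonneg_bdd_above_summable_on) (use nn le in \<open>auto intro!: bdd_aboveI2\<close>)
  show "(\<Sum>\<^sub>\<infinity>x. f x * g x) \<le> ?R"
    by (rule infsum_le_finite_sums[OF s]) (use le in auto)
qed

text \<open>Young's inequality for l1 with l2. Writing the summand as \<open>sqrt \<alpha>\<close>
  times \<open>sqrt \<alpha> \<beta>\<close>, Cauchy-Schwarz bounds the squared convolution by the
  sum of \<open>\<alpha>\<close> times the convolution of \<open>\<alpha>\<close> with the square of
  \<open>\<beta>\<close>, and the latter is summable by exchanging the two sums.\<close>

lemma Young_square_summable:
  fixes \<alpha> \<beta> :: "'a::ab_group_add \<Rightarrow> real"
  assumes \<alpha>: "\<alpha> summable_on UNIV" and \<beta>: "square_summable \<beta>"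
    and nn: "\<And>x. 0 \<le> \<alpha> x" "\<And>x. 0 \<le> \<beta> x"
  shows "(\<lambda>\<eta>. \<alpha> \<eta> * \<beta> (\<xi> - \<eta>)) summable_on UNIV"
    and "square_summable (\<lambda>\<xi>. \<Sum>\<^sub>\<infinity>\<eta>. \<alpha> \<eta> * \<beta> (\<xi> - \<eta>))"
proof -
  define K where "K = sqrt (\<Sum>\<^sub>\<infinity>\<eta>. (\<beta> \<eta>)\<^sup>2)"
  have K: "\<beta> \<eta> \<le> K" "0 \<le> K" for \<eta>
    using square_summable_bounded[OF \<beta>, of \<eta>] nn by (auto simp: K_def intro!: infsum_nonneg)
  \<comment> \<open>Square summable families are bounded. The exponent 1 gives the convolution
    itself, the exponent 2 the factor needed for Cauchy-Schwarz.\<close>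
  have sq: "(\<lambda>\<eta>. \<alpha> \<eta> * (\<beta> (\<xi> - \<eta>)) ^ m) summable_on UNIV" for \<xi> m
  proof (rule summable_on_comparison_test)
    show "(\<lambda>\<eta>. K ^ m * \<alpha> \<eta>) summable_on UNIV" by (intro summable_on_cmult_right \<alpha>)
    show "\<alpha> \<eta> * \<beta> (\<xi> - \<eta>) ^ m \<le> K ^ m * \<alpha> \<eta>" for \<eta>
      unfolding mult.commute[of "K ^ m"] by (intro mult_left_mono power_mono K nn)
  qed (use nn in auto)
  show "(\<lambda>\<eta>. \<alpha> \<eta> * \<beta> (\<xi> - \<eta>)) summable_on UNIV" using sq[of \<xi> 1] by simp
  define C where "C = infsum \<alpha> UNIV"
  have "(\<lambda>(\<eta>, \<xi>). \<alpha> \<eta> * (\<beta> (\<xi> - \<eta>))\<^sup>2) summable_on UNIV \<times> UNIV"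
  proof (rule summable_on_SigmaI)
    show "((\<lambda>\<xi>. case (\<eta>, \<xi>) of (\<eta>, \<xi>) \<Rightarrow> \<alpha> \<eta> * (\<beta> (\<xi> - \<eta>))\<^sup>2) has_sum (\<alpha> \<eta> * (\<Sum>\<^sub>\<infinity>\<xi>. (\<beta> \<xi>)\<^sup>2))) UNIV" for \<eta>
    proof -
      have "bij_betw (\<lambda>\<xi>. \<xi> - \<eta>) (UNIV :: 'a set) UNIV"
        by (rule bij_betw_byWitness[where f'="\<lambda>\<xi>. \<xi> + \<eta>"]) auto
      then have "((\<lambda>\<xi>. (\<beta> (\<xi> - \<eta>))\<^sup>2) has_sum (\<Sum>\<^sub>\<infinity>\<xi>. (\<beta> \<xi>)\<^sup>2)) UNIV"
        using \<beta> has_sum_reindex_bij_betw[of "\<lambda>\<xi>. \<xi> - \<eta>" UNIV UNIV "\<lambda>\<xi>. (\<beta> \<xi>)\<^sup>2"]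
        by (simp add: square_summable_def)
      then show ?thesis by (simp add: has_sum_cmult_right)
    qed
    show "(\<lambda>\<eta>. \<alpha> \<eta> * (\<Sum>\<^sub>\<infinity>\<xi>. (\<beta> \<xi>)\<^sup>2)) summable_on UNIV" by (intro summable_on_cmult_left \<alpha>)
  qed (use nn in auto)
  then have "(\<lambda>(\<xi>, \<eta>). \<alpha> \<eta> * (\<beta> (\<xi> - \<eta>))\<^sup>2) summable_on UNIV \<times> UNIV"
    by (subst (asm) summable_on_swap) simp
  then have s2: "(\<lambda>\<xi>. \<Sum>\<^sub>\<infinity>\<eta>. \<alpha> \<eta> * (\<beta> (\<xi> - \<eta>))\<^sup>2) summable_on UNIV"
    by (rule summable_on_Sigma_banach)
  show "square_summable (\<lambda>\<xi>. \<Sum>\<^sub>\<infinity>\<eta>. \<alpha> \<eta> * \<beta> (\<xi> - \<eta>))"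
    unfolding square_summable_def
  proof (rule summable_on_comparison_test)
    show "(\<lambda>\<xi>. C * (\<Sum>\<^sub>\<infinity>\<eta>. \<alpha> \<eta> * (\<beta> (\<xi> - \<eta>))\<^sup>2)) summable_on UNIV"
      by (intro summable_on_cmult_right s2)
    fix \<xi>
    define f g where "f \<eta> = sqrt (\<alpha> \<eta>)" and "g \<eta> = sqrt (\<alpha> \<eta>) * \<beta> (\<xi> - \<eta>)" for \<eta>
    have ff: "(f \<eta>)\<^sup>2 = \<alpha> \<eta>" and gg: "(g \<eta>)\<^sup>2 = \<alpha> \<eta> * (\<beta> (\<xi> - \<eta>))\<^sup>2" for \<eta>
      using nn by (auto simp: f_def g_def power_mult_distrib)
    have fg: "f \<eta> * g \<eta> = \<alpha> \<eta> * \<beta> (\<xi> - \<eta>)" for \<eta> using nn by (simp add: f_def g_def flip: mult.assoc)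
    have "square_summable f" "square_summable g"
      using \<alpha> sq[of \<xi> 2] by (simp_all add: square_summable_def ff gg)
    moreover have "0 \<le> f \<eta>" "0 \<le> g \<eta>" for \<eta> using nn by (simp_all add: f_def g_def)
    ultimately have "(\<Sum>\<^sub>\<infinity>\<eta>. \<alpha> \<eta> * \<beta> (\<xi> - \<eta>)) \<le> sqrt (C * (\<Sum>\<^sub>\<infinity>\<eta>. \<alpha> \<eta> * (\<beta> (\<xi> - \<eta>))\<^sup>2))"
      using Cauchy_Schwarz_infsum(2)[of f g] by (simp add: ff gg fg C_def)
    then have "(\<Sum>\<^sub>\<infinity>\<eta>. \<alpha> \<eta> * \<beta> (\<xi> - \<eta>))\<^sup>2 \<le> (sqrt (C * (\<Sum>\<^sub>\<infinity>\<eta>. \<alpha> \<eta> * (\<beta> (\<xi> - \<eta>))\<^sup>2)))\<^sup>2"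
      using nn by (intro power_mono infsum_nonneg) auto
    also have "\<dots> = C * (\<Sum>\<^sub>\<infinity>\<eta>. \<alpha> \<eta> * (\<beta> (\<xi> - \<eta>))\<^sup>2)"
      using nn by (intro real_sqrt_pow2 mult_nonneg_nonneg infsum_nonneg) (auto simp: C_def intro!: infsum_nonneg)
    finally show "(\<Sum>\<^sub>\<infinity>\<eta>. \<alpha> \<eta> * \<beta> (\<xi> - \<eta>))\<^sup>2 \<le> C * (\<Sum>\<^sub>\<infinity>\<eta>. \<alpha> \<eta> * (\<beta> (\<xi> - \<eta>))\<^sup>2)" .
  qed simp
qed

subsection \<open>The product estimate in Sobolev spaces\<close>

text \<open>For \<open>t \<ge> 0\<close>, the larger of \<open>y\<close> and \<open>z\<close> is at
  least \<open>x / 2\<close>, so it absorbs \<open>x powr t\<close> at the price of the power of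
  two; its remaining exponent \<open>t - s\<close> is not positive, so the smaller one may take its
  place. For negative \<open>t\<close> all three exponents are nonpositive and each base may be
  lowered to the minimum.\<close>

lemma product_weight_le:
  fixes x y z s t :: real
  assumes ge1: "1 \<le> x" "1 \<le> y" "1 \<le> z" and xyz: "x \<le> y + z" and s: "0 \<le> s" and t: "t \<le> s"
  shows "x powr t * (y powr (- s) * z powr (- s))
    \<le> 2 powr \<bar>t\<bar> * (x powr (t - 2 * s) + y powr (t - 2 * s) + z powr (t - 2 * s))" (is "_ \<le> ?K * ?S")
proof (cases "t \<ge> 0")
  case True
  have *: "x powr t * (M powr (- s) * m powr (- s)) \<le> ?K * m powr (t - 2 * s)"
    if "1 \<le> m" "m \<le> M" "x \<le> 2 * M" for m M
  proof -
    have "x powr t \<le> (2 * M) powr t" using True that ge1 by (intro powr_mono2) auto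
    then have "x powr t * (M powr (- s) * m powr (- s)) \<le> (2 * M) powr t * (M powr (- s) * m powr (- s))"
      by (intro mult_right_mono) auto
    also have "\<dots> = ?K * (M powr (t - s) * m powr (- s))"
    proof -
      have "M powr (t - s) = M powr t * M powr (- s)" by (simp flip: powr_add)
      then show ?thesis using that True by (simp add: powr_mult)
    qed
    also have "\<dots> \<le> ?K * (m powr (t - s) * m powr (- s))"
      using that t by (intro mult_left_mono mult_right_mono powr_mono2') auto
    also have "\<dots> = ?K * m powr (t - 2 * s)"
      using that by (simp flip: powr_add)
    finally show ?thesis .
  qed
  show ?thesis
  proof (cases "y \<le> z")
    case True
    have "x powr t * (y powr (- s) * z powr (- s)) \<le> ?K * y powr (t - 2 * s)"
      using *[of y z] True ge1 xyz by (simp add: mult.commute)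
    also have "\<dots> \<le> ?K * ?S" by (intro mult_left_mono) auto
    finally show ?thesis .
  next
    case False
    have "x powr t * (y powr (- s) * z powr (- s)) \<le> ?K * z powr (t - 2 * s)"
      using *[of z y] False ge1 xyz by simp
    also have "\<dots> \<le> ?K * ?S" by (intro mult_left_mono) auto
    finally show ?thesis .
  qed
next
  case False
  define m where "m = min x (min y z)"
  have m: "1 \<le> m" "m \<le> x" "m \<le> y" "m \<le> z" using ge1 by (auto simp: m_def)
  have "x powr t * (y powr (- s) * z powr (- s)) \<le> m powr t * (m powr (- s) * m powr (- s))"
    using m s False by (intro mult_mono powr_mono2') auto
  also have "\<dots> = m powr (t - 2 * s)" using m by (simp flip: powr_add)
  also have "\<dots> \<le> ?S" by (auto simp: m_def min_def)
  also have "\<dots> \<le> ?K * ?S"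
    using mult_right_mono[of 1 ?K ?S] ge_one_powr_ge_zero[of 2 "\<bar>t\<bar>"] by simp
  finally show ?thesis .
qed

text \<open>The three summands of \<open>product_weight_le\<close> give three pieces. Where the
  weight sits on \<open>\<xi>\<close>, the plain convolution is bounded by Cauchy-Schwarz and
  multiplies the square summable \<open>w\<close>. Where it sits on one factor, that factor times
  \<open>w\<close> becomes summable, and Young's inequality pairs it with the other. The condition
  on the dimension is exactly square summability of \<open>w\<close> by the lattice
  criterion.\<close>

lemma convolution_estimate:
  fixes A B :: "int^'n::finite \<Rightarrow> real"
  assumes A: "square_summable (\<lambda>\<xi>. \<rho> \<xi> powr s * A \<xi>)"
    and B: "square_summable (\<lambda>\<xi>. \<rho> \<xi> powr s * B \<xi>)"
    and nn: "\<And>\<xi>. 0 \<le> A \<xi>" "\<And>\<xi>. 0 \<le> B \<xi>"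
    and s: "0 \<le> s" and t: "t \<le> s" and \<kappa>: "real CARD('n) < 2 * (2 * s - t)"
  shows "(\<lambda>\<eta>. A \<eta> * B (\<xi> - \<eta>)) summable_on UNIV"
    and "square_summable (\<lambda>\<xi>. \<rho> \<xi> powr t * (\<Sum>\<^sub>\<infinity>\<eta>. A \<eta> * B (\<xi> - \<eta>)))"
proof -
  define a where "a \<xi> = \<rho> \<xi> powr s * A \<xi>" for \<xi>
  define b where "b \<xi> = \<rho> \<xi> powr s * B \<xi>" for \<xi>
  define w where "w \<xi> = \<rho> \<xi> powr (t - 2 * s)" for \<xi> :: "int^'n"
  define K where "K = 2 powr \<bar>t\<bar>"
  have a: "square_summable a" and b: "square_summable b"
    using A B by (simp_all add: a_def[abs_def] b_def[abs_def])
  have a0: "0 \<le> a \<xi>" and b0: "0 \<le> b \<xi>" and w0: "0 \<le> w \<xi>" for \<xi>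
    using nn by (simp_all add: a_def b_def w_def)
  have Aa: "A \<xi> = \<rho> \<xi> powr (- s) * a \<xi>" and Bb: "B \<xi> = \<rho> \<xi> powr (- s) * b \<xi>" for \<xi>
    by (simp_all add: a_def b_def powr_minus)
  have ge1: "1 \<le> \<rho> \<xi> powr s" for \<xi> :: "int^'n"
    using s by (intro ge_one_powr_ge_zero bessel_weight_ge_1)
  have "square_summable A"
    by (rule square_summable_mono[OF a]) (use mult_right_mono[OF ge1 nn(1)] nn in \<open>simp add: a_def\<close>)
  moreover have "square_summable B"
    by (rule square_summable_mono[OF b]) (use mult_right_mono[OF ge1 nn(2)] nn in \<open>simp add: b_def\<close>)
  ultimately show AB: "(\<lambda>\<eta>. A \<eta> * B (\<xi> - \<eta>)) summable_on UNIV" for \<xi>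
    using nn by (intro Cauchy_Schwarz_infsum square_summable_shift)
  have w: "square_summable w"
    using summable_on_bessel_weight[OF \<kappa>]
    by (simp add: square_summable_def w_def powr_powr algebra_simps flip: powr_numeral)
  have wa: "(\<lambda>\<xi>. w \<xi> * a \<xi>) summable_on UNIV" and wb: "(\<lambda>\<xi>. w \<xi> * b \<xi>) summable_on UNIV"
    by (intro Cauchy_Schwarz_infsum w a b w0 a0 b0)+
  define T1 where "T1 \<xi> = (\<Sum>\<^sub>\<infinity>\<eta>. a \<eta> * b (\<xi> - \<eta>))" for \<xi>
  define T2 where "T2 \<xi> = (\<Sum>\<^sub>\<infinity>\<eta>. w \<eta> * a \<eta> * b (\<xi> - \<eta>))" for \<xi>
  define T3 where "T3 \<xi> = (\<Sum>\<^sub>\<infinity>\<eta>. w \<eta> * b \<eta> * a (\<xi> - \<eta>))" for \<xi>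
  have ab: "(\<lambda>\<eta>. a \<eta> * b (\<xi> - \<eta>)) summable_on UNIV" for \<xi>
    by (intro Cauchy_Schwarz_infsum square_summable_shift a b a0 b0)
  have s2: "(\<lambda>\<eta>. w \<eta> * a \<eta> * b (\<xi> - \<eta>)) summable_on UNIV" for \<xi>
    using Young_square_summable(1)[OF wa b] w0 a0 b0 by simp
  have bij: "bij_betw (\<lambda>\<eta>. \<xi> - \<eta>) UNIV (UNIV :: (int^'n) set)" for \<xi>
    by (rule bij_betw_byWitness[where f'="\<lambda>\<eta>. \<xi> - \<eta>"]) auto
  have s3': "(\<lambda>\<eta>. w \<eta> * b \<eta> * a (\<xi> - \<eta>)) summable_on UNIV" for \<xi>
    using Young_square_summable(1)[OF wb a] w0 a0 b0 by simp
  \<comment> \<open>The reflection of \<open>\<eta>\<close> to \<open>\<xi> - \<eta>\<close>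
    exchanges the two factors, bringing the third piece into the form of Young's inequality.\<close>
  have s3: "(\<lambda>\<eta>. w (\<xi> - \<eta>) * b (\<xi> - \<eta>) * a \<eta>) summable_on UNIV" for \<xi>
    using s3'[of \<xi>] summable_on_reindex_bij_betw[OF bij[of \<xi>], of "\<lambda>\<eta>. w \<eta> * b \<eta> * a (\<xi> - \<eta>)"] by simp
  have T3: "T3 \<xi> = (\<Sum>\<^sub>\<infinity>\<eta>. w (\<xi> - \<eta>) * b (\<xi> - \<eta>) * a \<eta>)" for \<xi>
    using infsum_reindex_bij_betw[OF bij[of \<xi>], of "\<lambda>\<eta>. w \<eta> * b \<eta> * a (\<xi> - \<eta>)"] by (simp add: T3_def)
  define D where "D = sqrt ((\<Sum>\<^sub>\<infinity>\<eta>. (a \<eta>)\<^sup>2) * (\<Sum>\<^sub>\<infinity>\<eta>. (b \<eta>)\<^sup>2))"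
  have T1: "T1 \<xi> \<le> D" for \<xi>
    using Cauchy_Schwarz_infsum(2)[OF a square_summable_shift(1)[OF b, of \<xi>] a0 b0]
    by (simp add: T1_def D_def square_summable_shift(2))
  have le: "\<rho> \<xi> powr t * (\<Sum>\<^sub>\<infinity>\<eta>. A \<eta> * B (\<xi> - \<eta>)) \<le> K * (D * w \<xi> + T2 \<xi> + T3 \<xi>)" for \<xi>
  proof -
    have "\<rho> \<xi> powr t * (\<Sum>\<^sub>\<infinity>\<eta>. A \<eta> * B (\<xi> - \<eta>)) = (\<Sum>\<^sub>\<infinity>\<eta>. \<rho> \<xi> powr t * (A \<eta> * B (\<xi> - \<eta>)))"
      by (rule infsum_cmult_right'[symmetric])
    also have "\<dots> \<le> (\<Sum>\<^sub>\<infinity>\<eta>. K * (w \<xi> * (a \<eta> * b (\<xi> - \<eta>)) + w \<eta> * a \<eta> * b (\<xi> - \<eta>) + w (\<xi> - \<eta>) * b (\<xi> - \<eta>) * a \<eta>))"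
    proof (rule infsum_mono)
      show "(\<lambda>\<eta>. \<rho> \<xi> powr t * (A \<eta> * B (\<xi> - \<eta>))) summable_on UNIV"
        by (intro summable_on_cmult_right AB)
      show "(\<lambda>\<eta>. K * (w \<xi> * (a \<eta> * b (\<xi> - \<eta>)) + w \<eta> * a \<eta> * b (\<xi> - \<eta>) + w (\<xi> - \<eta>) * b (\<xi> - \<eta>) * a \<eta>)) summable_on UNIV"
        by (intro summable_on_cmult_right summable_on_add ab s2 s3)
      fix \<eta>
      have tri: "\<rho> \<xi> \<le> \<rho> \<eta> + \<rho> (\<xi> - \<eta>)"
        using bessel_weight_sum_le[of \<eta> "\<xi> - \<eta>"] by simp
      have "\<rho> \<xi> powr t * (A \<eta> * B (\<xi> - \<eta>))
        = \<rho> \<xi> powr t * (\<rho> \<eta> powr (- s) * \<rho> (\<xi> - \<eta>) powr (- s)) * (a \<eta> * b (\<xi> - \<eta>))"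
        unfolding Aa Bb by (simp add: ac_simps)
      also have "\<dots> \<le> K * (w \<xi> + w \<eta> + w (\<xi> - \<eta>)) * (a \<eta> * b (\<xi> - \<eta>))"
        unfolding K_def w_def using a0 b0
        by (intro mult_right_mono product_weight_le bessel_weight_ge_1 tri s t mult_nonneg_nonneg)
      finally show "\<rho> \<xi> powr t * (A \<eta> * B (\<xi> - \<eta>))
        \<le> K * (w \<xi> * (a \<eta> * b (\<xi> - \<eta>)) + w \<eta> * a \<eta> * b (\<xi> - \<eta>) + w (\<xi> - \<eta>) * b (\<xi> - \<eta>) * a \<eta>)"
        by (simp add: algebra_simps)
    qed
    also have "\<dots> = K * (w \<xi> * T1 \<xi> + T2 \<xi> + T3 \<xi>)"
      unfolding T1_def T2_def T3
      by (simp add: infsum_cmult_right' infsum_add summable_on_add summable_on_cmult_right ab s2 s3)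
    also have "\<dots> \<le> K * (D * w \<xi> + T2 \<xi> + T3 \<xi>)"
      using mult_right_mono[OF T1 w0, of \<xi> \<xi>]
      by (intro mult_left_mono) (auto simp: K_def mult.commute)
    finally show ?thesis .
  qed
  have "square_summable (\<lambda>\<xi>. K * (D * w \<xi> + T2 \<xi> + T3 \<xi>))"
    unfolding T2_def T3_def using w0 a0 b0
    by (intro square_summable_cmult square_summable_add w Young_square_summable(2) wa wb a b) auto
  then show "square_summable (\<lambda>\<xi>. \<rho> \<xi> powr t * (\<Sum>\<^sub>\<infinity>\<eta>. A \<eta> * B (\<xi> - \<eta>)))"
  proof (rule square_summable_mono)
    fix \<xi>
    have "0 \<le> (\<Sum>\<^sub>\<infinity>\<eta>. A \<eta> * B (\<xi> - \<eta>))" using nn by (intro infsum_nonneg) auto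
    then show "\<bar>\<rho> \<xi> powr t * (\<Sum>\<^sub>\<infinity>\<eta>. A \<eta> * B (\<xi> - \<eta>))\<bar> \<le> K * (D * w \<xi> + T2 \<xi> + T3 \<xi>)"
      using le[of \<xi>] by simp
  qed
qed

lemma square_summable_weight_mono:
  fixes A :: "int^'n::finite \<Rightarrow> real"
  assumes "square_summable (\<lambda>\<xi>. \<rho> \<xi> powr s * A \<xi>)" "t \<le> s" "\<And>\<xi>. 0 \<le> A \<xi>"
  shows "square_summable (\<lambda>\<xi>. \<rho> \<xi> powr t * A \<xi>)"
  by (rule square_summable_mono[OF assms(1)])
    (use assms in \<open>auto simp: abs_mult intro!: mult_right_mono powr_mono bessel_weight_ge_1\<close>)

subsection \<open>The bootstrap\<close>

text \<open>The order \<open>r\<close> is 2 for the velocity and 1 for the pressure. The extra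
  weight in front of \<open>M\<close> is the divergence applied to the product, hence the demand of
  one more derivative on \<open>M\<close> than on \<open>F\<close>.\<close>

lemma elliptic_gain:
  fixes U :: "int^'n::finite \<Rightarrow> real"
  assumes E: "\<And>\<xi>. \<rho> \<xi> powr r * U \<xi> \<le> K * ((\<Sum>k\<in>UNIV. F k \<xi>) + \<rho> \<xi> * (\<Sum>k\<in>UNIV. \<Sum>j\<in>UNIV. M j k \<xi>))"
    and nn: "\<And>\<xi>. 0 \<le> U \<xi>"
    and F: "\<And>k :: 'n. square_summable (\<lambda>\<xi>. \<rho> \<xi> powr q * F k \<xi>)"
    and M: "\<And>j k :: 'n. square_summable (\<lambda>\<xi>. \<rho> \<xi> powr (q + 1) * M j k \<xi>)"
  shows "square_summable (\<lambda>\<xi>. \<rho> \<xi> powr (q + r) * U \<xi>)"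
proof (rule square_summable_mono)
  show "square_summable (\<lambda>\<xi>. K * ((\<Sum>k\<in>UNIV. \<rho> \<xi> powr q * F k \<xi>)
      + (\<Sum>k\<in>UNIV. \<Sum>j\<in>UNIV. \<rho> \<xi> powr (q + 1) * M j k \<xi>)))"
    by (intro square_summable_cmult square_summable_add square_summable_sum F M)
  fix \<xi>
  have "\<bar>\<rho> \<xi> powr (q + r) * U \<xi>\<bar> = \<rho> \<xi> powr q * (\<rho> \<xi> powr r * U \<xi>)"
    using nn by (simp add: abs_mult powr_add mult.assoc)
  also have "\<dots> \<le> \<rho> \<xi> powr q * (K * ((\<Sum>k\<in>UNIV. F k \<xi>) + \<rho> \<xi> * (\<Sum>k\<in>UNIV. \<Sum>j\<in>UNIV. M j k \<xi>)))"
    by (intro mult_left_mono E) simp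
  also have "\<dots> = K * ((\<Sum>k\<in>UNIV. \<rho> \<xi> powr q * F k \<xi>)
      + (\<Sum>k\<in>UNIV. \<Sum>j\<in>UNIV. \<rho> \<xi> powr (q + 1) * M j k \<xi>))"
  proof -
    have "(\<Sum>k\<in>UNIV. \<rho> \<xi> powr q * F k \<xi>) = \<rho> \<xi> powr q * (\<Sum>k\<in>UNIV. F k \<xi>)"
      by (simp add: sum_distrib_left)
    moreover have "(\<Sum>k\<in>UNIV. \<Sum>j\<in>UNIV. \<rho> \<xi> powr (q + 1) * M j k \<xi>)
        = \<rho> \<xi> powr q * (\<rho> \<xi> * (\<Sum>k\<in>UNIV. \<Sum>j\<in>UNIV. M j k \<xi>))"
      by (simp add: sum_distrib_left powr_add mult.assoc)
    ultimately show ?thesis by (simp add: algebra_simps)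
  qed
  finally show "\<bar>\<rho> \<xi> powr (q + r) * U \<xi>\<bar> \<le> K * ((\<Sum>k\<in>UNIV. \<rho> \<xi> powr q * F k \<xi>)
      + (\<Sum>k\<in>UNIV. \<Sum>j\<in>UNIV. \<rho> \<xi> powr (q + 1) * M j k \<xi>))" .
qed

text \<open>The regularity argument reduced to nonnegative families. The bound on \<open>M\<close>
  is demanded only where the convolution converges, as a divergent \<open>infsum\<close> would be 0;
  \<open>convolution_estimate\<close> supplies the convergence. The conclusion on \<open>M\<close>
  is kept for the pressure.\<close>

lemma bootstrap:
  fixes U F :: "'n::finite \<Rightarrow> int^'n \<Rightarrow> real" and M :: "'n \<Rightarrow> 'n \<Rightarrow> int^'n \<Rightarrow> real"
  assumes s1: "- 1 + real CARD('n) / 2 < s1" "0 \<le> s1" and s2: "s1 < s2"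
    and nn: "\<And>i \<xi>. 0 \<le> U i \<xi>" "\<And>i \<xi>. 0 \<le> F i \<xi>" "\<And>j k \<xi>. 0 \<le> M j k \<xi>"
    and E: "\<And>i \<xi>. \<rho> \<xi> powr 2 * U i \<xi>
      \<le> K * ((\<Sum>k\<in>UNIV. F k \<xi>) + \<rho> \<xi> * (\<Sum>k\<in>UNIV. \<Sum>j\<in>UNIV. M j k \<xi>))"
    and ME: "\<And>j k \<xi>. (\<lambda>\<eta>. U j \<eta> * U k (\<xi> - \<eta>)) summable_on UNIV \<Longrightarrow> M j k \<xi> \<le> (\<Sum>\<^sub>\<infinity>\<eta>. U j \<eta> * U k (\<xi> - \<eta>))"
    and U: "\<And>i. square_summable (\<lambda>\<xi>. \<rho> \<xi> powr s1 * U i \<xi>)"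
    and F: "\<And>k. square_summable (\<lambda>\<xi>. \<rho> \<xi> powr (s2 - 2) * F k \<xi>)"
  shows "square_summable (\<lambda>\<xi>. \<rho> \<xi> powr s2 * U i \<xi>)"
    and "square_summable (\<lambda>\<xi>. \<rho> \<xi> powr (s2 - 1) * M j k \<xi>)"
proof -
  \<comment> \<open>Half of the room above the critical exponent keeps the inequality on the
    dimension strict for every \<open>s \<ge> s1\<close>; the cap at 1 ensures
    \<open>s - 1 + \<delta> \<le> s\<close>.\<close>
  define \<delta> where "\<delta> = min 1 ((s1 - real CARD('n) / 2 + 1) / 2)"
  have \<delta>: "0 < \<delta>" "\<delta> \<le> 1" "\<delta> \<le> (s1 - real CARD('n) / 2 + 1) / 2"
    unfolding \<delta>_def by (use s1 in simp, rule min.cobounded1, rule min.cobounded2)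
  have M: "square_summable (\<lambda>\<xi>. \<rho> \<xi> powr (s - 1 + \<delta>) * M j k \<xi>)"
    if s: "s1 \<le> s" and Us: "\<And>i. square_summable (\<lambda>\<xi>. \<rho> \<xi> powr s * U i \<xi>)" for s j k
  proof -
    have "real CARD('n) < 2 * (2 * s - (s - 1 + \<delta>))" using \<delta> s s1 by simp
    note conv = convolution_estimate[OF Us[of j] Us[of k] nn(1) nn(1) _ _ this]
    have st: "0 \<le> s" "s - 1 + \<delta> \<le> s" using \<delta> s s1 by auto
    show ?thesis
      by (rule square_summable_mono[OF conv(2)[OF st]])
        (use nn in \<open>auto simp: abs_mult intro!: mult_left_mono ME conv(1)[OF st]\<close>)
  qed
  \<comment> \<open>The exponent is capped at \<open>s2\<close> because the data \<open>F\<close>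
    allow no more; the cap is reached after finitely many steps of length
    \<open>\<delta>\<close>.\<close>
  have step: "square_summable (\<lambda>\<xi>. \<rho> \<xi> powr min (s1 + real m * \<delta>) s2 * U i \<xi>)" for m i
  proof (induction m arbitrary: i)
    case 0
    then show ?case using U s2 by simp
  next
    case (Suc m)
    define s where "s = min (s1 + real m * \<delta>) s2"
    define \<sigma> where "\<sigma> = min (s1 + real (Suc m) * \<delta>) s2"
    have s: "s1 \<le> s" using \<delta> s2 by (auto simp: s_def)
    have \<sigma>: "\<sigma> \<le> s + \<delta>" "\<sigma> \<le> s2" using \<delta> by (auto simp: s_def \<sigma>_def algebra_simps)
    have "square_summable (\<lambda>\<xi>. \<rho> \<xi> powr (\<sigma> - 2 + 1) * M j k \<xi>)" for j k
      by (rule square_summable_weight_mono[OF M[OF s Suc[folded s_def]]]) (use \<sigma> nn in auto)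
    moreover have "square_summable (\<lambda>\<xi>. \<rho> \<xi> powr (\<sigma> - 2) * F k \<xi>)" for k
      by (rule square_summable_weight_mono[OF F]) (use \<sigma> nn in auto)
    ultimately have "square_summable (\<lambda>\<xi>. \<rho> \<xi> powr (\<sigma> - 2 + 2) * U i \<xi>)"
      by (intro elliptic_gain[OF E nn(1)])
    then show ?case by (simp add: \<sigma>_def)
  qed
  obtain m :: nat where "(s2 - s1) / \<delta> < real m" using reals_Archimedean2 by blast
  then have "s2 \<le> s1 + real m * \<delta>" using \<delta> by (simp add: divide_less_eq)
  then show Us2: "square_summable (\<lambda>\<xi>. \<rho> \<xi> powr s2 * U i \<xi>)" for i using step[of m i] by simp
  show "square_summable (\<lambda>\<xi>. \<rho> \<xi> powr (s2 - 1) * M j k \<xi>)"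
    by (rule square_summable_weight_mono[OF M[OF _ Us2]]) (use \<delta> s2 nn in auto)
qed

subsection \<open>The symbol of the Stokes operator\<close>

text \<open>The viscosity form on the rank-one matrix with entries
  \<open>v $ k * \<xi> $ \<alpha>\<close>; equivalently \<open>symbol\<close> at a real vector
  \<open>v\<close>, tested with \<open>v\<close>.\<close>

definition quadratic_symbol :: "'n::finite tensor4 \<Rightarrow> real^'n \<Rightarrow> real^'n \<Rightarrow> real" where
  "quadratic_symbol a \<xi> v = (\<Sum>k\<in>UNIV. \<Sum>j\<in>UNIV. \<Sum>\<alpha>\<in>UNIV. \<Sum>\<beta>\<in>UNIV. a k j \<alpha> \<beta> * (\<xi> $ \<alpha> * v $ k) * (\<xi> $ \<beta> * v $ j))"

text \<open>Ellipticity is available only on symmetric trace-free matrices, whereas the symbol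
  contains a rank-one matrix. The tensor symmetries make the form see only the symmetric part of
  each argument, and orthogonality of \<open>\<xi>\<close> and \<open>v\<close> makes that part
  trace-free. Its squared Frobenius norm is then half the product of the squared lengths, whence the
  constant \<open>inverse C / 2\<close>.\<close>

lemma relaxed_elliptic_symbol:
  fixes a :: "'n::finite tensor4"
  assumes sym: "tensor_symmetric a" and ell: "relaxed_elliptic a"
  obtains c where "c > 0"
    and "\<And>\<xi> v :: real^'n. \<xi> \<bullet> v = 0 \<Longrightarrow>
      c * (norm \<xi>)\<^sup>2 * (norm v)\<^sup>2 \<le> quadratic_symbol a \<xi> v"
proof -
  obtain C where C: "C > 0" and ellC: "\<And>\<zeta>::real^'n^'n. \<zeta> = transpose \<zeta> \<and> trace \<zeta> = 0 \<Longrightarrow>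
     (\<Sum>k\<in>UNIV. \<Sum>j\<in>UNIV. \<Sum>\<alpha>\<in>UNIV. \<Sum>\<beta>\<in>UNIV. a k j \<alpha> \<beta> * \<zeta> $ k $ \<alpha> * \<zeta> $ j $ \<beta>)
       \<ge> inverse C * (\<Sum>k\<in>UNIV. \<Sum>\<alpha>\<in>UNIV. \<zeta> $ k $ \<alpha> * \<zeta> $ k $ \<alpha>)"
    using ell unfolding relaxed_elliptic_def by blast
  have sym1: "a k j \<alpha> \<beta> = a \<alpha> j k \<beta>" and sym2: "a k j \<alpha> \<beta> = a k \<beta> \<alpha> j" for k j \<alpha> \<beta>
    using sym unfolding tensor_symmetric_def by blast+
  have "inverse C / 2 * (norm \<xi>)\<^sup>2 * (norm v)\<^sup>2
      \<le> quadratic_symbol a \<xi> v"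
    if orth: "\<xi> \<bullet> v = 0" for \<xi> v :: "real^'n"
  proof -
    define \<zeta> :: "real^'n^'n" where "\<zeta> = (\<chi> k \<alpha>. (\<xi> $ k * v $ \<alpha> + \<xi> $ \<alpha> * v $ k) / 2)"
    have \<zeta>: "\<zeta> $ k $ \<alpha> = (\<xi> $ k * v $ \<alpha> + \<xi> $ \<alpha> * v $ k) / 2" for k \<alpha> by (simp add: \<zeta>_def)
    have "\<zeta> = transpose \<zeta>" by (simp add: vec_eq_iff transpose_def \<zeta> add.commute)
    moreover have "trace \<zeta> = 0" using orth by (simp add: trace_def \<zeta> inner_vec_def)
    ultimately have le: "inverse C * (\<Sum>k\<in>UNIV. \<Sum>\<alpha>\<in>UNIV. \<zeta> $ k $ \<alpha> * \<zeta> $ k $ \<alpha>)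
       \<le> (\<Sum>k\<in>UNIV. \<Sum>j\<in>UNIV. \<Sum>\<alpha>\<in>UNIV. \<Sum>\<beta>\<in>UNIV. a k j \<alpha> \<beta> * \<zeta> $ k $ \<alpha> * \<zeta> $ j $ \<beta>)"
      using ellC by blast
    have "(\<Sum>k\<in>UNIV. \<Sum>\<alpha>\<in>UNIV. \<zeta> $ k $ \<alpha> * \<zeta> $ k $ \<alpha>)
        = (\<Sum>k\<in>UNIV. \<Sum>\<alpha>\<in>UNIV. ((\<xi> $ k * \<xi> $ k) * (v $ \<alpha> * v $ \<alpha>) + (v $ k * v $ k) * (\<xi> $ \<alpha> * \<xi> $ \<alpha>)
            + ((\<xi> $ k * v $ k) * (\<xi> $ \<alpha> * v $ \<alpha>) + (\<xi> $ k * v $ k) * (\<xi> $ \<alpha> * v $ \<alpha>))) / 4)"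
      by (intro sum.cong refl) (simp add: \<zeta> field_simps)
    also have "\<dots> = ((\<xi> \<bullet> \<xi>) * (v \<bullet> v) + (v \<bullet> v) * (\<xi> \<bullet> \<xi>) + ((\<xi> \<bullet> v) * (\<xi> \<bullet> v) + (\<xi> \<bullet> v) * (\<xi> \<bullet> v))) / 4"
      by (simp only: inner_vec_def inner_real_def sum_product sum.distrib sum_divide_distrib[symmetric])
    also have "\<dots> = (norm \<xi>)\<^sup>2 * (norm v)\<^sup>2 / 2"
      using orth by (simp add: power2_norm_eq_inner)
    finally have lhs: "(\<Sum>k\<in>UNIV. \<Sum>\<alpha>\<in>UNIV. \<zeta> $ k $ \<alpha> * \<zeta> $ k $ \<alpha>) = (norm \<xi>)\<^sup>2 * (norm v)\<^sup>2 / 2" .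
    \<comment> \<open>Polarised form: each tensor symmetry gives invariance under transposing one
      argument (\<open>Gl\<close>, \<open>Gr\<close>), so either argument may be
      symmetrised.\<close>
    define G where "G f g = (\<Sum>k\<in>UNIV. \<Sum>j\<in>UNIV. \<Sum>\<alpha>\<in>UNIV. \<Sum>\<beta>\<in>UNIV. a k j \<alpha> \<beta> * f k \<alpha> * g j \<beta>)"
      for f g :: "'n \<Rightarrow> 'n \<Rightarrow> real"
    have Gl: "G (\<lambda>k \<alpha>. f \<alpha> k) g = G f g" for f g
    proof -
      have "G (\<lambda>k \<alpha>. f \<alpha> k) g = (\<Sum>k\<in>UNIV. \<Sum>\<alpha>\<in>UNIV. \<Sum>j\<in>UNIV. \<Sum>\<beta>\<in>UNIV. a k j \<alpha> \<beta> * f \<alpha> k * g j \<beta>)"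
        unfolding G_def by (rule sum.cong[OF refl], rule sum.swap)
      also have "\<dots> = (\<Sum>\<alpha>\<in>UNIV. \<Sum>k\<in>UNIV. \<Sum>j\<in>UNIV. \<Sum>\<beta>\<in>UNIV. a k j \<alpha> \<beta> * f \<alpha> k * g j \<beta>)"
        by (rule sum.swap)
      also have "\<dots> = (\<Sum>\<alpha>\<in>UNIV. \<Sum>k\<in>UNIV. \<Sum>j\<in>UNIV. \<Sum>\<beta>\<in>UNIV. a \<alpha> j k \<beta> * f \<alpha> k * g j \<beta>)"
        by (intro sum.cong refl, subst sym1, rule refl)
      also have "\<dots> = G f g"
        unfolding G_def by (rule sum.cong[OF refl], rule sum.swap)
      finally show ?thesis .
    qed
    have Gr: "G f (\<lambda>j \<beta>. g \<beta> j) = G f g" for f g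
    proof -
      have "G f (\<lambda>j \<beta>. g \<beta> j) = (\<Sum>k\<in>UNIV. \<Sum>\<alpha>\<in>UNIV. \<Sum>j\<in>UNIV. \<Sum>\<beta>\<in>UNIV. a k j \<alpha> \<beta> * f k \<alpha> * g \<beta> j)"
        unfolding G_def by (rule sum.cong[OF refl], rule sum.swap)
      also have "\<dots> = (\<Sum>k\<in>UNIV. \<Sum>\<alpha>\<in>UNIV. \<Sum>\<beta>\<in>UNIV. \<Sum>j\<in>UNIV. a k j \<alpha> \<beta> * f k \<alpha> * g \<beta> j)"
        by (rule sum.cong[OF refl], rule sum.cong[OF refl], rule sum.swap)
      also have "\<dots> = (\<Sum>k\<in>UNIV. \<Sum>\<alpha>\<in>UNIV. \<Sum>\<beta>\<in>UNIV. \<Sum>j\<in>UNIV. a k \<beta> \<alpha> j * f k \<alpha> * g \<beta> j)"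
        by (intro sum.cong refl, subst sym2, rule refl)
      also have "\<dots> = G f g"
        unfolding G_def by (rule sum.cong[OF refl], rule sum.swap)
      finally show ?thesis .
    qed
    have G_add: "G (\<lambda>k \<alpha>. (f k \<alpha> + f' k \<alpha>) / 2) g = (G f g + G f' g) / 2"
      "G g (\<lambda>k \<alpha>. (f k \<alpha> + f' k \<alpha>) / 2) = (G g f + G g f') / 2" for f f' g
    proof -
      have e: "r * ((x + y) / 2) * z = (r * x * z + r * y * z) / 2"
        "r * x * ((y + z) / 2) = (r * x * y + r * x * z) / 2" for r x y z :: real
        by (simp_all add: field_simps)
      show "G (\<lambda>k \<alpha>. (f k \<alpha> + f' k \<alpha>) / 2) g = (G f g + G f' g) / 2"
        unfolding G_def e(1) by (simp only: sum_divide_distrib[symmetric] sum.distrib)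
      show "G g (\<lambda>k \<alpha>. (f k \<alpha> + f' k \<alpha>) / 2) = (G g f + G g f') / 2"
        unfolding G_def e(2) by (simp only: sum_divide_distrib[symmetric] sum.distrib)
    qed
    define h where "h k \<alpha> = \<xi> $ \<alpha> * v $ k" for k \<alpha>
    have \<zeta>h: "(\<lambda>k \<alpha>. \<zeta> $ k $ \<alpha>) = (\<lambda>k \<alpha>. (h \<alpha> k + h k \<alpha>) / 2)"
      by (simp add: \<zeta> h_def fun_eq_iff)
    have "G (\<lambda>k \<alpha>. \<zeta> $ k $ \<alpha>) (\<lambda>k \<alpha>. \<zeta> $ k $ \<alpha>) = G h h"
    proof -
      have l: "G (\<lambda>k \<alpha>. (h \<alpha> k + h k \<alpha>) / 2) g = G h g" for g
        by (simp only: G_add(1)[of "\<lambda>k \<alpha>. h \<alpha> k" h g] Gl[of h g]) simp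
      have r: "G g (\<lambda>k \<alpha>. (h \<alpha> k + h k \<alpha>) / 2) = G g h" for g
        by (simp only: G_add(2)[of g "\<lambda>k \<alpha>. h \<alpha> k" h] Gr[of g h]) simp
      show ?thesis unfolding \<zeta>h by (rule trans[OF l r])
    qed
    then have "(\<Sum>k\<in>UNIV. \<Sum>j\<in>UNIV. \<Sum>\<alpha>\<in>UNIV. \<Sum>\<beta>\<in>UNIV. a k j \<alpha> \<beta> * \<zeta> $ k $ \<alpha> * \<zeta> $ j $ \<beta>)
      = quadratic_symbol a \<xi> v"
      by (simp add: G_def h_def quadratic_symbol_def)
    with le lhs show ?thesis by (simp add: algebra_simps)
  qed
  with C show ?thesis by (intro that[of "inverse C / 2"]) auto
qed

definition symbol :: "'n::finite tensor4 \<Rightarrow> real^'n \<Rightarrow> complex^'n \<Rightarrow> 'n \<Rightarrow> complex" where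
  "symbol a \<xi> v k = (\<Sum>j\<in>UNIV. \<Sum>\<alpha>\<in>UNIV. \<Sum>\<beta>\<in>UNIV. complex_of_real (a k j \<alpha> \<beta> * (\<xi> $ \<alpha> * \<xi> $ \<beta>)) * v $ j)"

lemma cmod_le_norm_vec: "cmod (v $ i) \<le> norm (v :: complex^'n::finite)"
  unfolding norm_vec_def by (rule member_le_L2_set) auto

lemma norm_symbol_le:
  fixes a :: "'n::finite tensor4"
  obtains M where "0 \<le> M" "\<And>\<xi> v k. cmod (symbol a \<xi> v k) \<le> M * (norm \<xi>)\<^sup>2 * norm v"
proof
  let ?M = "\<Sum>k\<in>UNIV. \<Sum>j\<in>UNIV. \<Sum>\<alpha>\<in>UNIV. \<Sum>\<beta>\<in>UNIV. \<bar>a k j \<alpha> \<beta>\<bar>"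
  show "0 \<le> ?M" by (intro sum_nonneg) simp
  fix \<xi> :: "real^'n" and v :: "complex^'n" and k
  have "cmod (symbol a \<xi> v k) \<le> (\<Sum>j\<in>UNIV. \<Sum>\<alpha>\<in>UNIV. \<Sum>\<beta>\<in>UNIV. \<bar>a k j \<alpha> \<beta>\<bar> * ((norm \<xi>)\<^sup>2 * norm v))"
    unfolding symbol_def
  proof (intro sum_norm_le)
    fix j \<alpha> \<beta>
    have "\<bar>\<xi> $ \<alpha>\<bar> * \<bar>\<xi> $ \<beta>\<bar> \<le> norm \<xi> * norm \<xi>"
      by (intro mult_mono component_le_norm_cart) auto
    then show "norm (complex_of_real (a k j \<alpha> \<beta> * (\<xi> $ \<alpha> * \<xi> $ \<beta>)) * v $ j) \<le> \<bar>a k j \<alpha> \<beta>\<bar> * ((norm \<xi>)\<^sup>2 * norm v)"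
      unfolding norm_mult norm_of_real abs_mult mult.assoc power2_eq_square
      by (intro mult_left_mono) (auto simp flip: mult.assoc intro!: mult_mono cmod_le_norm_vec)
  qed
  also have "\<dots> = (\<Sum>j\<in>UNIV. \<Sum>\<alpha>\<in>UNIV. \<Sum>\<beta>\<in>UNIV. \<bar>a k j \<alpha> \<beta>\<bar>) * ((norm \<xi>)\<^sup>2 * norm v)"
    by (simp add: sum_distrib_right)
  also have "\<dots> \<le> ?M * ((norm \<xi>)\<^sup>2 * norm v)"
    by (intro mult_right_mono member_le_sum[of k UNIV "\<lambda>k. \<Sum>j\<in>UNIV. \<Sum>\<alpha>\<in>UNIV. \<Sum>\<beta>\<in>UNIV. \<bar>a k j \<alpha> \<beta>\<bar>"] sum_nonneg) auto
  finally show "cmod (symbol a \<xi> v k) \<le> ?M * (norm \<xi>)\<^sup>2 * norm v" by (simp add: mult.assoc)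
qed

text \<open>Since \<open>\<xi>\<close> is real, the divergence constraint for \<open>v\<close>
  passes to its conjugate, so the pressure cancels against it. The estimate is stated with factors
  \<open>norm \<xi>\<close> and so is harmless at frequency zero, where the zero means are used
  instead.\<close>

lemma stokes_symbol_estimate:
  fixes a :: "'n::finite tensor4"
  assumes sym: "tensor_symmetric a" and ell: "relaxed_elliptic a"
  obtains K where "0 \<le> K"
    and "\<And>\<xi> v q h. (\<Sum>i\<in>UNIV. complex_of_real (\<xi> $ i) * v $ i) = 0 \<Longrightarrow>
      (\<And>k. 4 * pi\<^sup>2 * symbol a \<xi> v k + 2 * pi * \<i> * \<xi> $ k * q = h k) \<Longrightarrow>
      (norm \<xi>)\<^sup>2 * norm v \<le> K * (\<Sum>k\<in>UNIV. cmod (h k)) \<and> norm \<xi> * cmod q \<le> K * (\<Sum>k\<in>UNIV. cmod (h k))"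
proof -
  obtain c where c: "c > 0" and Q: "\<And>\<xi> v :: real^'n. \<xi> \<bullet> v = 0 \<Longrightarrow>
      c * (norm \<xi>)\<^sup>2 * (norm v)\<^sup>2 \<le> quadratic_symbol a \<xi> v"
    using relaxed_elliptic_symbol[OF sym ell] by blast
  obtain M where M: "0 \<le> M" "\<And>\<xi> v k. cmod (symbol a \<xi> v k) \<le> M * (norm \<xi>)\<^sup>2 * norm v"
    using norm_symbol_le by blast
  \<comment> \<open>\<open>K1\<close> is the inverse of the ellipticity constant of the scaled
    symbol. \<open>K2\<close> adds to the data the viscous term, bounded through \<open>M\<close>
    and the velocity estimate just obtained, once for each of the components.\<close>
  define K1 where "K1 = 1 / (4 * pi\<^sup>2 * c)"
  define K2 where "K2 = 1 + 4 * pi\<^sup>2 * M * CARD('n) * K1"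
  have K1: "0 \<le> K1" using c by (simp add: K1_def)
  have K2: "0 \<le> K2" using M K1 by (simp add: K2_def)
  have "(norm \<xi>)\<^sup>2 * norm v \<le> (K1 + K2) * (\<Sum>k\<in>UNIV. cmod (h k)) \<and> norm \<xi> * cmod q \<le> (K1 + K2) * (\<Sum>k\<in>UNIV. cmod (h k))"
    if div: "(\<Sum>i\<in>UNIV. complex_of_real (\<xi> $ i) * v $ i) = 0"
      and eq: "\<And>k. 4 * pi\<^sup>2 * symbol a \<xi> v k + 2 * pi * \<i> * \<xi> $ k * q = h k" for \<xi> :: "real^'n" and v q h
  proof -
    define H where "H = (\<Sum>k\<in>UNIV. cmod (h k))"
    have H: "0 \<le> H" unfolding H_def by (intro sum_nonneg) simp
    define x y :: "real^'n" where "x = (\<chi> i. Re (v $ i))" and "y = (\<chi> i. Im (v $ i))"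
    have nv: "(norm v)\<^sup>2 = (norm x)\<^sup>2 + (norm y)\<^sup>2"
      by (simp add: norm_vec_def L2_set_def x_def y_def sum_nonneg cmod_power2 sum.distrib)
    have "\<xi> \<bullet> x = Re (\<Sum>i\<in>UNIV. complex_of_real (\<xi> $ i) * v $ i)" "\<xi> \<bullet> y = Im (\<Sum>i\<in>UNIV. complex_of_real (\<xi> $ i) * v $ i)"
      by (simp_all add: inner_vec_def x_def y_def)
    then have orth: "\<xi> \<bullet> x = 0" "\<xi> \<bullet> y = 0" using div by simp_all
    have cdiv: "(\<Sum>k\<in>UNIV. complex_of_real (\<xi> $ k) * cnj (v $ k)) = 0"
      using arg_cong[OF div, of cnj] by simp
    \<comment> \<open>With real coefficients, the mixed products of real and imaginary parts are
      purely imaginary, so the form splits into two real ones, both at vectors orthogonal to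
      \<open>\<xi>\<close>.\<close>
    have Re_eq: "Re (\<Sum>k\<in>UNIV. symbol a \<xi> v k * cnj (v $ k))
        = quadratic_symbol a \<xi> x
        + quadratic_symbol a \<xi> y"
      unfolding symbol_def quadratic_symbol_def sum_distrib_right Re_sum sum.distrib[symmetric]
      by (intro sum.cong refl) (simp add: x_def y_def algebra_simps)
    have "c * (norm \<xi>)\<^sup>2 * (norm v)\<^sup>2 \<le> Re (\<Sum>k\<in>UNIV. symbol a \<xi> v k * cnj (v $ k))"
      using Q[OF orth(1)] Q[OF orth(2)] unfolding Re_eq nv by (simp add: algebra_simps)
    then have "4 * pi\<^sup>2 * (c * (norm \<xi>)\<^sup>2 * (norm v)\<^sup>2) \<le> 4 * pi\<^sup>2 * Re (\<Sum>k\<in>UNIV. symbol a \<xi> v k * cnj (v $ k))"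
      by (intro mult_left_mono) auto
    also have "\<dots> = Re (\<Sum>k\<in>UNIV. h k * cnj (v $ k))"
    proof -
      have "(\<Sum>k\<in>UNIV. h k * cnj (v $ k)) = 4 * pi\<^sup>2 * (\<Sum>k\<in>UNIV. symbol a \<xi> v k * cnj (v $ k))
          + 2 * pi * \<i> * q * (\<Sum>k\<in>UNIV. complex_of_real (\<xi> $ k) * cnj (v $ k))"
        unfolding eq[symmetric] sum_distrib_left sum.distrib[symmetric]
        by (intro sum.cong refl) (simp add: algebra_simps)
      also have "\<dots> = complex_of_real (4 * pi\<^sup>2) * (\<Sum>k\<in>UNIV. symbol a \<xi> v k * cnj (v $ k))"
        unfolding cdiv by simp
      finally have *: "(\<Sum>k\<in>UNIV. h k * cnj (v $ k))
          = complex_of_real (4 * pi\<^sup>2) * (\<Sum>k\<in>UNIV. symbol a \<xi> v k * cnj (v $ k))" .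
      have "Re (complex_of_real r * z) = r * Re z" for r z by simp
      then show ?thesis unfolding * by (simp only:)
    qed
    also have "\<dots> \<le> cmod (\<Sum>k\<in>UNIV. h k * cnj (v $ k))" by (rule complex_Re_le_cmod)
    also have "\<dots> \<le> (\<Sum>k\<in>UNIV. cmod (h k) * norm v)"
      by (rule sum_norm_le) (auto simp: norm_mult intro!: mult_left_mono cmod_le_norm_vec)
    also have "\<dots> = H * norm v" by (simp add: H_def sum_distrib_right)
    finally have le: "(4 * pi\<^sup>2 * c * ((norm \<xi>)\<^sup>2 * norm v)) * norm v \<le> H * norm v"
      by (simp add: power2_eq_square algebra_simps)
    have v: "(norm \<xi>)\<^sup>2 * norm v \<le> K1 * H"
    proof (cases "norm v = 0")
      case True
      then show ?thesis using K1 H by simp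
    next
      case False
      then have "4 * pi\<^sup>2 * c * ((norm \<xi>)\<^sup>2 * norm v) \<le> H"
        using le by (simp add: mult_le_cancel_right)
      moreover have "4 * pi\<^sup>2 * c > 0" using c by simp
      ultimately show ?thesis by (simp add: K1_def pos_le_divide_eq mult.commute)
    qed
    have "norm \<xi> * cmod q \<le> K2 * H"
    proof (cases "\<xi> = 0")
      case True
      then show ?thesis using K2 H by simp
    next
      case False
      then have n: "norm \<xi> > 0" by simp
      have "2 * pi * \<i> * q * complex_of_real ((norm \<xi>)\<^sup>2)
          = (\<Sum>k\<in>UNIV. complex_of_real (\<xi> $ k) * (h k - 4 * pi\<^sup>2 * symbol a \<xi> v k))"
      proof -
        have "(norm \<xi>)\<^sup>2 = (\<Sum>k\<in>UNIV. \<xi> $ k * \<xi> $ k)" by (simp add: power2_norm_eq_inner inner_vec_def)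
        then have "2 * pi * \<i> * q * complex_of_real ((norm \<xi>)\<^sup>2) = (\<Sum>k\<in>UNIV. complex_of_real (\<xi> $ k) * (2 * pi * \<i> * \<xi> $ k * q))"
          by (simp add: sum_distrib_left ac_simps)
        also have "\<dots> = (\<Sum>k\<in>UNIV. complex_of_real (\<xi> $ k) * (h k - 4 * pi\<^sup>2 * symbol a \<xi> v k))"
          unfolding eq[symmetric] by simp
        finally show ?thesis .
      qed
      then have "2 * pi * cmod q * (norm \<xi>)\<^sup>2 = cmod (\<Sum>k\<in>UNIV. complex_of_real (\<xi> $ k) * (h k - 4 * pi\<^sup>2 * symbol a \<xi> v k))"
      proof -
        assume *: "2 * pi * \<i> * q * complex_of_real ((norm \<xi>)\<^sup>2)
          = (\<Sum>k\<in>UNIV. complex_of_real (\<xi> $ k) * (h k - 4 * pi\<^sup>2 * symbol a \<xi> v k))"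
        show ?thesis unfolding *[symmetric] by (simp add: norm_mult norm_power)
      qed
      also have "\<dots> \<le> (\<Sum>k\<in>UNIV. norm \<xi> * (cmod (h k) + 4 * pi\<^sup>2 * (M * (norm \<xi>)\<^sup>2 * norm v)))"
      proof (rule sum_norm_le)
        fix k
        have "cmod (h k - 4 * pi\<^sup>2 * symbol a \<xi> v k) \<le> cmod (h k) + cmod (4 * pi\<^sup>2 * symbol a \<xi> v k)"
          by (rule norm_triangle_ineq4)
        also have "cmod (4 * pi\<^sup>2 * symbol a \<xi> v k) = 4 * pi\<^sup>2 * cmod (symbol a \<xi> v k)"
          by (simp add: norm_mult norm_power)
        also have "\<dots> \<le> 4 * pi\<^sup>2 * (M * (norm \<xi>)\<^sup>2 * norm v)"
          by (intro mult_left_mono M) auto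
        finally have "cmod (h k - 4 * pi\<^sup>2 * symbol a \<xi> v k) \<le> cmod (h k) + 4 * pi\<^sup>2 * (M * (norm \<xi>)\<^sup>2 * norm v)" by simp
        then show "cmod (complex_of_real (\<xi> $ k) * (h k - 4 * pi\<^sup>2 * symbol a \<xi> v k))
            \<le> norm \<xi> * (cmod (h k) + 4 * pi\<^sup>2 * (M * (norm \<xi>)\<^sup>2 * norm v))"
          unfolding norm_mult norm_of_real by (intro mult_mono component_le_norm_cart) auto
      qed
      also have "\<dots> = norm \<xi> * (H + 4 * pi\<^sup>2 * M * CARD('n) * ((norm \<xi>)\<^sup>2 * norm v))"
        by (simp add: H_def sum_distrib_left[symmetric] sum.distrib algebra_simps)
      also have "\<dots> \<le> norm \<xi> * (H + 4 * pi\<^sup>2 * M * CARD('n) * (K1 * H))"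
        using v M by (intro mult_left_mono add_left_mono) auto
      also have "\<dots> = norm \<xi> * (K2 * H)" by (simp add: K2_def algebra_simps)
      finally have "norm \<xi> * (2 * pi * (norm \<xi> * cmod q)) \<le> norm \<xi> * (K2 * H)"
        by (simp add: power2_eq_square ac_simps)
      then have "2 * pi * (norm \<xi> * cmod q) \<le> K2 * H" using n by simp
      moreover have "1 * (norm \<xi> * cmod q) \<le> 2 * pi * (norm \<xi> * cmod q)"
        using pi_ge_two by (intro mult_right_mono) auto
      ultimately show ?thesis by simp
    qed
    moreover have "K1 * H \<le> (K1 + K2) * H" "K2 * H \<le> (K1 + K2) * H"
      using K1 K2 H by (auto intro!: mult_right_mono)
    ultimately show ?thesis using v unfolding H_def by linarith
  qed
  note main = this
  show ?thesis
  proof (rule that)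
    show "0 \<le> K1 + K2" using K1 K2 by simp
  qed (fact main)
qed

subsection \<open>The Navier-Stokes system on the Fourier side\<close>

lemma fourier_coeff_zero: "fourier_coeff g 0 = g (\<lambda>_. 1)"
  by (simp add: fourier_coeff_eq)

text \<open>Only homogeneity on test functions is asked of \<open>g\<close>, so that the lemma
  covers distributions and the products \<open>dist_mult\<close> alike.\<close>

lemma dist_deriv_character:
  assumes "\<And>c \<phi>. \<phi> \<in> Cinf_per \<Longrightarrow> g (\<lambda>x. c * \<phi> x) = c * g \<phi>"
  shows "dist_deriv i g (\<lambda>x. c * character (- \<xi>) x) = c * (2 * pi * \<i> * of_int (\<xi> $ i)) * fourier_coeff g \<xi>"
    and "dist_deriv i g (character (- \<xi>)) = 2 * pi * \<i> * of_int (\<xi> $ i) * fourier_coeff g \<xi>"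
proof -
  show 1: "dist_deriv i g (\<lambda>x. c * character (- \<xi>) x) = c * (2 * pi * \<i> * of_int (\<xi> $ i)) * fourier_coeff g \<xi>" for c
    unfolding dist_deriv_def partial_cmult_character assms[OF character_Cinf_per] fourier_coeff_eq
    by simp
  show "dist_deriv i g (character (- \<xi>)) = 2 * pi * \<i> * of_int (\<xi> $ i) * fourier_coeff g \<xi>"
    using 1[of 1] by simp
qed

lemma dist_mult_cmult: "dist_mult g h (\<lambda>x. c * \<phi> x) = c * dist_mult g h \<phi>"
proof -
  have "dist_of_fun W (\<lambda>x. c * \<phi> x) = c * dist_of_fun W \<phi>" for W
    by (simp add: dist_of_fun_eq mult.left_commute[of "W _" c])
  then show ?thesis by (simp add: dist_mult_def)
qed

lemma dist_div_fourier:
  assumes u: "\<And>i. u $ i \<in> periodic_distributions" and div: "pdist_eq (dist_div u) (\<lambda>_. 0)"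
  shows "(\<Sum>i\<in>UNIV. complex_of_real (real_vec \<xi> $ i) * fourier_coeff (u $ i) \<xi>) = 0"
proof -
  have "dist_div u (character (- \<xi>)) = 0"
    using div character_Cinf_per unfolding pdist_eq_def by blast
  then have "2 * pi * \<i> * (\<Sum>i\<in>UNIV. complex_of_real (real_vec \<xi> $ i) * fourier_coeff (u $ i) \<xi>) = 0"
    by (simp add: dist_div_def dist_deriv_character(2)[OF pdist_cmult[OF u]] sum_distrib_left mult.assoc)
  then show ?thesis by simp
qed

text \<open>The strain contributes two halves that differ by exchanging \<open>j\<close> and
  \<open>\<beta>\<close>. The second tensor symmetry, after relabelling the sums, makes them equal
  and leaves the unsymmetrised gradient.\<close>

lemma viscous_op_fourier:
  assumes sym: "tensor_symmetric a" and u: "\<And>i. u $ i \<in> periodic_distributions"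
  shows "(viscous_op a u $ k) (character (- \<xi>))
    = - (4 * pi\<^sup>2 * symbol a (real_vec \<xi>) (\<chi> j. fourier_coeff (u $ j) \<xi>) k)"
proof -
  define x where "x i = complex_of_int (\<xi> $ i)" for i
  define w where "w i = fourier_coeff (u $ i) \<xi>" for i
  have sym2: "a k j \<alpha> \<beta> = a k \<beta> \<alpha> j" for j \<alpha> \<beta>
    using sym unfolding tensor_symmetric_def by blast
  have st: "strain u j \<beta> (\<lambda>z. c * character (- \<xi>) z) = c * (pi * \<i>) * (x j * w \<beta> + x \<beta> * w j)" for j \<beta> c
    by (simp add: strain_def dist_deriv_character(1)[OF pdist_cmult[OF u]] x_def w_def field_simps)
  have "(viscous_op a u $ k) (character (- \<xi>)) =
    (\<Sum>\<alpha>\<in>UNIV. - (\<Sum>j\<in>UNIV. \<Sum>\<beta>\<in>UNIV. complex_of_real (a k j \<alpha> \<beta>)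
      * strain u j \<beta> (\<lambda>z. (- (2 * pi * \<i> * x \<alpha>)) * character (- \<xi>) z)))"
    by (simp add: viscous_op_def dist_deriv_def partial_character x_def)
  also have "\<dots> = (\<Sum>\<alpha>\<in>UNIV. - (\<Sum>j\<in>UNIV. \<Sum>\<beta>\<in>UNIV. complex_of_real (a k j \<alpha> \<beta>)
      * (2 * pi\<^sup>2 * x \<alpha> * (x j * w \<beta>)) + complex_of_real (a k j \<alpha> \<beta>) * (2 * pi\<^sup>2 * x \<alpha> * (x \<beta> * w j))))"
    unfolding st
    by (intro sum.cong refl arg_cong[where f=uminus]) (simp add: power2_eq_square algebra_simps)
  also have "\<dots> = - ((\<Sum>\<alpha>\<in>UNIV. \<Sum>j\<in>UNIV. \<Sum>\<beta>\<in>UNIV. complex_of_real (a k j \<alpha> \<beta>) * (2 * pi\<^sup>2 * x \<alpha> * (x j * w \<beta>)))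
     + (\<Sum>\<alpha>\<in>UNIV. \<Sum>j\<in>UNIV. \<Sum>\<beta>\<in>UNIV. complex_of_real (a k j \<alpha> \<beta>) * (2 * pi\<^sup>2 * x \<alpha> * (x \<beta> * w j))))"
    by (simp only: sum.distrib sum_negf)
  also have "(\<Sum>\<alpha>\<in>UNIV. \<Sum>j\<in>UNIV. \<Sum>\<beta>\<in>UNIV. complex_of_real (a k j \<alpha> \<beta>) * (2 * pi\<^sup>2 * x \<alpha> * (x j * w \<beta>)))
    = (\<Sum>\<alpha>\<in>UNIV. \<Sum>\<beta>\<in>UNIV. \<Sum>j\<in>UNIV. complex_of_real (a k j \<alpha> \<beta>) * (2 * pi\<^sup>2 * x \<alpha> * (x j * w \<beta>)))"
    by (rule sum.cong[OF refl], rule sum.swap)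
  also have "\<dots> = (\<Sum>\<alpha>\<in>UNIV. \<Sum>\<beta>\<in>UNIV. \<Sum>j\<in>UNIV. complex_of_real (a k \<beta> \<alpha> j) * (2 * pi\<^sup>2 * x \<alpha> * (x j * w \<beta>)))"
    by (intro sum.cong refl, subst sym2, rule refl)
  also have "- (\<dots> + (\<Sum>\<alpha>\<in>UNIV. \<Sum>j\<in>UNIV. \<Sum>\<beta>\<in>UNIV. complex_of_real (a k j \<alpha> \<beta>) * (2 * pi\<^sup>2 * x \<alpha> * (x \<beta> * w j))))
    = - (\<Sum>\<alpha>\<in>UNIV. \<Sum>j\<in>UNIV. \<Sum>\<beta>\<in>UNIV. 4 * pi\<^sup>2 * (complex_of_real (a k j \<alpha> \<beta>) * (x \<alpha> * x \<beta>) * w j))"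
    unfolding sum.distrib[symmetric]
    by (intro arg_cong[where f=uminus] sum.cong refl) (simp add: algebra_simps)
  also have "(\<Sum>\<alpha>\<in>UNIV. \<Sum>j\<in>UNIV. \<Sum>\<beta>\<in>UNIV. 4 * pi\<^sup>2 * (complex_of_real (a k j \<alpha> \<beta>) * (x \<alpha> * x \<beta>) * w j))
    = (\<Sum>j\<in>UNIV. \<Sum>\<alpha>\<in>UNIV. \<Sum>\<beta>\<in>UNIV. 4 * pi\<^sup>2 * (complex_of_real (a k j \<alpha> \<beta>) * (x \<alpha> * x \<beta>) * w j))"
    by (rule sum.swap)
  also have "\<dots> = 4 * pi\<^sup>2 * symbol a (real_vec \<xi>) (\<chi> j. fourier_coeff (u $ j) \<xi>) k"
    by (simp add: symbol_def sum_distrib_left x_def w_def)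
  finally show ?thesis .
qed

lemma navier_stokes_fourier:
  assumes sym: "tensor_symmetric a" and u: "\<And>i. u $ i \<in> periodic_distributions"
    and p: "p \<in> periodic_distributions" and ns: "navier_stokes_solution a f u p"
  shows "4 * pi\<^sup>2 * symbol a (real_vec \<xi>) (\<chi> j. fourier_coeff (u $ j) \<xi>) k
      + 2 * pi * \<i> * (real_vec \<xi> $ k) * fourier_coeff p \<xi>
    = fourier_coeff (f $ k) \<xi> - (\<Sum>j\<in>UNIV. 2 * pi * \<i> * (real_vec \<xi> $ j) * fourier_coeff (dist_mult (u $ j) (u $ k)) \<xi>)"
proof -
  have "- (stokes_op a u p $ k) (character (- \<xi>)) = (f $ k) (character (- \<xi>)) - (convection u $ k) (character (- \<xi>))"
    using ns character_Cinf_per unfolding navier_stokes_solution_def pdist_eq_def by blast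
  moreover have "(stokes_op a u p $ k) (character (- \<xi>)) = - (4 * pi\<^sup>2 * symbol a (real_vec \<xi>) (\<chi> j. fourier_coeff (u $ j) \<xi>) k)
     - 2 * pi * \<i> * (real_vec \<xi> $ k) * fourier_coeff p \<xi>"
    using viscous_op_fourier[OF sym u, where k=k and \<xi>=\<xi>]
    by (simp add: stokes_op_def dist_deriv_character(2)[OF pdist_cmult[OF p]])
  moreover have "(convection u $ k) (character (- \<xi>))
      = (\<Sum>j\<in>UNIV. 2 * pi * \<i> * (real_vec \<xi> $ j) * fourier_coeff (dist_mult (u $ j) (u $ k)) \<xi>)"
    by (simp add: convection_def dist_deriv_character(2)[OF dist_mult_cmult])
  ultimately show ?thesis by (simp add: fourier_coeff_eq add.commute)
qed

subsection \<open>Regularity\<close>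

lemma summable_weight_iff:
  "(\<lambda>\<xi>. \<rho> \<xi> powr (2 * s) * (cmod (c \<xi>))\<^sup>2) summable_on UNIV
    \<longleftrightarrow> square_summable (\<lambda>\<xi>. \<rho> \<xi> powr s * cmod (c \<xi>))"
  by (simp add: square_summable_def power_mult_distrib powr_powr mult.commute[of s] flip: powr_numeral)

lemma H_per_iff:
  "g \<in> H_per s \<longleftrightarrow> g \<in> periodic_distributions \<and>
    square_summable (\<lambda>\<xi>. \<rho> \<xi> powr s * cmod (fourier_coeff g \<xi>))"
  by (simp add: H_per_def summable_weight_iff)

text \<open>With \<open>s \<ge> 0\<close> both factors are square integrable, so
  \<open>dist_mult\<close> is formed from genuine densities with the right coefficients.\<close>

lemma fourier_coeff_dist_mult_le:
  assumes g: "g \<in> H_per s" and h: "h \<in> H_per s" and s: "0 \<le> s"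
    and conv: "(\<lambda>\<eta>. cmod (fourier_coeff g \<eta>) * cmod (fourier_coeff h (\<xi> - \<eta>))) summable_on UNIV"
  shows "cmod (fourier_coeff (dist_mult g h) \<xi>)
    \<le> (\<Sum>\<^sub>\<infinity>\<eta>. cmod (fourier_coeff g \<eta>) * cmod (fourier_coeff h (\<xi> - \<eta>)))"
proof -
  have sq: "(\<lambda>\<xi>. (cmod (fourier_coeff k \<xi>))\<^sup>2) summable_on UNIV" if "k \<in> H_per s" for k :: "'a pdist"
    using that square_summable_weight_mono[of s "\<lambda>\<xi>. cmod (fourier_coeff k \<xi>)" 0] s
    by (simp add: H_per_iff square_summable_def)
  have pd: "g \<in> periodic_distributions" "h \<in> periodic_distributions" using g h by (auto simp: H_per_iff)
  note G = L2_density_exists[OF pd(1) sq[OF g]] and H = L2_density_exists[OF pd(2) sq[OF h]]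
  show ?thesis
    using torus_coeff_mult_le[OF G(1) H(1), of \<xi>] sq[OF g] conv
    by (simp add: G(2) H(2) dist_mult_def fourier_coeff_dist_of_fun)
qed

text \<open>A summable nonnegative family is bounded, hence its square is at most a constant
  multiple of itself.\<close>

lemma rapid_imp_square_summable:
  fixes c :: "int^'n::finite \<Rightarrow> complex"
  assumes c: "rapid c"
  shows "square_summable (\<lambda>\<xi>. \<rho> \<xi> powr s * cmod (c \<xi>))"
proof -
  obtain m :: nat where m: "s < real m" using reals_Archimedean2 by blast
  have s1: "(\<lambda>\<xi>. \<rho> \<xi> ^ m * cmod (c \<xi>)) summable_on UNIV" using c by (simp add: rapid_def)
  define B where "B = (\<Sum>\<^sub>\<infinity>\<xi>. \<rho> \<xi> ^ m * cmod (c \<xi>))"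
  have B: "\<rho> \<xi> ^ m * cmod (c \<xi>) \<le> B" for \<xi>
    using finite_sum_le_infsum[OF s1, of "{\<xi>}"] by (simp add: B_def)
  have "square_summable (\<lambda>\<xi>. \<rho> \<xi> ^ m * cmod (c \<xi>))"
    unfolding square_summable_def
  proof (rule summable_on_comparison_test[OF summable_on_cmult_right[OF s1]])
    show "(\<rho> \<xi> ^ m * cmod (c \<xi>))\<^sup>2 \<le> B * (\<rho> \<xi> ^ m * cmod (c \<xi>))" for \<xi>
      unfolding power2_eq_square by (intro mult_right_mono B) auto
  qed auto
  then have "square_summable (\<lambda>\<xi>. \<rho> \<xi> powr real m * cmod (c \<xi>))"
    by (simp add: powr_realpow)
  then show ?thesis by (rule square_summable_weight_mono) (use m in auto)
qed

lemma all_square_summable_imp_rapid: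
  assumes "\<And>m. square_summable (\<lambda>\<xi>. \<rho> \<xi> powr real m * cmod (c \<xi>))"
  shows "rapid c"
proof (rule rapidI_bounded)
  fix m
  show "\<exists>B. \<forall>\<xi>. \<rho> \<xi> ^ m * cmod (c \<xi>) \<le> B"
    using square_summable_bounded[OF assms[of m]] by (auto simp: powr_realpow abs_mult)
qed

lemma Cinfdot_per_rapid:
  assumes "g \<in> Cinfdot_per" shows "rapid (fourier_coeff g)"
proof -
  obtain F where F: "F \<in> Cinf_per" "pdist_eq g (dist_of_fun F)"
    using assms by (auto simp: Cinfdot_per_def)
  have "fourier_coeff g = fourier_coeff (dist_of_fun F)"
    using F(2) by (auto simp: fun_eq_iff fourier_coeff_eq pdist_eq_def character_Cinf_per)
  then show ?thesis using rapid_torus_coeff[OF F(1)] by (simp add: fourier_coeff_dist_of_fun)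
qed

lemma Cinfdot_perI:
  assumes g: "g \<in> periodic_distributions" "g (\<lambda>_. 1) = 0" and r: "rapid (fourier_coeff g)"
  shows "g \<in> Cinfdot_per"
proof -
  let ?F = "fseries (fourier_coeff g)"
  have F: "?F \<in> Cinf_per" by (rule fseries_Cinf_per[OF r])
  have "pdist_eq g (dist_of_fun ?F)"
  proof (rule pdist_eqI[OF g(1) dist_of_fun_periodic_distribution[OF Cinf_per_D(4)[OF F]]])
    show "fourier_coeff g = fourier_coeff (dist_of_fun ?F)"
      by (simp add: fourier_coeff_dist_of_fun fun_eq_iff torus_coeff_fseries[OF r])
  qed
  with F g show ?thesis by (auto simp: Cinfdot_per_def)
qed

text \<open>A nonzero integer vector has length at least 1. This spectral gap turns the homogeneous
  symbol estimates into weighted ones.\<close>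

lemma bessel_weight_le_norm:
  assumes "\<xi> \<noteq> 0" shows "(\<rho> \<xi>)\<^sup>2 \<le> 2 * (norm (real_vec \<xi>))\<^sup>2"
    and "\<rho> \<xi> \<le> 2 * norm (real_vec \<xi>)"
proof -
  obtain i where "\<xi> $ i \<noteq> 0" using assms by (auto simp: vec_eq_iff)
  then have "1 \<le> \<bar>\<xi> $ i\<bar>" by linarith
  then have "1 \<le> \<bar>real_vec \<xi> $ i\<bar>" unfolding real_vec_component by linarith
  then have n: "1 \<le> norm (real_vec \<xi>)" using component_le_norm_cart[of "real_vec \<xi>" i] by linarith
  then have "1 \<le> (norm (real_vec \<xi>))\<^sup>2" by simp
  then show 1: "(\<rho> \<xi>)\<^sup>2 \<le> 2 * (norm (real_vec \<xi>))\<^sup>2" by (simp add: bessel_weight_def)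
  also have "\<dots> \<le> (2 * norm (real_vec \<xi>))\<^sup>2" by (simp add: power_mult_distrib)
  finally show "\<rho> \<xi> \<le> 2 * norm (real_vec \<xi>)" by (rule power2_le_imp_le) simp
qed

text \<open>The assumption on \<open>f\<close> concerns only the decay of its coefficients, so the
  same lemma serves Sobolev data at one order and smooth data at every order.\<close>

lemma navier_stokes_regularity:
  fixes a :: "'n::finite tensor4" and u :: "'n pdist ^ 'n"
  assumes n: "CARD('n) \<ge> 2" and s1: "- 1 + real CARD('n) / 2 < s1" and s12: "s1 < s2"
    and sym: "tensor_symmetric a" and ell: "relaxed_elliptic a"
    and u: "u \<in> Hdot_per_sigma s1" and p: "p \<in> Hdot_per (s1 - 1)"
    and f: "\<And>k. square_summable (\<lambda>\<xi>. \<rho> \<xi> powr (s2 - 2) * cmod (fourier_coeff (f $ k) \<xi>))"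
    and ns: "navier_stokes_solution a f u p"
  shows "\<And>i. square_summable (\<lambda>\<xi>. \<rho> \<xi> powr s2 * cmod (fourier_coeff (u $ i) \<xi>))"
    and "square_summable (\<lambda>\<xi>. \<rho> \<xi> powr (s2 - 1) * cmod (fourier_coeff p \<xi>))"
proof -
  \<comment> \<open>In dimension at least two the critical exponent is nonnegative; this makes
    \<open>u\<close> square integrable and its products meaningful.\<close>
  have s10: "0 \<le> s1" using n s1 by linarith
  have uH: "u $ i \<in> H_per s1" and u0: "(u $ i) (\<lambda>_. 1) = 0" for i
    using u by (auto simp: Hdot_per_sigma_def Hdot_per_vec_def Hdot_per_def)
  have upd: "u $ i \<in> periodic_distributions" for i using uH[of i] by (simp add: H_per_iff)
  have ppd: "p \<in> periodic_distributions" and p0: "p (\<lambda>_. 1) = 0"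
    using p by (auto simp: Hdot_per_def H_per_iff)
  define U where "U i \<xi> = cmod (fourier_coeff (u $ i) \<xi>)" for i \<xi>
  define P where "P \<xi> = cmod (fourier_coeff p \<xi>)" for \<xi>
  define F where "F k \<xi> = cmod (fourier_coeff (f $ k) \<xi>)" for k \<xi>
  define M where "M j k \<xi> = cmod (fourier_coeff (dist_mult (u $ j) (u $ k)) \<xi>)" for j k \<xi>
  define R where "R \<xi> = (\<Sum>k\<in>UNIV. F k \<xi>) + \<rho> \<xi> * (\<Sum>k\<in>UNIV. \<Sum>j\<in>UNIV. M j k \<xi>)" for \<xi>
  have R0: "0 \<le> R \<xi>" for \<xi>
    unfolding R_def F_def M_def by (intro add_nonneg_nonneg mult_nonneg_nonneg sum_nonneg) auto
  obtain K where K: "0 \<le> K" and KE: "\<And>\<xi> v q h. (\<Sum>i\<in>UNIV. complex_of_real (\<xi> $ i) * v $ i) = 0 \<Longrightarrow>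
      (\<And>k. 4 * pi\<^sup>2 * symbol a \<xi> v k + 2 * pi * \<i> * \<xi> $ k * q = h k) \<Longrightarrow>
      (norm \<xi>)\<^sup>2 * norm v \<le> K * (\<Sum>k\<in>UNIV. cmod (h k)) \<and> norm \<xi> * cmod q \<le> K * (\<Sum>k\<in>UNIV. cmod (h k))"
    using stokes_symbol_estimate[OF sym ell] by blast
  \<comment> \<open>The constant collects a factor \<open>2 pi\<close> from the derivatives in
    \<open>h\<close> and a factor 2 from comparing the weight with the norm. Frequency zero is
    settled by the zero means.\<close>
  have E: "(\<rho> \<xi>)\<^sup>2 * U i \<xi> \<le> (4 * pi * K) * R \<xi> \<and> \<rho> \<xi> * P \<xi> \<le> (4 * pi * K) * R \<xi>" for \<xi> i
  proof (cases "\<xi> = 0")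
    case True
    then have "U i \<xi> = 0" "P \<xi> = 0" by (simp_all add: U_def P_def fourier_coeff_zero u0 p0)
    then show ?thesis using K R0 by simp
  next
    case False
    define v where "v = (\<chi> j. fourier_coeff (u $ j) \<xi>)"
    define h where "h k = fourier_coeff (f $ k) \<xi>
      - (\<Sum>j\<in>UNIV. 2 * pi * \<i> * (real_vec \<xi> $ j) * fourier_coeff (dist_mult (u $ j) (u $ k)) \<xi>)" for k
    have "(\<Sum>i\<in>UNIV. complex_of_real (real_vec \<xi> $ i) * v $ i) = 0"
      using dist_div_fourier[OF upd, of \<xi>] u by (simp add: v_def Hdot_per_sigma_def)
    moreover have "4 * pi\<^sup>2 * symbol a (real_vec \<xi>) v k + 2 * pi * \<i> * real_vec \<xi> $ k * fourier_coeff p \<xi> = h k" for k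
      unfolding v_def h_def by (rule navier_stokes_fourier[OF sym upd ppd ns])
    ultimately have est: "(norm (real_vec \<xi>))\<^sup>2 * norm v \<le> K * (\<Sum>k\<in>UNIV. cmod (h k))"
      "norm (real_vec \<xi>) * P \<xi> \<le> K * (\<Sum>k\<in>UNIV. cmod (h k))"
      using KE[of "real_vec \<xi>" v "fourier_coeff p \<xi>" h] unfolding P_def by blast+
    have h: "cmod (h k) \<le> 2 * pi * (F k \<xi> + \<rho> \<xi> * (\<Sum>j\<in>UNIV. M j k \<xi>))" for k
    proof -
      have "cmod (\<Sum>j\<in>UNIV. 2 * pi * \<i> * (real_vec \<xi> $ j) * fourier_coeff (dist_mult (u $ j) (u $ k)) \<xi>)
          \<le> (\<Sum>j\<in>UNIV. 2 * pi * (\<rho> \<xi> * M j k \<xi>))"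
      proof (rule sum_norm_le)
        fix j
        have "\<bar>real_vec \<xi> $ j\<bar> * M j k \<xi> \<le> \<rho> \<xi> * M j k \<xi>"
          using component_le_bessel_weight[of \<xi> j] by (intro mult_right_mono) (auto simp: M_def)
        then show "cmod (2 * pi * \<i> * (real_vec \<xi> $ j) * fourier_coeff (dist_mult (u $ j) (u $ k)) \<xi>)
            \<le> 2 * pi * (\<rho> \<xi> * M j k \<xi>)"
          by (simp add: norm_mult M_def mult.assoc)
      qed
      also have "\<dots> = 2 * pi * (\<rho> \<xi> * (\<Sum>j\<in>UNIV. M j k \<xi>))" by (simp add: sum_distrib_left)
      finally have "cmod (h k) \<le> F k \<xi> + 2 * pi * (\<rho> \<xi> * (\<Sum>j\<in>UNIV. M j k \<xi>))"
        unfolding h_def F_def by (intro order_trans[OF norm_triangle_ineq4] add_mono) auto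
      moreover have "1 * F k \<xi> \<le> 2 * pi * F k \<xi>"
        using pi_ge_two by (intro mult_right_mono) (auto simp: F_def)
      ultimately show ?thesis by (simp add: distrib_left)
    qed
    have "(\<Sum>k\<in>UNIV. cmod (h k)) \<le> (\<Sum>k\<in>UNIV. 2 * pi * (F k \<xi> + \<rho> \<xi> * (\<Sum>j\<in>UNIV. M j k \<xi>)))"
      by (intro sum_mono h)
    also have "\<dots> = 2 * pi * R \<xi>"
      by (simp add: R_def sum_distrib_left[symmetric] sum.distrib)
    finally have "K * (\<Sum>k\<in>UNIV. cmod (h k)) \<le> K * (2 * pi * R \<xi>)" using K by (rule mult_left_mono)
    note est = order_trans[OF est(1) this] order_trans[OF est(2) this]
    have "(\<rho> \<xi>)\<^sup>2 * U i \<xi> \<le> 2 * (norm (real_vec \<xi>))\<^sup>2 * norm v"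
      using cmod_le_norm_vec[of v i] by (intro mult_mono bessel_weight_le_norm False) (auto simp: U_def v_def)
    moreover have "\<rho> \<xi> * P \<xi> \<le> 2 * norm (real_vec \<xi>) * P \<xi>"
      by (intro mult_right_mono bessel_weight_le_norm False) (simp add: P_def)
    ultimately show ?thesis using est by (simp add: algebra_simps)
  qed
  have nn: "0 \<le> U i \<xi>" "0 \<le> F i \<xi>" "0 \<le> M j k \<xi>" "0 \<le> P \<xi>" for i j k \<xi>
    by (simp_all add: U_def F_def M_def P_def)
  have EU: "\<rho> \<xi> powr 2 * U i \<xi>
      \<le> (4 * pi * K) * ((\<Sum>k\<in>UNIV. F k \<xi>) + \<rho> \<xi> * (\<Sum>k\<in>UNIV. \<Sum>j\<in>UNIV. M j k \<xi>))" for i \<xi>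
    using E[of \<xi> i] by (simp add: R_def)
  \<comment> \<open>The pressure part of \<open>E\<close> does not depend on the component index, so
    any index, here \<open>undefined\<close>, will do.\<close>
  have EP: "\<rho> \<xi> powr 1 * P \<xi>
      \<le> (4 * pi * K) * ((\<Sum>k\<in>UNIV. F k \<xi>) + \<rho> \<xi> * (\<Sum>k\<in>UNIV. \<Sum>j\<in>UNIV. M j k \<xi>))" for \<xi>
    using E[of \<xi> undefined] by (simp add: R_def)
  have ME: "M j k \<xi> \<le> (\<Sum>\<^sub>\<infinity>\<eta>. U j \<eta> * U k (\<xi> - \<eta>))" if "(\<lambda>\<eta>. U j \<eta> * U k (\<xi> - \<eta>)) summable_on UNIV" for j k \<xi>
    using that unfolding M_def U_def by (rule fourier_coeff_dist_mult_le[OF uH uH s10])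
  have Us: "square_summable (\<lambda>\<xi>. \<rho> \<xi> powr s1 * U i \<xi>)" for i
    using uH[of i] by (simp add: H_per_iff U_def)
  have Fs: "square_summable (\<lambda>\<xi>. \<rho> \<xi> powr (s2 - 2) * F k \<xi>)" for k
    using f by (simp add: F_def)
  note B = bootstrap[where U=U and F=F and M=M, OF s1 s10 s12 nn(1-3) EU ME Us Fs]
  show "square_summable (\<lambda>\<xi>. \<rho> \<xi> powr s2 * cmod (fourier_coeff (u $ i) \<xi>))" for i
    using B(1)[of i] by (simp add: U_def)
  \<comment> \<open>The pressure is recovered only now, with a gain of one derivative, from the
    final regularity of the products.\<close>
  have "square_summable (\<lambda>\<xi>. \<rho> \<xi> powr (s2 - 2 + 1) * P \<xi>)"
    by (rule elliptic_gain[OF EP nn(4) Fs]) (use B(2) in simp)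
  then show "square_summable (\<lambda>\<xi>. \<rho> \<xi> powr (s2 - 1) * cmod (fourier_coeff p \<xi>))"
    by (simp add: P_def)
qed

theorem theorem5:
  fixes a :: "'n::finite tensor4" and s1 s2 :: real
  assumes "CARD('n) \<ge> 2"
    and "- 1 + real CARD('n) / 2 < s1" and "s1 < s2"
    and "tensor_symmetric a" and "relaxed_elliptic a"
  shows "(\<forall>(u :: 'n pdist ^ 'n) (p :: 'n pdist) (f :: 'n pdist ^ 'n).
            u \<in> Hdot_per_sigma s1 \<and> p \<in> Hdot_per (s1 - 1) \<and> f \<in> Hdot_per_vec (s2 - 2) \<and>
            navier_stokes_solution a f u p
            \<longrightarrow> u \<in> Hdot_per_sigma s2 \<and> p \<in> Hdot_per (s2 - 1)) \<and>
         (\<forall>(u :: 'n pdist ^ 'n) (p :: 'n pdist) (f :: 'n pdist ^ 'n).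
            u \<in> Hdot_per_sigma s1 \<and> p \<in> Hdot_per (s1 - 1) \<and> f \<in> Cinfdot_per_vec \<and>
            navier_stokes_solution a f u p
            \<longrightarrow> u \<in> Cinfdot_per_vec \<and> p \<in> Cinfdot_per)"
proof (intro conjI allI impI; (elim conjE)?)
  fix u :: "'n pdist ^ 'n" and p :: "'n pdist" and f :: "'n pdist ^ 'n"
  assume u: "u \<in> Hdot_per_sigma s1" and p: "p \<in> Hdot_per (s1 - 1)"
    and f: "f \<in> Hdot_per_vec (s2 - 2)" and ns: "navier_stokes_solution a f u p"
  have "square_summable (\<lambda>\<xi>. \<rho> \<xi> powr (s2 - 2) * cmod (fourier_coeff (f $ k) \<xi>))" for k
    using f by (auto simp: Hdot_per_vec_def Hdot_per_def H_per_iff)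
  note reg = navier_stokes_regularity[OF assms u p this ns]
  \<comment> \<open>Being a distribution, zero mean and zero divergence carry over from the
    hypotheses; only the decay of the coefficients is new.\<close>
  show "u \<in> Hdot_per_sigma s2"
    using u reg(1) by (auto simp: Hdot_per_sigma_def Hdot_per_vec_def Hdot_per_def H_per_iff)
  show "p \<in> Hdot_per (s2 - 1)"
    using p reg(2) by (auto simp: Hdot_per_def H_per_iff)
next
  fix u :: "'n pdist ^ 'n" and p :: "'n pdist" and f :: "'n pdist ^ 'n"
  assume u: "u \<in> Hdot_per_sigma s1" and p: "p \<in> Hdot_per (s1 - 1)"
    and f: "f \<in> Cinfdot_per_vec" and ns: "navier_stokes_solution a f u p"
  have "rapid (fourier_coeff (f $ k))" for k
    using f by (auto simp: Cinfdot_per_vec_def intro: Cinfdot_per_rapid)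
  note fs = rapid_imp_square_summable[OF this]
  \<comment> \<open>Large enough to exceed \<open>s1\<close> and, thanks to the added 1, to leave
    order \<open>m\<close> for the pressure as well, which is one order less regular than the
    velocity.\<close>
  define t where "t m = max s2 (real m + 1)" for m
  have t: "s1 < t m" "real m \<le> t m" "real m \<le> t m - 1" for m using assms(3) by (auto simp: t_def)
  note reg = navier_stokes_regularity[OF assms(1,2) t(1) assms(4,5) u p fs ns]
  have ur: "rapid (fourier_coeff (u $ i))" for i
    by (rule all_square_summable_imp_rapid, rule square_summable_weight_mono[OF reg(1) t(2)]) simp
  have pr: "rapid (fourier_coeff p)"
    by (rule all_square_summable_imp_rapid, rule square_summable_weight_mono[OF reg(2) t(3)]) simp
  show "u \<in> Cinfdot_per_vec"
    using u ur by (auto simp: Cinfdot_per_vec_def Hdot_per_sigma_def Hdot_per_vec_def Hdot_per_def H_per_iff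
        intro!: Cinfdot_perI)
  show "p \<in> Cinfdot_per"
    using p pr by (auto simp: Hdot_per_def H_per_iff intro!: Cinfdot_perI)
qed

end
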